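(* Let $B$ and $B'$ be braids with $sl(B)=sl(B')$, and let $\Sigma$ be a sequence of Markov moves from $B$ to $B'$ (resp. of Reidemeister moves from $\widehat B$ to $\widehat{B'}$). Let $$\Phi_\Sigma:C^{\bullet,\bullet}_{BN}(\widehat B)\to C^{\bullet,\bullet}_{BN}(\widehat{B'}),\qquad \phi_\Sigma:C^\bullet_{TLee}(\widehat B)\to C^\bullet_{TLee}(\widehat{B'})$$ be the chain maps induced by $\Sigma$. Then $$\Phi_\Sigma(\beta(B))=\beta(B')\iff\phi_\Sigma(\psi^+(B))=\psi^+(B')$$ and $$\Phi_\Sigma(\overline\beta(B))=\overline\beta(B')\iff\phi_\Sigma(\psi^-(B))=\psi^-(B').$$
   Context: **Algebras.** $\mathbb F$ is a field. $BN$ is the Frobenius algebra over $R=\mathbb F[U]$ with $A=\mathbb F[U][X]/(X^2-UX)$, counit $\epsilon(1)=0,\epsilon(X)=1$ and coproduct $\Delta(1)=1\otimes X+X\otimes1-U\,1\otimes1$, $\Delta(X)=X\otimes X$; it is graded by $\deg1=1$, $\deg X=-1$, $\deg U=-2$. $TLee$ is obtained by setting $U=1$ (over $R=\mathbb F$). Denote by $m$ the product and $\iota:R\to A$ the unit. Put $x_\circ=X$, $x_\bullet=X-U$ (with $U=1$ for $TLee$). **Complex.** Rotate a crossing of a link diagram so that the over-strand runs from SW to NE; its $0$-resolution joins SW to NW and SE to NE, its $1$-resolution joins SW to SE and NW to NE. A resolution $\underline r$ of an oriented diagram $D$ is the set of planar circles obtained by resolving every crossing; $|\underline r|$ is the number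 of $1$-resolutions used. Write $\underline r\prec\underline s$ if they differ at exactly one crossing, $0$-resolved in $\underline r$ and $1$-resolved in $\underline s$. A sign function assigns $\pm1$ to each pair $\underline r\prec\underline s$ so that for each square $\underline s_0\prec\underline s_1,\underline s_2\prec\underline s_3$ the sign products along the two paths are opposite. Put $A_{\underline r}=\bigotimes_{\gamma\in\underline r}A_\gamma$ (one copy of $A$ per circle, tensor over $R$), $C^i_{\mathcal F}(D)=\bigoplus_{|\underline r|-n_-(D)=i}A_{\underline r}$, and $d$ on $A_{\underline r}$ is $\sum_{\underline r\prec\underline s}\mathsf{sgn}(\underline r,\underline s)d_{\underline r}^{\underline s}$, where $d_{\underline r}^{\underline s}$ applies $m$ to the labels of merging circles or $\Delta$ to that of a splitting circle. Here $n_\pm(D)$ are the numbers of positive/negative crossings. An enhanced state is an element $\bigotimes_\gamma\alpha_\gamma\in A_{\underline r}$. The quantum degree on $C_{BN}(D)$ is $\mathrm{qdeg}(\bigotimes\alpha_\gamma)=\sum\deg\alpha_\gamma-2n_-(D)+n_+(D)+|\underline r|$ for homogeneous labels; it gives the second grading. Setting $U=1$ gives $\pi_{TLee}:C_{BN}(D)\to C_{TLee}(D)$. **Invariants.** For a circle $\gamma$ of the oriented resolution $\underline r$ of $D$, $N(\gamma)\in\mathbb Z/2$ is the number mod 2 of intersections of the circles of $\underline r$ with a generic path to infinity starting at a point of $\gamma$ pushed slightly to its left. For a braid $B$ with closure $\widehat B$, $\beta(B)\in C_{BN}^{0}(\widehat B)$ is the enhanced state on the oriented resolution with label $x_\circ$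 on $\gamma$ if $N(\gamma)=0$ and $x_\bullet$ if $N(\gamma)=1$; $\overline\beta(B)$ is obtained by exchanging $x_\circ$ and $x_\bullet$. The Lipshitz–Ng–Sarkar invariants $\psi^+(B),\psi^-(B)\in C^0_{TLee}(\widehat B)$ are the elements defined in the same way with the $TLee$ labels, from $\beta$ and $\overline\beta$ respectively (so $\psi^+(B)=\pi_{TLee}(\beta(B))$, $\psi^-(B)=\pi_{TLee}(\overline\beta(B))$). $sl(B)=w(B)-b(B)$, the writhe minus the number of strands. **Induced maps.** Markov moves are braid relations, conjugations, positive and negative (de)stabilizations ($B\in B_m\leftrightarrow B\sigma_m^{\pm1}\in B_{m+1}$); each corresponds to Reidemeister moves on closures: braid relations and conjugations to second and third moves (and planar isotopies), a stabilization to adding a curl of the corresponding sign. The map of a sequence is the composition of the maps below, which are given by the same formulas, with the same choices of signs and homotopies, for $BN$ and $TLee$ (so $\phi_\Sigma$ is $\Phi_\Sigma$ with $U$ set to $1$). Complexes with different sign functions are identified by isomorphisms acting by $\pm\mathrm{id}$ on each $A_{\underline r}$ (the same for $BN$ and $TLee$). $\mathbf S(\cdot,\mathbf e)$ is the saddle map along an arc $\mathbf e$ (apply $m$ if its endpoints are on distinct circles, $\Delta$ otherwise). *$R_1^+$*: adding a positive curl to $D$ on the circle $\gamma'$ gives $D'_+$, with $C(D'_+)=(C(D)\otimes A)\oplus C(D)(-1)$ (new crossing $0$-, $1$-resolved). $\Phi_1^+(\bigotimes\alpha_\gamma)=\big(\bigotimes_{\gamma\neq\gamma'}\alpha_\gamma\big)\otimes\big(\alpha_{\gamma'}\otimes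 m(\Delta(1))-\Delta(\alpha_{\gamma'})\big)\oplus0$; the inverse move has map $\Psi_1^+((x\otimes a)\oplus y)=\epsilon(a)x$. *$R_2$*: $D''$ is obtained from $D$ by inserting crossings $c_1,c_2$ between arcs $\mathbf a,\mathbf b$ (any orientations); $D''_{ij}$ is $D''$ with $c_1$ $i$-resolved and $c_2$ $j$-resolved, named so that $D''_{10}=D$ and $D''_{01}$ contains a small circle $\gamma''$. $\Psi_2:C(D)\to C(D'')$ is $x\mapsto0\oplus x\oplus\pm(\mathbf S(x,\mathbf e)\otimes\iota(1)_{\gamma''})\oplus0$ (components $00,10,01,11$), $\mathbf e$ joining $\mathbf a$ and $\mathbf b$, and $\Phi_2:C(D'')\to C(D)$ is $x_{00}\oplus x_{10}\oplus x_{01}\oplus x_{11}\mapsto x_{10}\pm\epsilon(x_{\gamma''})\mathbf S(x_{01},\mathbf g)$, where $x_{\gamma''}$ is the label of $\gamma''$, $\gamma''$ is then removed and $\mathbf g$ joins the other two local arcs of $D''_{01}$; signs are those making them chain maps. *$R_1^-$*: adding a negative curl has map $\Phi_1^-(x)=0\oplus(x\otimes\iota(1))$ (new crossing $0$-resolved gives $D$, $1$-resolved gives $D\sqcup\bigcirc$); removing it has map $\Psi_1^-$, the composition of $\Phi_1^+$, creating a positive curl on the loop, with the map of the (non-coherent) second move cancelling the two crossings; it is a homotopy inverse of $\Phi_1^-$ up to sign. *$R_3$*: $R_3^\circ$ replaces locally $D=\sigma_2^{-1}\sigma_1\sigma_2$ by $D'=\sigma_1\sigma_2\sigma_1^{-1}$,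 and $R_3^\bullet$ is the same move with the orientations of the two strands other than the topmost one reversed. With $c$ the middle crossing and $D_i$ the $i$-resolution at $c$, $C(D)=\mathrm{Cone}(\mathbf S:C(D_0)\to C(D_1))$; $D_0$ is related by an $R_2$ to a diagram $D''$ without local crossings, with maps $f=\Phi_2:C(D_0)\to C(D'')$, $g=\Psi_2$ and a homotopy $h$ with $fg=\mathrm{id}$, $gf-\mathrm{id}=dh+hd$, $hg=0$. Put $\Phi(x,y)=(fx,y\pm\mathbf Shx)\in\mathrm{Cone}(\mathbf Sg)$ and $\Psi(x,y)=(gx,y)$, and similarly $\Phi',\Psi'$ for $D'$; the two cones are identified since $D_1,D_1'$ are planar isotopic. The maps are $\Psi'\circ\Phi:C(D)\to C(D')$ and $\Psi\circ\Phi':C(D')\to C(D)$. Maps of other third moves are compositions of these and of second move maps. All these maps preserve the homological degree and, for $BN$, the quantum degree. *)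

theory Defs
  imports "HOL-Computational_Algebra.Polynomial"
begin

section \<open>The Frobenius algebras\<close>

text \<open>
  The pair \<open>(a, b)\<close> stands for \<open>a + b X\<close> in \<open>A = R[X]/(X\<^sup>2 - u X)\<close>.  For \<open>BN\<close> one takes
  \<open>R = F[U]\<close>, i.e. the type \<open>'f poly\<close>, and \<open>u = U\<close>; for \<open>TLee\<close> one takes \<open>R = F\<close> and \<open>u = 1\<close>.
  A Boolean names a basis vector: \<open>True\<close> for \<open>X\<close>, \<open>False\<close> for \<open>1\<close>.
\<close>

type_synonym 'r alg = "'r \<times> 'r"

definition alg_one :: "'r::comm_ring_1 alg" where
  "alg_one = (1, 0)"

definition alg_X :: "'r::comm_ring_1 alg" where
  "alg_X = (0, 1)"

definition alg_X_minus :: "'r::comm_ring_1 \<Rightarrow> 'r alg" where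
  "alg_X_minus u = (- u, 1)"

definition alg_basis :: "bool \<Rightarrow> 'r::comm_ring_1 alg" where
  "alg_basis x = (if x then alg_X else alg_one)"

definition alg_coeff :: "'r::comm_ring_1 alg \<Rightarrow> bool \<Rightarrow> 'r" where
  "alg_coeff v x = (if x then snd v else fst v)"

definition alg_mult :: "'r::comm_ring_1 \<Rightarrow> 'r alg \<Rightarrow> 'r alg \<Rightarrow> 'r alg" where
  "alg_mult u v w =
     (fst v * fst w, fst v * snd w + snd v * fst w + u * snd v * snd w)"

definition alg_counit :: "'r::comm_ring_1 alg \<Rightarrow> 'r" where
  "alg_counit v = snd v"

text \<open>\<open>alg_comult u v y z\<close> is the coefficient of \<open>y \<otimes> z\<close> in \<open>\<Delta>(v)\<close>.\<close>

definition alg_comult :: "'r::comm_ring_1 \<Rightarrow> 'r alg \<Rightarrow> bool \<Rightarrow> bool \<Rightarrow> 'r" where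
  "alg_comult u v y z =
     fst v * (if y \<and> z then 0 else if y \<or> z then 1 else - u)
     + snd v * (if y \<and> z then 1 else 0)"

definition mult_coeff :: "'r::comm_ring_1 \<Rightarrow> bool \<Rightarrow> bool \<Rightarrow> bool \<Rightarrow> 'r" where
  "mult_coeff u x y z = alg_coeff (alg_mult u (alg_basis x) (alg_basis y)) z"

definition comult_coeff :: "'r::comm_ring_1 \<Rightarrow> bool \<Rightarrow> bool \<Rightarrow> bool \<Rightarrow> 'r" where
  "comult_coeff u x y z = alg_comult u (alg_basis x) y z"

definition mult_comult_one_coeff :: "'r::comm_ring_1 \<Rightarrow> bool \<Rightarrow> 'r" where
  "mult_comult_one_coeff u z =
     (\<Sum>x\<in>UNIV. \<Sum>y\<in>UNIV. alg_comult u alg_one x y * mult_coeff u x y z)"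

definition bn_U :: "'f::field poly" where
  "bn_U = [:0, 1:]"


section \<open>Oriented link diagrams\<close>

text \<open>
  A diagram in the plane in general position with respect to the height function is a word of
  elementary slices, read from bottom to top.  Positions count strands from the left, starting
  at 0.  \<open>Cup i b\<close> is a local minimum creating strands at positions \<open>i\<close> and \<open>i + 1\<close>, the left one
  oriented upwards iff \<open>b\<close>; \<open>Cap i\<close> is a local maximum joining the strands at \<open>i\<close> and \<open>i + 1\<close>;
  \<open>Cross i k\<close> is a crossing of these two strands, in which the strand going from lower left to
  upper right is the over-strand iff \<open>k\<close>.
\<close>

datatype slice = Cup nat bool | Cap nat | Cross nat bool

type_synonym diagram = "slice list"

text \<open>The strands at a level are listed by their orientations: \<open>True\<close> is upwards.\<close>

fun slice_fits :: "slice \<Rightarrow> bool list \<Rightarrow> bool" where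
  "slice_fits (Cup i b) st = (i \<le> length st)"
| "slice_fits (Cap i) st = (i + 1 < length st \<and> st ! i \<noteq> st ! (i + 1))"
| "slice_fits (Cross i k) st = (i + 1 < length st)"

fun slice_step :: "slice \<Rightarrow> bool list \<Rightarrow> bool list" where
  "slice_step (Cup i b) st = take i st @ [b, \<not> b] @ drop i st"
| "slice_step (Cap i) st = take i st @ drop (i + 2) st"
| "slice_step (Cross i k) st = st[i := st ! (i + 1), i + 1 := st ! i]"

definition strands :: "diagram \<Rightarrow> nat \<Rightarrow> bool list" where
  "strands D l = fold slice_step (take l D) []"

definition link_diagram :: "diagram \<Rightarrow> bool" where
  "link_diagram D \<longleftrightarrow>
     (\<forall>l<length D. slice_fits (D ! l) (strands D l)) \<and> strands D (length D) = []"

definition crossings :: "diagram \<Rightarrow> nat set" where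
  "crossings D = {l. l < length D \<and> (\<exists>i k. D ! l = Cross i k)}"

definition positive_crossing :: "diagram \<Rightarrow> nat \<Rightarrow> bool" where
  "positive_crossing D l \<longleftrightarrow> l < length D \<and>
     (\<exists>i k. D ! l = Cross i k \<and> k = (strands D l ! i = strands D l ! (i + 1)))"

definition pos_crossings :: "diagram \<Rightarrow> nat set" where
  "pos_crossings D = {l \<in> crossings D. positive_crossing D l}"

definition neg_crossings :: "diagram \<Rightarrow> nat set" where
  "neg_crossings D = {l \<in> crossings D. \<not> positive_crossing D l}"


section \<open>Resolutions\<close>

text \<open>
  A resolution is given by the set of its 1-resolved crossings; crossings are named by their
  level.  Rotating the picture, the 0-resolution of \<open>Cross i k\<close> is vertical if \<open>k\<close> and horizontal
  otherwise.
\<close>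

type_synonym resolution = "nat set"
type_synonym point = "nat \<times> nat"

fun slice_bonds :: "slice \<Rightarrow> bool \<Rightarrow> nat \<Rightarrow> nat \<Rightarrow> (point \<times> point) set" where
  "slice_bonds (Cup i b) one l n =
     {((l, p), (l + 1, p)) | p. p < i} \<union> {((l, p), (l + 1, p + 2)) | p. i \<le> p \<and> p < n}
     \<union> {((l + 1, i), (l + 1, i + 1))}"
| "slice_bonds (Cap i) one l n =
     {((l, p), (l + 1, p)) | p. p < i} \<union> {((l, p + 2), (l + 1, p)) | p. i \<le> p \<and> p + 2 < n}
     \<union> {((l, i), (l, i + 1))}"
| "slice_bonds (Cross i k) one l n =
     {((l, p), (l + 1, p)) | p. p < n \<and> (p \<notin> {i, i + 1} \<or> k = (\<not> one))}
     \<union> (if k = (\<not> one) then {} else {((l, i), (l, i + 1)), ((l + 1, i), (l + 1, i + 1))})"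

text \<open>
  The point \<open>(l, p)\<close> is the intersection of the strand at position \<open>p\<close> with the horizontal line
  just below slice \<open>l\<close>.  A circle of a resolution is represented by the set of its points.
\<close>

definition points :: "diagram \<Rightarrow> point set" where
  "points D = {(l, p). l \<le> length D \<and> p < length (strands D l)}"

definition bonds :: "diagram \<Rightarrow> resolution \<Rightarrow> (point \<times> point) set" where
  "bonds D r = (\<Union>l<length D. slice_bonds (D ! l) (l \<in> r) l (length (strands D l)))"

definition circle :: "diagram \<Rightarrow> resolution \<Rightarrow> point \<Rightarrow> point set" where
  "circle D r z = {y. (z, y) \<in> (bonds D r \<union> (bonds D r)\<inverse>)\<^sup>*}"

definition circles :: "diagram \<Rightarrow> resolution \<Rightarrow> point set set" where
  "circles D r = circle D r ` points D"

definition precedes :: "diagram \<Rightarrow> resolution \<Rightarrow> resolution \<Rightarrow> bool" where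
  "precedes D r t \<longleftrightarrow> r \<subseteq> crossings D \<and> (\<exists>l \<in> crossings D - r. t = insert l r)"

type_synonym signs = "resolution \<Rightarrow> resolution \<Rightarrow> int"

definition sign_function :: "diagram \<Rightarrow> signs \<Rightarrow> bool" where
  "sign_function D s \<longleftrightarrow>
     (\<forall>r t. precedes D r t \<longrightarrow> s r t \<in> {1, -1}) \<and>
     (\<forall>r0 r1 r2 r3. precedes D r0 r1 \<and> precedes D r1 r3 \<and> precedes D r0 r2 \<and> precedes D r2 r3
        \<and> r1 \<noteq> r2 \<longrightarrow> s r0 r1 * s r1 r3 = - (s r0 r2 * s r2 r3))"

text \<open>
  An orientation-respecting smoothing is the 0-resolution at a positive crossing and the
  1-resolution at a negative one.
\<close>

definition oriented_resolution :: "diagram \<Rightarrow> resolution" where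
  "oriented_resolution D = neg_crossings D"


section \<open>The chain complexes\<close>

text \<open>
  A generator \<open>(r, L)\<close> is the tensor product with factor \<open>X\<close> on the circles in \<open>L\<close> and factor \<open>1\<close>
  on the other circles of \<open>r\<close>.  A chain is its family of coefficients.
\<close>

type_synonym generator = "resolution \<times> point set set"
type_synonym 'r chain = "generator \<Rightarrow> 'r"

definition generators :: "diagram \<Rightarrow> generator set" where
  "generators D = {(r, L). r \<subseteq> crossings D \<and> L \<subseteq> circles D r}"

definition chains :: "diagram \<Rightarrow> 'r::comm_ring_1 chain set" where
  "chains D = {x. \<forall>g. g \<notin> generators D \<longrightarrow> x g = 0}"

text \<open>\<open>K g g'\<close> is the coefficient of \<open>g'\<close> in the image of \<open>g\<close>.\<close>

definition linear_map ::
  "diagram \<Rightarrow> diagram \<Rightarrow> (generator \<Rightarrow> generator \<Rightarrow> 'r::comm_ring_1) \<Rightarrow> 'r chain \<Rightarrow> 'r chain" where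
  "linear_map D D' K x =
     (\<lambda>g'. if g' \<in> generators D' then (\<Sum>g\<in>generators D. K g g' * x g) else 0)"

definition has_X :: "generator \<Rightarrow> point \<Rightarrow> bool" where
  "has_X g z \<longleftrightarrow> z \<in> \<Union>(snd g)"

text \<open>
  The coefficient of a saddle on the affected circles.  Before the saddle the circles at the ends
  of its arc pass through \<open>p\<close> and \<open>q\<close>, afterwards the new arcs pass through \<open>p'\<close> and \<open>q'\<close>; \<open>c\<close> and
  \<open>c'\<close> give the circle through a point.  For a diagram in the plane \<open>c p = c q\<close> is equivalent to
  \<open>c' p' \<noteq> c' q'\<close>, so that the last case does not arise.
\<close>

definition saddle_coeff ::
  "'r::comm_ring_1 \<Rightarrow> (point \<Rightarrow> point set) \<Rightarrow> (point \<Rightarrow> point set) \<Rightarrow> generator \<Rightarrow> generator \<Rightarrow>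
   point \<Rightarrow> point \<Rightarrow> point \<Rightarrow> point \<Rightarrow> 'r" where
  "saddle_coeff u c c' g g' p q p' q' =
     (if c p \<noteq> c q \<and> c' p' = c' q' then mult_coeff u (has_X g p) (has_X g q) (has_X g' p')
      else if c p = c q \<and> c' p' \<noteq> c' q' then comult_coeff u (has_X g p) (has_X g' p') (has_X g' q')
      else 0)"

text \<open>
  Suppose that \<open>D = P @ M @ Q\<close> and \<open>D' = P @ M' @ Q\<close>, where \<open>P\<close>, \<open>M\<close>, \<open>M'\<close> have lengths \<open>a\<close>, \<open>n\<close>, \<open>n'\<close>.
  \<open>same_outside a n n' S g g'\<close> says that the generators \<open>g\<close> of \<open>D\<close> and \<open>g'\<close> of \<open>D'\<close> have the same
  labels at corresponding points outside of \<open>M\<close>, \<open>M'\<close> (including their boundaries), except possibly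
  on \<open>S\<close>.  \<open>transport a n n' \<rho> r\<close> transports a resolution; crossing \<open>j\<close> of \<open>M\<close> corresponds to crossing
  \<open>\<rho> j\<close> of \<open>M'\<close>.
\<close>

definition same_outside ::
  "nat \<Rightarrow> nat \<Rightarrow> nat \<Rightarrow> point set \<Rightarrow> generator \<Rightarrow> generator \<Rightarrow> bool" where
  "same_outside a n n' S g g' \<longleftrightarrow>
     (\<forall>l l' p. (l \<le> a \<and> l' = l \<or> a + n \<le> l \<and> l' + n = l + n') \<and> (l, p) \<notin> S
        \<longrightarrow> has_X g (l, p) = has_X g' (l', p))"

definition transport :: "nat \<Rightarrow> nat \<Rightarrow> nat \<Rightarrow> (nat \<Rightarrow> nat) \<Rightarrow> resolution \<Rightarrow> resolution" where
  "transport a n n' \<rho> r =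
     {l \<in> r. l < a} \<union> {a + \<rho> j | j. j < n \<and> a + j \<in> r} \<union> {a + n' + j | j. a + n + j \<in> r}"

definition edge_coeff ::
  "'r::comm_ring_1 \<Rightarrow> diagram \<Rightarrow> generator \<Rightarrow> generator \<Rightarrow> point \<Rightarrow> point \<Rightarrow> point \<Rightarrow> point \<Rightarrow> 'r" where
  "edge_coeff u D g g' p q p' q' =
     (let c = circle D (fst g); c' = circle D (fst g') in
      if same_outside 0 0 0 (c p \<union> c q) g g' then saddle_coeff u c c' g g' p q p' q' else 0)"

definition differential ::
  "'r::comm_ring_1 \<Rightarrow> diagram \<Rightarrow> signs \<Rightarrow> 'r chain \<Rightarrow> 'r chain" where
  "differential u D s = linear_map D D (\<lambda>g g'. \<Sum>l<length D.
     case D ! l of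
       Cross i k \<Rightarrow>
         if l \<notin> fst g \<and> fst g' = insert l (fst g) then
           of_int (s (fst g) (fst g')) *
           (if k then edge_coeff u D g g' (l, i) (l, i + 1) (l, i) (l + 1, i)
            else edge_coeff u D g g' (l, i) (l + 1, i) (l, i) (l, i + 1))
         else 0
     | _ \<Rightarrow> 0)"

definition chain_map ::
  "'r::comm_ring_1 \<Rightarrow> diagram \<Rightarrow> signs \<Rightarrow> diagram \<Rightarrow> signs \<Rightarrow> ('r chain \<Rightarrow> 'r chain) \<Rightarrow> bool" where
  "chain_map u D s D' s' f \<longleftrightarrow>
     (\<forall>x\<in>chains D. f (differential u D s x) = differential u D' s' (f x))"

text \<open>
  The bidegree of a generator; a coefficient \<open>U\<^sup>n\<close> contributes \<open>-2 n\<close> to the quantum degree.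
\<close>

definition label_degree :: "diagram \<Rightarrow> generator \<Rightarrow> int" where
  "label_degree D g = (\<Sum>\<gamma>\<in>circles D (fst g). if \<gamma> \<in> snd g then -1 else 1)"

definition hdeg :: "diagram \<Rightarrow> generator \<Rightarrow> int" where
  "hdeg D g = int (card (fst g)) - int (card (neg_crossings D))"

definition qdeg :: "diagram \<Rightarrow> generator \<Rightarrow> int" where
  "qdeg D g = label_degree D g - 2 * int (card (neg_crossings D))
     + int (card (pos_crossings D)) + int (card (fst g))"


section \<open>Signs and planar isotopies\<close>

text \<open>The sign function induced on a face of the cube of resolutions.\<close>

definition face_signs :: "(resolution \<Rightarrow> resolution) \<Rightarrow> signs \<Rightarrow> signs" where
  "face_signs e s = (\<lambda>r t. s (e r) (e t))"

definition sign_choice :: "(resolution \<Rightarrow> int) \<Rightarrow> bool" where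
  "sign_choice \<tau> \<longleftrightarrow> (\<forall>r. \<tau> r \<in> {1, -1})"

definition sign_map :: "(resolution \<Rightarrow> int) \<Rightarrow> 'r::comm_ring_1 chain \<Rightarrow> 'r chain" where
  "sign_map \<tau> x = (\<lambda>g. of_int (\<tau> (fst g)) * x g)"

fun at_position :: "slice \<Rightarrow> nat \<Rightarrow> slice" where
  "at_position (Cup i b) j = Cup j b"
| "at_position (Cap i) j = Cap j"
| "at_position (Cross i k) j = Cross j k"

fun position :: "slice \<Rightarrow> nat" where
  "position (Cup i b) = i"
| "position (Cap i) = i"
| "position (Cross i k) = i"

fun strands_below :: "slice \<Rightarrow> nat" where
  "strands_below (Cup i b) = 0"
| "strands_below (Cap i) = 2"
| "strands_below (Cross i k) = 2"

fun strands_above :: "slice \<Rightarrow> nat" where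
  "strands_above (Cup i b) = 2"
| "strands_above (Cap i) = 0"
| "strands_above (Cross i k) = 2"

text \<open>
  Elementary planar isotopies with the correspondence of crossings: changing the relative height of
  two slices side by side, creating or cancelling a maximum and a minimum, and turning a
  crossing around a minimum or maximum.
\<close>

inductive elementary_isotopy :: "diagram \<Rightarrow> diagram \<Rightarrow> (nat \<Rightarrow> nat) \<Rightarrow> bool" where
  exchange: "elementary_isotopy
     [x, at_position y (position x + strands_above x + j)]
     [at_position y (position x + strands_below x + j), x] (\<lambda>m. 1 - m)"
| zigzag_right: "elementary_isotopy [Cup i b, Cap (i + 1)] [] id"
| zigzag_left: "elementary_isotopy [Cup (i + 1) b, Cap i] [] id"
| turn_cup: "elementary_isotopy [Cup i b, Cross (i + 1) k] [Cup (i + 1) b, Cross i (\<not> k)] id"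
| turn_cap: "elementary_isotopy [Cross (i + 1) k, Cap i] [Cross i (\<not> k), Cap (i + 1)] id"
| reverse: "elementary_isotopy M M' \<rho> \<Longrightarrow> elementary_isotopy M' M \<rho>"

definition isotopy_map ::
  "diagram \<Rightarrow> diagram \<Rightarrow> diagram \<Rightarrow> diagram \<Rightarrow> (nat \<Rightarrow> nat) \<Rightarrow> 'r::comm_ring_1 chain \<Rightarrow> 'r chain" where
  "isotopy_map P M M' Q \<rho> =
     (let a = length P; n = length M; n' = length M' in
      linear_map (P @ M @ Q) (P @ M' @ Q) (\<lambda>g g'.
        of_bool (fst g' = transport a n n' \<rho> (fst g) \<and> same_outside a n n' {} g g')))"


section \<open>First moves\<close>

text \<open>
  The curl at position \<open>i\<close> is positive iff \<open>k\<close>; its loop passes through the point \<open>(a + 1, i + 1)\<close>,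
  where \<open>a\<close> is the length of \<open>P\<close>.  All other curls differ from these by planar isotopies.
\<close>

definition curl :: "nat \<Rightarrow> bool \<Rightarrow> bool \<Rightarrow> diagram" where
  "curl i b k = [Cup (i + 1) b, Cross i k, Cap (i + 1)]"

definition add_curl :: "diagram \<Rightarrow> nat \<Rightarrow> bool \<Rightarrow> bool \<Rightarrow> diagram \<Rightarrow> diagram" where
  "add_curl P i b k Q = P @ curl i b k @ Q"

definition R1_pos_map ::
  "'r::comm_ring_1 \<Rightarrow> diagram \<Rightarrow> nat \<Rightarrow> bool \<Rightarrow> diagram \<Rightarrow> 'r chain \<Rightarrow> 'r chain" where
  "R1_pos_map u P i b Q =
     (let a = length P in
      linear_map (P @ Q) (add_curl P i b True Q) (\<lambda>g g'.
        if fst g' = transport a 0 3 id (fst g) \<and>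
           same_outside a 0 3 (circle (P @ Q) (fst g) (a, i)) g g'
        then let x = has_X g (a, i); y = has_X g' (a, i); z = has_X g' (a + 1, i + 1) in
             of_bool (x = y) * mult_comult_one_coeff u z - comult_coeff u x y z
        else 0))"

definition R1_pos_inv_map ::
  "diagram \<Rightarrow> nat \<Rightarrow> bool \<Rightarrow> diagram \<Rightarrow> 'r::comm_ring_1 chain \<Rightarrow> 'r chain" where
  "R1_pos_inv_map P i b Q =
     (let a = length P in
      linear_map (add_curl P i b True Q) (P @ Q) (\<lambda>g g'.
        if fst g = transport a 0 3 id (fst g') \<and> same_outside a 3 0 {} g g'
        then alg_counit (alg_basis (has_X g (a + 1, i + 1)))
        else 0))"

definition R1_neg_resolution :: "nat \<Rightarrow> resolution \<Rightarrow> resolution" where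
  "R1_neg_resolution a r = insert (a + 1) (transport a 0 3 id r)"

definition R1_neg_map ::
  "diagram \<Rightarrow> nat \<Rightarrow> bool \<Rightarrow> diagram \<Rightarrow> 'r::comm_ring_1 chain \<Rightarrow> 'r chain" where
  "R1_neg_map P i b Q =
     (let a = length P in
      linear_map (P @ Q) (add_curl P i b False Q) (\<lambda>g g'.
        if fst g' = R1_neg_resolution a (fst g) \<and> same_outside a 0 3 {} g g'
        then alg_coeff alg_one (has_X g' (a + 1, i + 1))
        else 0))"


section \<open>Second moves\<close>

text \<open>
  Of the two crossings \<open>c\<^sub>1\<close>, \<open>c\<^sub>2\<close> the first one is the one of the form \<open>Cross i False\<close>, because
  then the diagram without the two crossings is the 10-resolution, which is vertical at both
  crossings.  The small circle of the 01-resolution passes through \<open>(a + 1, i)\<close>.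
\<close>

definition add_bigon :: "diagram \<Rightarrow> nat \<Rightarrow> bool \<Rightarrow> diagram \<Rightarrow> diagram" where
  "add_bigon P i k Q = P @ [Cross i k, Cross i (\<not> k)] @ Q"

definition resolution_10 :: "nat \<Rightarrow> bool \<Rightarrow> resolution \<Rightarrow> resolution" where
  "resolution_10 a k r = insert (if k then a + 1 else a) (transport a 0 2 id r)"

definition resolution_01 :: "nat \<Rightarrow> bool \<Rightarrow> resolution \<Rightarrow> resolution" where
  "resolution_01 a k r = insert (if k then a else a + 1) (transport a 0 2 id r)"

definition R2_map ::
  "'r::comm_ring_1 \<Rightarrow> diagram \<Rightarrow> nat \<Rightarrow> bool \<Rightarrow> diagram \<Rightarrow> (resolution \<Rightarrow> int) \<Rightarrow> 'r chain \<Rightarrow> 'r chain"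
  where
  "R2_map u P i k Q \<tau> =
     (let a = length P in
      linear_map (P @ Q) (add_bigon P i k Q) (\<lambda>g g'.
        let c = circle (P @ Q) (fst g); c' = circle (add_bigon P i k Q) (fst g') in
        if fst g' = resolution_10 a k (fst g) then of_bool (same_outside a 0 2 {} g g')
        else if fst g' = resolution_01 a k (fst g) \<and>
          same_outside a 0 2 (c (a, i) \<union> c (a, i + 1)) g g'
        then of_int (\<tau> (fst g))
          * saddle_coeff u c c' g g' (a, i) (a, i + 1) (a, i) (a + 2, i)
          * alg_coeff alg_one (has_X g' (a + 1, i))
        else 0))"

definition R2_inv_map ::
  "'r::comm_ring_1 \<Rightarrow> diagram \<Rightarrow> nat \<Rightarrow> bool \<Rightarrow> diagram \<Rightarrow> (resolution \<Rightarrow> int) \<Rightarrow> 'r chain \<Rightarrow> 'r chain"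
  where
  "R2_inv_map u P i k Q \<tau> =
     (let a = length P in
      linear_map (add_bigon P i k Q) (P @ Q) (\<lambda>g g'.
        let c = circle (add_bigon P i k Q) (fst g); c' = circle (P @ Q) (fst g') in
        if fst g = resolution_10 a k (fst g') then of_bool (same_outside a 2 0 {} g g')
        else if fst g = resolution_01 a k (fst g') \<and>
          same_outside a 2 0 (c (a, i) \<union> c (a + 2, i)) g g'
        then of_int (\<tau> (fst g'))
          * alg_counit (alg_basis (has_X g (a + 1, i)))
          * saddle_coeff u c c' g g' (a, i) (a + 2, i) (a, i) (a, i + 1)
        else 0))"

text \<open>The signs are chosen for \<open>BN\<close>; the same signs are then used for \<open>TLee\<close>.\<close>

definition R2_signs ::
  "'f::field itself \<Rightarrow> diagram \<Rightarrow> nat \<Rightarrow> bool \<Rightarrow> diagram \<Rightarrow> signs \<Rightarrow> (resolution \<Rightarrow> int) \<Rightarrow> bool" where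
  "R2_signs _ P i k Q s \<tau> \<longleftrightarrow> sign_choice \<tau> \<and>
     chain_map (bn_U :: 'f poly) (P @ Q) (face_signs (resolution_10 (length P) k) s)
       (add_bigon P i k Q) s (R2_map bn_U P i k Q \<tau>)"

definition R2_inv_signs ::
  "'f::field itself \<Rightarrow> diagram \<Rightarrow> nat \<Rightarrow> bool \<Rightarrow> diagram \<Rightarrow> signs \<Rightarrow> (resolution \<Rightarrow> int) \<Rightarrow> bool" where
  "R2_inv_signs _ P i k Q s \<tau> \<longleftrightarrow> sign_choice \<tau> \<and>
     chain_map (bn_U :: 'f poly) (add_bigon P i k Q) s
       (P @ Q) (face_signs (resolution_10 (length P) k) s) (R2_inv_map bn_U P i k Q \<tau>)"


section \<open>Third moves\<close>

text \<open>
  \<open>triple i\<close> and \<open>triple' i\<close> describe \<open>\<sigma>\<^sub>2\<inverse> \<sigma>\<^sub>1 \<sigma>\<^sub>2\<close> and \<open>\<sigma>\<^sub>1 \<sigma>\<^sub>2 \<sigma>\<^sub>1\<inverse>\<close> on the strands at positions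
  \<open>i, i + 1, i + 2\<close>: \<open>(p, k, q)\<close> encodes \<open>[Cross p k, Cross q True, Cross p (\<not> k)]\<close>.  The vertical
  resolution of the middle crossing, at level \<open>a + 1\<close>, is the 0-resolution, and gives the
  diagram \<open>add_bigon P p k Q\<close>.  That diagram and \<open>P @ Q\<close> need not inherit a consistent orientation;
  their complexes and differentials do not depend on it.
\<close>

type_synonym triple = "nat \<times> bool \<times> nat"

definition triple :: "nat \<Rightarrow> triple" where
  "triple i = (i + 1, False, i)"

definition triple' :: "nat \<Rightarrow> triple" where
  "triple' i = (i, True, i + 1)"

fun add_triple :: "diagram \<Rightarrow> triple \<Rightarrow> diagram \<Rightarrow> diagram" where
  "add_triple P (p, k, q) Q = P @ [Cross p k, Cross q True, Cross p (\<not> k)] @ Q"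

fun R3_zero :: "diagram \<Rightarrow> triple \<Rightarrow> diagram \<Rightarrow> diagram" where
  "R3_zero P (p, k, q) Q = add_bigon P p k Q"

definition R3_zero_signs :: "diagram \<Rightarrow> signs \<Rightarrow> signs" where
  "R3_zero_signs P s = face_signs (transport (length P + 1) 0 1 id) s"

fun R3_base_signs :: "diagram \<Rightarrow> triple \<Rightarrow> signs \<Rightarrow> signs" where
  "R3_base_signs P (p, k, q) s = face_signs (resolution_10 (length P) k) (R3_zero_signs P s)"

definition R3_to_zero ::
  "diagram \<Rightarrow> triple \<Rightarrow> diagram \<Rightarrow> 'r::comm_ring_1 chain \<Rightarrow> 'r chain" where
  "R3_to_zero P T Q =
     (let c = length P + 1 in
      linear_map (add_triple P T Q) (R3_zero P T Q) (\<lambda>g g'.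
        of_bool (fst g = transport c 0 1 id (fst g') \<and> same_outside c 1 0 {} g g')))"

definition R3_from_zero ::
  "diagram \<Rightarrow> triple \<Rightarrow> diagram \<Rightarrow> 'r::comm_ring_1 chain \<Rightarrow> 'r chain" where
  "R3_from_zero P T Q =
     (let c = length P + 1 in
      linear_map (R3_zero P T Q) (add_triple P T Q) (\<lambda>g g'.
        of_bool (fst g' = transport c 0 1 id (fst g) \<and> same_outside c 0 1 {} g g')))"

definition one_part :: "diagram \<Rightarrow> 'r::comm_ring_1 chain \<Rightarrow> 'r chain" where
  "one_part P x = (\<lambda>g. if length P + 1 \<in> fst g then x g else 0)"

definition R3_saddle ::
  "'r::comm_ring_1 \<Rightarrow> diagram \<Rightarrow> triple \<Rightarrow> diagram \<Rightarrow> signs \<Rightarrow> 'r chain \<Rightarrow> 'r chain" where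
  "R3_saddle u P T Q s x =
     one_part P (differential u (add_triple P T Q) s (R3_from_zero P T Q x))"

fun R3_f :: "'r::comm_ring_1 \<Rightarrow> diagram \<Rightarrow> triple \<Rightarrow> diagram \<Rightarrow> (resolution \<Rightarrow> int) \<Rightarrow> 'r chain \<Rightarrow> 'r chain"
  where "R3_f u P (p, k, q) Q \<tau> = R2_inv_map u P p k Q \<tau>"

fun R3_g :: "'r::comm_ring_1 \<Rightarrow> diagram \<Rightarrow> triple \<Rightarrow> diagram \<Rightarrow> (resolution \<Rightarrow> int) \<Rightarrow> 'r chain \<Rightarrow> 'r chain"
  where "R3_g u P (p, k, q) Q \<tau> = R2_map u P p k Q \<tau>"

text \<open>
  Elements of \<open>Cone(S g)\<close> are pairs of a chain of \<open>P @ Q\<close> and a chain of \<open>add_triple P T Q\<close> supported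
  on the 1-resolution of the middle crossing.  As the sign function already makes \<open>S\<close>
  anticommute with the differentials, no further sign appears in the differential of the cone.
\<close>

definition R3_cone ::
  "diagram \<Rightarrow> triple \<Rightarrow> diagram \<Rightarrow> ('r::comm_ring_1 chain \<times> 'r chain) set" where
  "R3_cone P T Q =
     {(x, y). x \<in> chains (P @ Q) \<and> y \<in> chains (add_triple P T Q) \<and> one_part P y = y}"

definition R3_cone_differential ::
  "'r::comm_ring_1 \<Rightarrow> diagram \<Rightarrow> triple \<Rightarrow> diagram \<Rightarrow> signs \<Rightarrow> (resolution \<Rightarrow> int) \<Rightarrow>
   'r chain \<times> 'r chain \<Rightarrow> 'r chain \<times> 'r chain" where
  "R3_cone_differential u P T Q s \<tau>g = (\<lambda>(x, y).
     (differential u (P @ Q) (R3_base_signs P T s) x,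
      \<lambda>g. R3_saddle u P T Q s (R3_g u P T Q \<tau>g x) g
           + differential u (add_triple P T Q) s y g))"

definition R3_Phi ::
  "'r::comm_ring_1 \<Rightarrow> diagram \<Rightarrow> triple \<Rightarrow> diagram \<Rightarrow> signs \<Rightarrow> (resolution \<Rightarrow> int) \<Rightarrow>
   ('r chain \<Rightarrow> 'r chain) \<Rightarrow> int \<Rightarrow> 'r chain \<Rightarrow> 'r chain \<times> 'r chain" where
  "R3_Phi u P T Q s \<tau>f h e z =
     (let x = R3_to_zero P T Q z in
      (R3_f u P T Q \<tau>f x, \<lambda>g. one_part P z g + of_int e * R3_saddle u P T Q s (h x) g))"

definition R3_Psi ::
  "'r::comm_ring_1 \<Rightarrow> diagram \<Rightarrow> triple \<Rightarrow> diagram \<Rightarrow> (resolution \<Rightarrow> int) \<Rightarrow>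
   'r chain \<times> 'r chain \<Rightarrow> 'r chain" where
  "R3_Psi u P T Q \<tau>g = (\<lambda>(x, y). \<lambda>g. R3_from_zero P T Q (R3_g u P T Q \<tau>g x) g + y g)"

text \<open>
  The identification of the two cones: the 1-resolutions of the middle crossings are planar
  isotopic, with corresponding crossings at the same levels.
\<close>

definition R3_identify ::
  "diagram \<Rightarrow> triple \<Rightarrow> triple \<Rightarrow> diagram \<Rightarrow> (resolution \<Rightarrow> int) \<Rightarrow> (resolution \<Rightarrow> int) \<Rightarrow>
   'r::comm_ring_1 chain \<times> 'r chain \<Rightarrow> 'r chain \<times> 'r chain" where
  "R3_identify P T T' Q \<tau>0 \<tau>1 = (\<lambda>(x, y).
     (sign_map \<tau>0 x,
      linear_map (add_triple P T Q) (add_triple P T' Q) (\<lambda>g g'.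
        of_bool (length P + 1 \<in> fst g \<and> fst g' = fst g \<and> same_outside (length P) 3 3 {} g g')
        * of_int (\<tau>1 (fst g))) y))"

text \<open>
  A homotopy is given by its matrix \<open>H\<close> over \<open>F[U]\<close>.  It lowers the homological degree by one and
  preserves the quantum degree; only differences of degrees enter, so orientations do not matter.
\<close>

definition bn_graded_homotopy :: "diagram \<Rightarrow> (generator \<Rightarrow> generator \<Rightarrow> 'f::field poly) \<Rightarrow> bool" where
  "bn_graded_homotopy D H \<longleftrightarrow>
     (\<forall>g\<in>generators D. \<forall>g'\<in>generators D. \<forall>n. coeff (H g g') n \<noteq> 0 \<longrightarrow>
        hdeg D g' = hdeg D g - 1 \<and> qdeg D g' - 2 * int n = qdeg D g)"

definition set_U_one :: "(generator \<Rightarrow> generator \<Rightarrow> 'f::field poly) \<Rightarrow> generator \<Rightarrow> generator \<Rightarrow> 'f" where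
  "set_U_one H g g' = poly (H g g') 1"

definition R3_homotopy ::
  "diagram \<Rightarrow> triple \<Rightarrow> diagram \<Rightarrow> signs \<Rightarrow> (resolution \<Rightarrow> int) \<Rightarrow> (resolution \<Rightarrow> int) \<Rightarrow>
   (generator \<Rightarrow> generator \<Rightarrow> 'f::field poly) \<Rightarrow> bool" where
  "R3_homotopy P T Q s \<tau>f \<tau>g H \<longleftrightarrow>
     (let E = R3_zero P T Q; h = linear_map E E H; d = differential bn_U E (R3_zero_signs P s);
          f = R3_f bn_U P T Q \<tau>f; g = R3_g bn_U P T Q \<tau>g in
      bn_graded_homotopy E H \<and>
      (\<forall>x\<in>chains (P @ Q). f (g x) = x \<and> h (g x) = (\<lambda>_. 0)) \<and>
      (\<forall>x\<in>chains E. \<forall>y. g (f x) y - x y = d (h x) y + h (d x) y))"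

fun R3_signs ::
  "'f::field itself \<Rightarrow> diagram \<Rightarrow> triple \<Rightarrow> diagram \<Rightarrow> signs \<Rightarrow> (resolution \<Rightarrow> int) \<Rightarrow>
   (resolution \<Rightarrow> int) \<Rightarrow> bool" where
  "R3_signs F P (p, k, q) Q s \<tau>f \<tau>g \<longleftrightarrow>
     R2_inv_signs F P p k Q (R3_zero_signs P s) \<tau>f \<and> R2_signs F P p k Q (R3_zero_signs P s) \<tau>g"

text \<open>
  \<open>R3_maps P T T' Q s s' \<Phi> \<phi>\<close>: the maps \<open>\<Phi>\<close> for \<open>BN\<close> and \<open>\<phi>\<close> for \<open>TLee\<close> are obtained with one and the
  same choice of signs and homotopy.
\<close>

definition R3_maps ::
  "diagram \<Rightarrow> triple \<Rightarrow> triple \<Rightarrow> diagram \<Rightarrow> signs \<Rightarrow> signs \<Rightarrow>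
   ('f::field poly chain \<Rightarrow> 'f poly chain) \<Rightarrow> ('f chain \<Rightarrow> 'f chain) \<Rightarrow> bool" where
  "R3_maps P T T' Q s s' \<Phi> \<phi> \<longleftrightarrow>
     (\<exists>\<tau>f \<tau>g \<tau>f' \<tau>g' \<tau>0 \<tau>1 e (H :: generator \<Rightarrow> generator \<Rightarrow> 'f poly).
        R3_signs TYPE('f) P T Q s \<tau>f \<tau>g \<and> R3_signs TYPE('f) P T' Q s' \<tau>f' \<tau>g' \<and>
        R3_homotopy P T Q s \<tau>f \<tau>g H \<and>
        e \<in> {1, -1} \<and>
        (let E = R3_zero P T Q; \<Phi>0 = R3_Phi bn_U P T Q s \<tau>f (linear_map E E H) e in
         \<forall>z\<in>chains (add_triple P T Q).
           \<Phi>0 (differential bn_U (add_triple P T Q) s z)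
             = R3_cone_differential bn_U P T Q s \<tau>g (\<Phi>0 z)) \<and>
        sign_choice \<tau>0 \<and> sign_choice \<tau>1 \<and>
        (\<forall>v\<in>R3_cone P T Q.
           R3_identify P T T' Q \<tau>0 \<tau>1 (R3_cone_differential (bn_U :: 'f poly) P T Q s \<tau>g v)
             = R3_cone_differential bn_U P T' Q s' \<tau>g' (R3_identify P T T' Q \<tau>0 \<tau>1 v)) \<and>
        \<Phi> = R3_Psi bn_U P T' Q \<tau>g' \<circ> R3_identify P T T' Q \<tau>0 \<tau>1
             \<circ> R3_Phi bn_U P T Q s \<tau>f
                 (linear_map (R3_zero P T Q) (R3_zero P T Q) H) e \<and>
        \<phi> = R3_Psi 1 P T' Q \<tau>g' \<circ> R3_identify P T T' Q \<tau>0 \<tau>1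
             \<circ> R3_Phi 1 P T Q s \<tau>f
                 (linear_map (R3_zero P T Q) (R3_zero P T Q) (set_U_one H)) e)"


section \<open>Maps induced by sequences of Reidemeister moves\<close>

text \<open>
  \<open>R3 o\<close> replaces \<open>\<sigma>\<^sub>2\<inverse> \<sigma>\<^sub>1 \<sigma>\<^sub>2\<close> by \<open>\<sigma>\<^sub>1 \<sigma>\<^sub>2 \<sigma>\<^sub>1\<inverse>\<close>.  The topmost strand starts at position \<open>i\<close>; the
  other two strands are reversed in \<open>R3_bullet\<close>.
\<close>

datatype R3_type = R3_circ | R3_bullet

datatype move =
    Sign_Change | Isotopy
  | R1_pos | R1_pos_inv | R1_neg | R1_neg_inv
  | R2 | R2_inv
  | R3 R3_type | R3_inv R3_type

fun R3_orientation :: "R3_type \<Rightarrow> bool list" where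
  "R3_orientation R3_circ = [True, True, True]"
| "R3_orientation R3_bullet = [True, False, False]"

type_synonym signed_diagram = "diagram \<times> signs"

fun signed_link_diagram :: "signed_diagram \<Rightarrow> bool" where
  "signed_link_diagram (D, s) \<longleftrightarrow> link_diagram D \<and> sign_function D s"

inductive single_move_maps ::
  "move \<Rightarrow> signed_diagram \<Rightarrow> signed_diagram \<Rightarrow>
   ('f::field poly chain \<Rightarrow> 'f poly chain) \<Rightarrow> ('f chain \<Rightarrow> 'f chain) \<Rightarrow> bool" where
  sign_change:
  "\<lbrakk>signed_link_diagram (D, s); signed_link_diagram (D, s'); sign_choice \<tau>;
    \<And>r t. precedes D r t \<Longrightarrow> s' r t * \<tau> r = \<tau> t * s r t\<rbrakk>
   \<Longrightarrow> single_move_maps Sign_Change (D, s) (D, s') (sign_map \<tau>) (sign_map \<tau>)"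
| isotopy:
  "\<lbrakk>elementary_isotopy M M' \<rho>; D = P @ M @ Q; D' = P @ M' @ Q;
    s = face_signs (transport (length P) (length M) (length M') \<rho>) s';
    signed_link_diagram (D, s); signed_link_diagram (D', s')\<rbrakk>
   \<Longrightarrow> single_move_maps Isotopy (D, s) (D', s')
         (isotopy_map P M M' Q \<rho>) (isotopy_map P M M' Q \<rho>)"
| R1_pos:
  "\<lbrakk>D' = add_curl P i b True Q; s = face_signs (transport (length P) 0 3 id) s';
    signed_link_diagram (P @ Q, s); signed_link_diagram (D', s')\<rbrakk>
   \<Longrightarrow> single_move_maps R1_pos (P @ Q, s) (D', s')
         (R1_pos_map bn_U P i b Q) (R1_pos_map 1 P i b Q)"
| R1_pos_inv:
  "\<lbrakk>D' = add_curl P i b True Q; s = face_signs (transport (length P) 0 3 id) s';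
    signed_link_diagram (P @ Q, s); signed_link_diagram (D', s')\<rbrakk>
   \<Longrightarrow> single_move_maps R1_pos_inv (D', s') (P @ Q, s)
         (R1_pos_inv_map P i b Q) (R1_pos_inv_map P i b Q)"
| R1_neg:
  "\<lbrakk>D' = add_curl P i b False Q; s = face_signs (R1_neg_resolution (length P)) s';
    signed_link_diagram (P @ Q, s); signed_link_diagram (D', s')\<rbrakk>
   \<Longrightarrow> single_move_maps R1_neg (P @ Q, s) (D', s')
         (R1_neg_map P i b Q) (R1_neg_map P i b Q)"
| R2:
  "\<lbrakk>D' = add_bigon P i k Q; s = face_signs (resolution_10 (length P) k) s';
    signed_link_diagram (P @ Q, s); signed_link_diagram (D', s');
    R2_signs TYPE('f) P i k Q s' \<tau>\<rbrakk>
   \<Longrightarrow> single_move_maps R2 (P @ Q, s) (D', s')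
         (R2_map bn_U P i k Q \<tau>) (R2_map 1 P i k Q \<tau>)"
| R2_inv:
  "\<lbrakk>D' = add_bigon P i k Q; s = face_signs (resolution_10 (length P) k) s';
    signed_link_diagram (P @ Q, s); signed_link_diagram (D', s');
    R2_inv_signs TYPE('f) P i k Q s' \<tau>\<rbrakk>
   \<Longrightarrow> single_move_maps R2_inv (D', s') (P @ Q, s)
         (R2_inv_map bn_U P i k Q \<tau>) (R2_inv_map 1 P i k Q \<tau>)"
| R3:
  "\<lbrakk>D = add_triple P (triple i) Q; D' = add_triple P (triple' i) Q;
    take 3 (drop i (strands D (length P))) = R3_orientation ty;
    signed_link_diagram (D, s); signed_link_diagram (D', s');
    R3_maps P (triple i) (triple' i) Q s s' \<Phi> \<phi>\<rbrakk>
   \<Longrightarrow> single_move_maps (R3 ty) (D, s) (D', s') \<Phi> \<phi>"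
| R3_inv:
  "\<lbrakk>D = add_triple P (triple i) Q; D' = add_triple P (triple' i) Q;
    take 3 (drop i (strands D (length P))) = R3_orientation ty;
    signed_link_diagram (D, s); signed_link_diagram (D', s');
    R3_maps P (triple' i) (triple i) Q s' s \<Phi> \<phi>\<rbrakk>
   \<Longrightarrow> single_move_maps (R3_inv ty) (D', s') (D, s) \<Phi> \<phi>"

inductive isotopy_sequence_maps ::
  "signed_diagram \<Rightarrow> signed_diagram \<Rightarrow>
   ('f::field poly chain \<Rightarrow> 'f poly chain) \<Rightarrow> ('f chain \<Rightarrow> 'f chain) \<Rightarrow> bool" where
  "signed_link_diagram A \<Longrightarrow> isotopy_sequence_maps A A id id"
| "\<lbrakk>isotopy_sequence_maps A B \<Phi> \<phi>; m \<in> {Isotopy, Sign_Change}; single_move_maps m B C \<Phi>' \<phi>'\<rbrakk>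
   \<Longrightarrow> isotopy_sequence_maps A C (\<Phi>' \<circ> \<Phi>) (\<phi>' \<circ> \<phi>)"

text \<open>
  In the rule for \<open>R1_neg_inv\<close> a positive curl is created on the right-hand side of the loop; after
  planar isotopies its crossing and the crossing to be removed bound a bigon, which is cancelled
  by a second move.  For any other sequence of third moves, one writes it in terms of \<open>R3\<close>,
  \<open>R3_inv\<close> and second moves.
\<close>

inductive reidemeister_maps ::
  "move list \<Rightarrow> signed_diagram \<Rightarrow> signed_diagram \<Rightarrow>
   ('f::field poly chain \<Rightarrow> 'f poly chain) \<Rightarrow> ('f chain \<Rightarrow> 'f chain) \<Rightarrow> bool" where
  no_move:
  "signed_link_diagram A \<Longrightarrow> reidemeister_maps [] A A id id"
| single_move:
  "\<lbrakk>single_move_maps m A B \<Phi> \<phi>; reidemeister_maps \<Sigma> B C \<Phi>' \<phi>'\<rbrakk>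
   \<Longrightarrow> reidemeister_maps (m # \<Sigma>) A C (\<Phi>' \<circ> \<Phi>) (\<phi>' \<circ> \<phi>)"
| R1_neg_inv:
  "\<lbrakk>D = add_curl P i b False Q;
    s = face_signs (transport (length P + 1) 0 3 id) s1;
    D1 = add_curl (P @ [Cup (i + 1) b]) (i + 2) (\<not> b) True ([Cross i False, Cap (i + 1)] @ Q);
    signed_link_diagram (D, s); signed_link_diagram (D1, s1);
    \<Phi>1 = R1_pos_map bn_U (P @ [Cup (i + 1) b]) (i + 2) (\<not> b) ([Cross i False, Cap (i + 1)] @ Q);
    \<phi>1 = R1_pos_map 1 (P @ [Cup (i + 1) b]) (i + 2) (\<not> b) ([Cross i False, Cap (i + 1)] @ Q);
    D2 = add_bigon (P @ [Cup i b]) (i + 1) True ([Cup (i + 3) (\<not> b), Cap (i + 2), Cap (i + 1)] @ Q);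
    isotopy_sequence_maps (D1, s1) (D2, s2) \<Phi>2 \<phi>2;
    R2_inv_signs TYPE('f) (P @ [Cup i b]) (i + 1) True
      ([Cup (i + 3) (\<not> b), Cap (i + 2), Cap (i + 1)] @ Q) s2 \<tau>;
    \<Phi>3 = R2_inv_map bn_U (P @ [Cup i b]) (i + 1) True
      ([Cup (i + 3) (\<not> b), Cap (i + 2), Cap (i + 1)] @ Q) \<tau>;
    \<phi>3 = R2_inv_map 1 (P @ [Cup i b]) (i + 1) True
      ([Cup (i + 3) (\<not> b), Cap (i + 2), Cap (i + 1)] @ Q) \<tau>;
    D3 = P @ [Cup i b, Cup (i + 3) (\<not> b), Cap (i + 2), Cap (i + 1)] @ Q;
    isotopy_sequence_maps (D3, face_signs (resolution_10 (length P + 1) True) s2) (P @ Q, s4) \<Phi>4 \<phi>4;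
    reidemeister_maps \<Sigma> (P @ Q, s4) C \<Phi>' \<phi>'\<rbrakk>
   \<Longrightarrow> reidemeister_maps (R1_neg_inv # \<Sigma>) (D, s) C
         (\<Phi>' \<circ> (\<Phi>4 \<circ> \<Phi>3 \<circ> \<Phi>2 \<circ> \<Phi>1)) (\<phi>' \<circ> (\<phi>4 \<circ> \<phi>3 \<circ> \<phi>2 \<circ> \<phi>1))"


section \<open>Braids and Markov moves\<close>

text \<open>
  A braid is the number of its strands with a braid word; the letters \<open>(i, True)\<close> and \<open>(i, False)\<close>
  are \<open>\<sigma>\<^sub>i\<close> and its inverse.  Braids are oriented upwards and are closed to the right.
\<close>

type_synonym braid = "nat \<times> (nat \<times> bool) list"

definition is_braid :: "braid \<Rightarrow> bool" where
  "is_braid B \<longleftrightarrow> 1 \<le> fst B \<and> (\<forall>(i, b) \<in> set (snd B). 1 \<le> i \<and> i < fst B)"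

definition braid_closure :: "braid \<Rightarrow> diagram" where
  "braid_closure B =
     map (\<lambda>j. Cup j True) [0..<fst B]
     @ map (\<lambda>(i, b). Cross (i - 1) b) (snd B)
     @ map Cap (rev [0..<fst B])"

definition writhe :: "braid \<Rightarrow> int" where
  "writhe B = (\<Sum>(i, b)\<leftarrow>snd B. if b then 1 else -1)"

definition sl :: "braid \<Rightarrow> int" where
  "sl B = writhe B - int (fst B)"

inductive braid_relation :: "(nat \<times> bool) list \<Rightarrow> (nat \<times> bool) list \<Rightarrow> bool" where
  "braid_relation [(i, b), (i, \<not> b)] []"
| "i + 2 \<le> j \<or> j + 2 \<le> i \<Longrightarrow> braid_relation [(i, b), (j, c)] [(j, c), (i, b)]"
| "braid_relation [(i, True), (i + 1, True), (i, True)] [(i + 1, True), (i, True), (i + 1, True)]"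

text \<open>\<open>markov_move B K B'\<close>: the set \<open>K\<close> consists of the kinds of Reidemeister moves used to realise it.\<close>

definition second_third_moves :: "move set" where
  "second_third_moves =
     {R2, R2_inv, R3 R3_circ, R3 R3_bullet, R3_inv R3_circ, R3_inv R3_bullet}"

inductive markov_move :: "braid \<Rightarrow> move set \<Rightarrow> braid \<Rightarrow> bool" where
  "braid_relation x y \<Longrightarrow> markov_move (n, v @ x @ w) second_third_moves (n, v @ y @ w)"
| "braid_relation x y \<Longrightarrow> markov_move (n, v @ y @ w) second_third_moves (n, v @ x @ w)"
| "markov_move (n, w) second_third_moves (n, [(i, b)] @ w @ [(i, \<not> b)])"
| "markov_move (n, [(i, b)] @ w @ [(i, \<not> b)]) second_third_moves (n, w)"
| "markov_move (n, w) {R1_pos} (n + 1, w @ [(n, True)])"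
| "markov_move (n + 1, w @ [(n, True)]) {R1_pos_inv} (n, w)"
| "markov_move (n, w) {R1_neg} (n + 1, w @ [(n, False)])"
| "markov_move (n + 1, w @ [(n, False)]) {R1_neg_inv} (n, w)"

inductive markov_maps ::
  "braid list \<Rightarrow> braid \<times> signs \<Rightarrow> braid \<times> signs \<Rightarrow>
   ('f::field poly chain \<Rightarrow> 'f poly chain) \<Rightarrow> ('f chain \<Rightarrow> 'f chain) \<Rightarrow> bool" where
  "\<lbrakk>is_braid B; signed_link_diagram (braid_closure B, s)\<rbrakk>
   \<Longrightarrow> markov_maps [B] (B, s) (B, s) id id"
| "\<lbrakk>is_braid B; is_braid B1; markov_move B K B1; set \<Sigma> \<subseteq> K \<union> {Isotopy, Sign_Change};
    reidemeister_maps \<Sigma> (braid_closure B, s) (braid_closure B1, s1) \<Phi> \<phi>;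
    markov_maps \<Lambda> (B1, s1) (B', s') \<Phi>' \<phi>'\<rbrakk>
   \<Longrightarrow> markov_maps (B # \<Lambda>) (B, s) (B', s') (\<Phi>' \<circ> \<Phi>) (\<phi>' \<circ> \<phi>)"


section \<open>The invariants\<close>

text \<open>
  The coefficients of an enhanced state with labels \<open>\<alpha>\<close> in terms of the generators.
\<close>

definition enhanced_state ::
  "diagram \<Rightarrow> resolution \<Rightarrow> (point set \<Rightarrow> 'r::comm_ring_1 alg) \<Rightarrow> 'r chain" where
  "enhanced_state D r \<alpha> = (\<lambda>g.
     if fst g = r \<and> g \<in> generators D
     then \<Prod>\<gamma>\<in>circles D r. alg_coeff (\<alpha> \<gamma>) (\<gamma> \<in> snd g)
     else 0)"

text \<open>
  The path to infinity is the horizontal one going to the left.  Starting at \<open>(l, p)\<close>, pushed to the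
  left of the oriented strand, it meets the \<open>p\<close> strands further left, and in addition the strand
  itself if that strand is oriented downwards.
\<close>

definition path_intersections :: "diagram \<Rightarrow> point \<Rightarrow> nat" where
  "path_intersections D z =
     (case z of (l, p) \<Rightarrow> if strands D l ! p then p else p + 1)"

definition N_odd :: "diagram \<Rightarrow> point set \<Rightarrow> bool" where
  "N_odd D \<gamma> \<longleftrightarrow> odd (path_intersections D (SOME z. z \<in> \<gamma>))"

definition x_circ :: "'r::comm_ring_1 alg" where
  "x_circ = alg_X"

definition x_bullet :: "'r::comm_ring_1 \<Rightarrow> 'r alg" where
  "x_bullet u = alg_X_minus u"

definition plus_state :: "'r::comm_ring_1 \<Rightarrow> braid \<Rightarrow> 'r chain" where
  "plus_state u B =
     (let D = braid_closure B in
      enhanced_state D (oriented_resolution D) (\<lambda>\<gamma>. if N_odd D \<gamma> then x_bullet u else x_circ))"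

definition minus_state :: "'r::comm_ring_1 \<Rightarrow> braid \<Rightarrow> 'r chain" where
  "minus_state u B =
     (let D = braid_closure B in
      enhanced_state D (oriented_resolution D) (\<lambda>\<gamma>. if N_odd D \<gamma> then x_circ else x_bullet u))"

definition \<beta> :: "braid \<Rightarrow> 'f::field poly chain" where
  "\<beta> B = plus_state bn_U B"

definition \<beta>_bar :: "braid \<Rightarrow> 'f::field poly chain" where
  "\<beta>_bar B = minus_state bn_U B"

definition \<psi>_plus :: "braid \<Rightarrow> 'f::field chain" where
  "\<psi>_plus B = plus_state 1 B"

definition \<psi>_minus :: "braid \<Rightarrow> 'f::field chain" where
  "\<psi>_minus B = minus_state 1 B"

end

theory Submission
  imports Defs
begin

text \<open>
  Setting \<open>U = 1\<close> loses nothing on homogeneous chains.  A coefficient in \<open>F[U]\<close> of a chain of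
  quantum degree \<open>q\<close> can only be a scalar multiple of the power of \<open>U\<close> that makes up the difference
  between \<open>q\<close> and the degree of the generator, and the scalar is recovered by setting \<open>U = 1\<close>
  (\<open>set_one_inj\<close>).  The states \<open>\<beta>\<close> and \<open>\<beta>_bar\<close> are homogeneous of quantum degree \<open>sl\<close>, because \<open>X\<close>
  and \<open>X - U\<close> both have degree -1 and the oriented resolution of a closed braid has one circle for
  each strand (\<open>braid_circles\<close>, \<open>homogeneous_states\<close>).  As \<open>sl B = sl B'\<close>, it remains to see that
  the maps for \<open>BN\<close> preserve the quantum degree and become the maps for \<open>TLee\<close> when \<open>U = 1\<close>
  (\<open>quantum_reidemeister\<close>, \<open>quantum_markov\<close>).

  The second property is visible from the matrices of the maps.  The first one is planar geometry:
  the degree of a generator is a sum over the circles of a resolution, so one has to know how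
  these circles change under a move.  Circles are treated as the components of a graph whose
  vertices are the points at the levels of a diagram.  A resolved diagram is a tangle
  without crossings, and a part of it may be replaced by another one that connects its boundary
  points in the same way and contains no closed circle (\<open>equivalent\<close>).  Since a horizontal resolution
  is a maximum followed by a minimum and a vertical one is nothing at all, all such replacements
  follow from three relations: straight strands may be dropped, zigzags may be pulled tight,
  and distant slices may be exchanged.  Where circles are created, merged or split, only
  those through a few known points are affected, and the degrees are compared for these
  alone (\<open>label_degree_compare\<close>).
\<close>

section \<open>Components of a graph\<close>

definition component :: "('v \<times> 'v) set \<Rightarrow> 'v \<Rightarrow> 'v set" where
  "component E z = {y. (z, y) \<in> (E \<union> E\<inverse>)\<^sup>*}"

lemma component_refl [simp]: "x \<in> component E x"
  by (simp add: component_def)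

lemma component_sym: "y \<in> component E x \<Longrightarrow> x \<in> component E y"
proof -
  assume "y \<in> component E x"
  then have "(x, y) \<in> (E \<union> E\<inverse>)\<^sup>*" by (simp add: component_def)
  then have "(y, x) \<in> ((E \<union> E\<inverse>)\<inverse>)\<^sup>*" by (simp add: rtrancl_converse)
  moreover have "(E \<union> E\<inverse>)\<inverse> = E \<union> E\<inverse>" by auto
  ultimately show ?thesis by (simp add: component_def)
qed

lemma component_trans: "y \<in> component E x \<Longrightarrow> z \<in> component E y \<Longrightarrow> z \<in> component E x"
  by (auto simp: component_def)

lemma component_eq_iff: "component E x = component E y \<longleftrightarrow> y \<in> component E x"
  by (metis component_refl component_sym component_trans subsetI subset_antisym)

lemma component_bond: "(x, y) \<in> E \<Longrightarrow> component E x = component E y"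
  unfolding component_eq_iff by (auto simp: component_def)

lemma component_induct [consumes 1, case_names refl step]:
  assumes "y \<in> component E x" "P x"
    and "\<And>y z. \<lbrakk>y \<in> component E x; P y; (y, z) \<in> E \<or> (z, y) \<in> E\<rbrakk> \<Longrightarrow> P z"
  shows "P y"
proof -
  have "(x, y) \<in> (E \<union> E\<inverse>)\<^sup>*" using assms(1) by (simp add: component_def)
  then show ?thesis
  proof (induction rule: rtrancl_induct)
    case (step y z)
    then have "y \<in> component E x" "(y, z) \<in> E \<or> (z, y) \<in> E" by (auto simp: component_def)
    then show ?case using step(3) assms(3) by blast
  qed (rule assms(2))
qed

lemma component_invariant:
  assumes "component E x = component E y" and "\<And>a b. (a, b) \<in> E \<Longrightarrow> f a = f b"
  shows "f x = f y"
proof -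
  from assms(1) have "y \<in> component E x" by (simp add: component_eq_iff)
  then show ?thesis
  proof (induction rule: component_induct)
    case (step y z)
    then show ?case using assms(2)[of y z] assms(2)[of z y] by metis
  qed simp
qed

lemma component_image:
  assumes "component E x = component E y" "map_prod f f ` E \<subseteq> E'"
  shows "component E' (f x) = component E' (f y)"
proof (rule component_invariant[OF assms(1), of "\<lambda>x. component E' (f x)"])
  show "component E' (f a) = component E' (f b)" if "(a, b) \<in> E" for a b
    using that assms(2) by (intro component_bond) force
qed

text \<open>
  Bonds changed within \<open>T\<close> affect only the components that meet \<open>T\<close>: a path that avoids \<open>T\<close>, or
  that has left \<open>T\<close> for the last time, is a path for both sets of bonds.
\<close>

lemma component_local_change:
  assumes "E - E' \<subseteq> T \<times> T" and "component E x \<inter> T = {}"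
  shows "component E x \<subseteq> component E' x"
proof
  fix y assume "y \<in> component E x"
  then show "y \<in> component E' x"
  proof (induction rule: component_induct)
    case (step y z)
    have "y \<notin> T" using step assms(2) by auto
    then have "(y, z) \<in> E' \<or> (z, y) \<in> E'" using step assms(1) by auto
    then show ?case using step component_bond by (metis component_eq_iff)
  qed simp
qed

lemma meets_local_change:
  assumes "E - E' \<subseteq> T \<times> T" and "component E x \<inter> T \<noteq> {}"
  shows "component E' x \<inter> T \<noteq> {}"
proof -
  obtain t where t: "t \<in> T" "x \<in> component E t"
    using assms(2) component_sym by fastforce
  from t(2) show ?thesis
  proof (induction rule: component_induct)
    case refl
    then show ?case using t(1) component_refl[of t E'] by blast
  next
    case (step y z)
    show ?case
    proof (cases "z \<in> T")
      case True
      then show ?thesis using component_refl[of z E'] by blast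
    next
      case False
      then have "(y, z) \<in> E' \<or> (z, y) \<in> E'" using step assms(1) by blast
      then show ?thesis using step component_bond by metis
    qed
  qed
qed

lemma component_local_change_eq:
  assumes "E - E' \<subseteq> T \<times> T" "E' - E \<subseteq> T \<times> T" "component E x \<inter> T = {}"
  shows "component E' x = component E x"
proof -
  have "component E' x \<inter> T = {}" using meets_local_change[OF assms(2)] assms(3) by blast
  then show ?thesis
    using component_local_change[OF assms(1,3)] component_local_change[OF assms(2)]
    by (intro subset_antisym) auto
qed


section \<open>Sums over components\<close>

text \<open>
  The common core of all comparisons of label degrees.  Outside of the finite families \<open>B\<close> and
  \<open>B'\<close> of affected circles, the circles on both sides are matched by a correspondence \<open>Z\<close> of the
  points that lie on them.
\<close>

lemma sum_matched_components:
  fixes h :: "'a set \<Rightarrow> int" and h' :: "'b set \<Rightarrow> int"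
  assumes "finite C" "finite C'" "B \<subseteq> C" "B' \<subseteq> C'"
    and left: "\<And>\<gamma>. \<gamma> \<in> C - B \<Longrightarrow> \<exists>(x, x')\<in>Z. c x = \<gamma>"
    and right: "\<And>\<gamma>. \<gamma> \<in> C' - B' \<Longrightarrow> \<exists>(x, x')\<in>Z. c' x' = \<gamma>"
    and Z: "\<And>x x'. (x, x') \<in> Z \<Longrightarrow> c x \<in> C - B \<and> c' x' \<in> C' - B' \<and> h (c x) = h' (c' x')"
    and eq: "\<And>x x' y y'. \<lbrakk>(x, x') \<in> Z; (y, y') \<in> Z\<rbrakk> \<Longrightarrow> c x = c y \<longleftrightarrow> c' x' = c' y'"
  shows "sum h C - sum h B = sum h' C' - sum h' B'"
proof -
  define F where "F \<gamma> = (SOME \<delta>. \<exists>(x, x')\<in>Z. c x = \<gamma> \<and> c' x' = \<delta>)" for \<gamma>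
  have F: "F (c x) = c' x'" if "(x, x') \<in> Z" for x x'
    unfolding F_def by (rule some_equality) (use that eq in \<open>auto\<close>)
  have "bij_betw F (C - B) (C' - B')"
  proof (rule bij_betw_imageI)
    show "inj_on F (C - B)"
    proof (rule inj_onI)
      fix \<gamma> \<delta> assume "\<gamma> \<in> C - B" "\<delta> \<in> C - B" and FF: "F \<gamma> = F \<delta>"
      obtain x x' where x: "(x, x') \<in> Z" "c x = \<gamma>" using left[OF \<open>\<gamma> \<in> C - B\<close>] by auto
      obtain y y' where y: "(y, y') \<in> Z" "c y = \<delta>" using left[OF \<open>\<delta> \<in> C - B\<close>] by auto
      show "\<gamma> = \<delta>" using FF F[OF x(1)] F[OF y(1)] x y eq[OF x(1) y(1)] by auto
    qed
    show "F ` (C - B) = C' - B'"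
    proof
      show "F ` (C - B) \<subseteq> C' - B'"
      proof
        fix d assume "d \<in> F ` (C - B)"
        then obtain \<gamma> where g: "\<gamma> \<in> C - B" "d = F \<gamma>" by auto
        obtain x x' where x: "(x, x') \<in> Z" "c x = \<gamma>" using left[OF g(1)] by auto
        show "d \<in> C' - B'" using g x F[OF x(1)] Z[OF x(1)] by auto
      qed
      show "C' - B' \<subseteq> F ` (C - B)"
      proof
        fix d assume "d \<in> C' - B'"
        then obtain x x' where x: "(x, x') \<in> Z" "c' x' = d" using right[of d] by auto
        show "d \<in> F ` (C - B)" using x F[OF x(1)] Z[OF x(1)] by (metis image_eqI)
      qed
    qed
  qed
  then have "(\<Sum>\<gamma>\<in>C - B. h' (F \<gamma>)) = sum h' (C' - B')" by (rule sum.reindex_bij_betw)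
  moreover have "sum h (C - B) = (\<Sum>\<gamma>\<in>C - B. h' (F \<gamma>))"
  proof (rule sum.cong)
    fix \<gamma> assume "\<gamma> \<in> C - B"
    then obtain x x' where x: "(x, x') \<in> Z" "c x = \<gamma>" using left[of \<gamma>] by auto
    then show "h \<gamma> = h' (F \<gamma>)" using F[OF x(1)] Z[OF x(1)] by simp
  qed simp
  moreover have "finite B" "finite B'" using assms(1-4) finite_subset by auto
  ultimately show ?thesis
    using assms(1-4) by (simp add: sum_diff)
qed


section \<open>Resolved tangles\<close>

type_synonym tangle = "(slice \<times> bool) list"

fun out_width :: "nat \<Rightarrow> slice \<Rightarrow> nat" where
  "out_width w (Cup i b) = w + 2"
| "out_width w (Cap i) = w - 2"
| "out_width w (Cross i k) = w"

fun fits_width :: "nat \<Rightarrow> slice \<Rightarrow> bool" where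
  "fits_width w (Cup i b) = (i \<le> w)"
| "fits_width w (Cap i) = (i + 1 < w)"
| "fits_width w (Cross i k) = (i + 1 < w)"

fun width :: "nat \<Rightarrow> tangle \<Rightarrow> nat" where
  "width w [] = w"
| "width w (x # T) = width (out_width w (fst x)) T"

fun fits :: "nat \<Rightarrow> tangle \<Rightarrow> bool" where
  "fits w [] = True"
| "fits w (x # T) = (fits_width w (fst x) \<and> fits (out_width w (fst x)) T)"

definition tangle_points :: "nat \<Rightarrow> tangle \<Rightarrow> point set" where
  "tangle_points w T = {(l, p). l \<le> length T \<and> p < width w (take l T)}"

definition tangle_bonds :: "nat \<Rightarrow> tangle \<Rightarrow> (point \<times> point) set" where
  "tangle_bonds w T =
     (\<Union>l<length T. slice_bonds (fst (T ! l)) (snd (T ! l)) l (width w (take l T)))"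

definition raise :: "nat \<Rightarrow> point \<Rightarrow> point" where
  "raise k = (\<lambda>(l, p). (l + k, p))"

lemma raise_simp [simp]: "raise k (l, p) = (l + k, p)"
  by (simp add: raise_def)

lemma width_append [simp]: "width w (S @ T) = width (width w S) T"
  by (induction S arbitrary: w) auto

lemma fits_append [simp]: "fits w (S @ T) \<longleftrightarrow> fits w S \<and> fits (width w S) T"
  by (induction S arbitrary: w) auto

lemma slice_bonds_raise:
  "slice_bonds s one (l + k) n = map_prod (raise k) (raise k) ` slice_bonds s one l n"
  by (cases s) (simp_all add: setcompr_eq_image image_Un image_image)

lemma tangle_bonds_append:
  "tangle_bonds w (S @ T) = tangle_bonds w S
     \<union> map_prod (raise (length S)) (raise (length S)) ` tangle_bonds (width w S) T"
proof -
  let ?b = "\<lambda>l. slice_bonds (fst ((S @ T) ! l)) (snd ((S @ T) ! l)) l (width w (take l (S @ T)))"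
  have "{..<length (S @ T)} = {..<length S} \<union> (\<lambda>l. l + length S) ` {..<length T}"
  proof (intro subset_antisym subsetI)
    fix l assume "l \<in> {..<length (S @ T)}"
    then have "l < length S \<or> l = (l - length S) + length S \<and> l - length S < length T" by auto
    then show "l \<in> {..<length S} \<union> (\<lambda>l. l + length S) ` {..<length T}" by blast
  qed auto
  then have "tangle_bonds w (S @ T)
      = (\<Union>l<length S. ?b l) \<union> (\<Union>l<length T. ?b (l + length S))"
    unfolding tangle_bonds_def by auto
  also have "(\<Union>l<length S. ?b l) = tangle_bonds w S"
    unfolding tangle_bonds_def by (intro SUP_cong) (auto simp: nth_append)
  also have "(\<Union>l<length T. ?b (l + length S))
      = map_prod (raise (length S)) (raise (length S)) ` tangle_bonds (width w S) T"
    unfolding tangle_bonds_def image_UN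
    by (intro SUP_cong refl, subst slice_bonds_raise[symmetric]) (simp add: nth_append)
  finally show ?thesis .
qed

lemma tangle_bonds_part:
  assumes "width 0 P = w"
  shows "tangle_bonds 0 (P @ M @ Q) = tangle_bonds 0 P
      \<union> map_prod (raise (length P)) (raise (length P)) ` tangle_bonds w M
      \<union> map_prod (raise (length P + length M)) (raise (length P + length M)) ` tangle_bonds (width w M) Q"
proof -
  have "raise (length P) \<circ> raise (length M) = raise (length P + length M)" by (auto simp: raise_def)
  then have "map_prod (raise (length P)) (raise (length P)) ` map_prod (raise (length M)) (raise (length M)) ` X
      = map_prod (raise (length P + length M)) (raise (length P + length M)) ` X" for X
    by (simp add: image_comp map_prod.comp)
  then show ?thesis using assms by (simp add: tangle_bonds_append image_Un Un_assoc)
qed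

lemma component_raise:
  assumes "component (tangle_bonds w M) u = component (tangle_bonds w M) v" "width 0 P = w"
  shows "component (tangle_bonds 0 (P @ M @ Q)) (raise (length P) u)
       = component (tangle_bonds 0 (P @ M @ Q)) (raise (length P) v)"
  by (rule component_image[OF assms(1)]) (unfold tangle_bonds_part[OF assms(2)], blast)

lemma tangle_bonds_simps [simp]:
  "tangle_bonds w [] = {}"
  "tangle_bonds w [x] = slice_bonds (fst x) (snd x) 0 w"
  "tangle_bonds w [x, y] = slice_bonds (fst x) (snd x) 0 w
     \<union> slice_bonds (fst y) (snd y) 1 (out_width w (fst x))"
  by (auto simp: tangle_bonds_def lessThan_Suc)

lemma slice_bonds_points:
  assumes "fits_width n s" "((l1, p1), (l2, p2)) \<in> slice_bonds s one l n"
  shows "(l1 = l \<and> p1 < n \<or> l1 = Suc l \<and> p1 < out_width n s) \<and>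
    (l2 = l \<and> p2 < n \<or> l2 = Suc l \<and> p2 < out_width n s)"
  using assms by (cases s) (auto split: if_splits)

lemma fits_nth:
  assumes "fits w T" "l < length T"
  shows "fits_width (width w (take l T)) (fst (T ! l))"
proof -
  have "fits w (take l T @ T ! l # drop (Suc l) T)" using assms by (simp add: id_take_nth_drop[symmetric])
  then show ?thesis by simp
qed

lemma width_take_Suc:
  "l < length T \<Longrightarrow> width w (take (Suc l) T) = out_width (width w (take l T)) (fst (T ! l))"
  by (simp add: take_Suc_conv_app_nth)

lemma tangle_bonds_subset:
  assumes "fits w T"
  shows "tangle_bonds w T \<subseteq> tangle_points w T \<times> tangle_points w T"
proof clarify
  fix l1 p1 l2 p2 assume "((l1, p1), (l2, p2)) \<in> tangle_bonds w T"
  then obtain l where l: "l < length T"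
    "((l1, p1), (l2, p2)) \<in> slice_bonds (fst (T ! l)) (snd (T ! l)) l (width w (take l T))"
    unfolding tangle_bonds_def by auto
  from slice_bonds_points[OF fits_nth[OF assms l(1)] l(2)]
  show "(l1, p1) \<in> tangle_points w T \<and> (l2, p2) \<in> tangle_points w T"
    using l(1) width_take_Suc[OF l(1), of w] by (auto simp: tangle_points_def)
qed

lemma finite_tangle_points: "finite (tangle_points w T)"
proof -
  have "tangle_points w T \<subseteq> (SIGMA l:{..length T}. {..<width w (take l T)})"
    by (auto simp: tangle_points_def)
  then show ?thesis by (rule finite_subset) auto
qed


section \<open>Replacing a part of a tangle\<close>

text \<open>
  The points outside of the part \<open>M\<close> of \<open>P @ M @ Q\<close> and those outside of the part \<open>M'\<close> of
  \<open>P @ M' @ Q\<close>, where \<open>P\<close>, \<open>M\<close>, \<open>M'\<close> have lengths \<open>a\<close>, \<open>n\<close>, \<open>n'\<close>.  If \<open>n = 0\<close>, then a point at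
  level \<open>a\<close> corresponds to a point below \<open>M'\<close> as well as to one above \<open>M'\<close>.
\<close>

definition corresponds :: "nat \<Rightarrow> nat \<Rightarrow> nat \<Rightarrow> point \<Rightarrow> point \<Rightarrow> bool" where
  "corresponds a n n' x x' \<longleftrightarrow> snd x' = snd x \<and>
     (fst x \<le> a \<and> fst x' = fst x \<or> a + n \<le> fst x \<and> fst x' + n = fst x + n')"

text \<open>
  Points outside of \<open>M\<close> that are connected remain so when \<open>M\<close> is replaced by \<open>M'\<close>.  The quantification
  over all surroundings \<open>P\<close>, \<open>Q\<close> makes this a relation that may be used in any context.
\<close>

definition simulates :: "nat \<Rightarrow> tangle \<Rightarrow> tangle \<Rightarrow> bool" where
  "simulates w M M' \<longleftrightarrow> (\<forall>P Q x x' y y'.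
     fits 0 (P @ M @ Q) \<and> fits 0 (P @ M' @ Q) \<and> width 0 P = w \<and>
     x \<in> tangle_points 0 (P @ M @ Q) \<and> y \<in> tangle_points 0 (P @ M @ Q) \<and>
     corresponds (length P) (length M) (length M') x x' \<and>
     corresponds (length P) (length M) (length M') y y' \<and>
     component (tangle_bonds 0 (P @ M @ Q)) x = component (tangle_bonds 0 (P @ M @ Q)) y \<longrightarrow>
     component (tangle_bonds 0 (P @ M' @ Q)) x' = component (tangle_bonds 0 (P @ M' @ Q)) y')"

text \<open>Excludes small circles inside \<open>M\<close>, which the connections of the points outside do not show.\<close>

definition covered :: "nat \<Rightarrow> tangle \<Rightarrow> bool" where
  "covered w M \<longleftrightarrow> (\<forall>P Q. fits 0 (P @ M @ Q) \<and> width 0 P = w \<longrightarrow>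
     (\<forall>x\<in>tangle_points 0 (P @ M @ Q). \<exists>y\<in>tangle_points 0 (P @ M @ Q).
        (fst y \<le> length P \<or> length P + length M \<le> fst y) \<and>
        component (tangle_bonds 0 (P @ M @ Q)) x = component (tangle_bonds 0 (P @ M @ Q)) y))"

definition equivalent :: "nat \<Rightarrow> tangle \<Rightarrow> tangle \<Rightarrow> bool" where
  "equivalent w M M' \<longleftrightarrow> fits w M \<and> fits w M' \<and> width w M = width w M' \<and>
     simulates w M M' \<and> simulates w M' M \<and> covered w M \<and> covered w M'"

lemma equivalent_sym: "equivalent w M M' \<Longrightarrow> equivalent w M' M"
  by (auto simp: equivalent_def)

lemma corresponding_point:
  assumes "corresponds (length P) (length M) (length M') x x'"
    and "x \<in> tangle_points w (P @ M @ Q)" "width (width w P) M = width (width w P) M'"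
  shows "x' \<in> tangle_points w (P @ M' @ Q)"
proof (cases x)
  case (Pair l p)
  show ?thesis
  proof (cases "l \<le> length P \<and> fst x' = l")
    case True
    then show ?thesis using assms Pair by (cases x') (auto simp: corresponds_def tangle_points_def)
  next
    case False
    then obtain j where "l = length P + length M + j"
      using assms(1) Pair by (auto simp: corresponds_def le_iff_add)
    then show ?thesis
      using False assms Pair by (cases x') (auto simp: corresponds_def tangle_points_def)
  qed
qed

lemma corresponds_trans:
  assumes "corresponds a n n'' x x''"
  obtains x' where "corresponds a n n' x x'" "corresponds a n' n'' x' x''"
proof (cases "fst x \<le> a \<and> fst x'' = fst x")
  case True
  then show ?thesis using that[of x] assms by (auto simp: corresponds_def)
next
  case False
  then obtain j where "fst x = a + n + j" "fst x'' = a + n'' + j" "snd x'' = snd x"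
    using assms by (auto simp: corresponds_def le_iff_add)
  then show ?thesis using that[of "(a + n' + j, snd x)"] by (auto simp: corresponds_def)
qed

lemma corresponds_context:
  assumes "corresponds a (k + n + m) (k + n' + m) x x'"
  shows "corresponds (a + k) n n' x x'"
  using assms by (auto simp: corresponds_def)

lemma simulates_context:
  assumes "simulates (width w A) M M'"
  shows "simulates w (A @ M @ B) (A @ M' @ B)"
  unfolding simulates_def
proof (intro allI impI, elim conjE)
  fix P Q x x' y y'
  assume *: "fits 0 (P @ (A @ M @ B) @ Q)" "fits 0 (P @ (A @ M' @ B) @ Q)" "width 0 P = w"
    "x \<in> tangle_points 0 (P @ (A @ M @ B) @ Q)" "y \<in> tangle_points 0 (P @ (A @ M @ B) @ Q)"
    "corresponds (length P) (length (A @ M @ B)) (length (A @ M' @ B)) x x'"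
    "corresponds (length P) (length (A @ M @ B)) (length (A @ M' @ B)) y y'"
    "component (tangle_bonds 0 (P @ (A @ M @ B) @ Q)) x
     = component (tangle_bonds 0 (P @ (A @ M @ B) @ Q)) y"
  have "corresponds (length (P @ A)) (length M) (length M') x x'"
    "corresponds (length (P @ A)) (length M) (length M') y y'"
    using *(6,7) corresponds_context[of "length P" "length A" "length M" "length B" "length M'"]
    by (simp_all add: add.assoc)
  then show "component (tangle_bonds 0 (P @ (A @ M' @ B) @ Q)) x'
     = component (tangle_bonds 0 (P @ (A @ M' @ B) @ Q)) y'"
    using assms[unfolded simulates_def, rule_format, of "P @ A" "B @ Q" x y x' y'] *
    by simp
qed

lemma simulates_trans:
  assumes "simulates w M M'" "simulates w M' M''"
    and "fits w M'" "width w M = width w M'" "width w M' = width w M''"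
  shows "simulates w M M''"
  unfolding simulates_def
proof (intro allI impI, elim conjE)
  fix P Q x x'' y y''
  assume *: "fits 0 (P @ M @ Q)" "fits 0 (P @ M'' @ Q)" "width 0 P = w"
    "x \<in> tangle_points 0 (P @ M @ Q)" "y \<in> tangle_points 0 (P @ M @ Q)"
    "corresponds (length P) (length M) (length M'') x x''"
    "corresponds (length P) (length M) (length M'') y y''"
    "component (tangle_bonds 0 (P @ M @ Q)) x = component (tangle_bonds 0 (P @ M @ Q)) y"
  obtain x' where x': "corresponds (length P) (length M) (length M') x x'"
    "corresponds (length P) (length M') (length M'') x' x''"
    using corresponds_trans[OF *(6)] by blast
  obtain y' where y': "corresponds (length P) (length M) (length M') y y'"
    "corresponds (length P) (length M') (length M'') y' y''"
    using corresponds_trans[OF *(7)] by blast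
  have "fits 0 (P @ M' @ Q)" using * assms by simp
  moreover have "x' \<in> tangle_points 0 (P @ M' @ Q)" "y' \<in> tangle_points 0 (P @ M' @ Q)"
    using corresponding_point x'(1) y'(1) * assms by blast+
  ultimately show "component (tangle_bonds 0 (P @ M'' @ Q)) x''
     = component (tangle_bonds 0 (P @ M'' @ Q)) y''"
    using assms(2)[unfolded simulates_def, rule_format, of P Q x' y' x'' y'']
      assms(1)[unfolded simulates_def, rule_format, of P Q x y x' y'] x' y' *
    by simp
qed

text \<open>
  A component of the whole tangle leaves \<open>M\<close>; the point where it does so survives the replacement of
  \<open>M\<close> by \<open>M'\<close>, and from there it leaves \<open>A @ M' @ B\<close>.
\<close>

lemma covered_context:
  assumes MM': "equivalent (width w A) M M'" and AB: "covered w (A @ M' @ B)"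
  shows "covered w (A @ M @ B)"
  unfolding covered_def
proof (intro allI impI ballI, elim conjE)
  fix P Q x
  let ?T = "P @ (A @ M @ B) @ Q" and ?T' = "P @ (A @ M' @ B) @ Q"
  assume T: "fits 0 ?T" "width 0 P = w" and x: "x \<in> tangle_points 0 ?T"
  have T': "fits 0 ?T'" using T MM' by (simp add: equivalent_def)
  have T_eq: "?T = (P @ A) @ M @ (B @ Q)" "?T' = (P @ A) @ M' @ (B @ Q)" by simp_all
  have w: "width 0 (P @ A) = width w A" "width (width w A) M = width (width w A) M'"
    using T MM' by (simp_all add: equivalent_def)
  obtain y where y: "y \<in> tangle_points 0 ?T"
    "fst y \<le> length (P @ A) \<or> length (P @ A) + length M \<le> fst y"
    "component (tangle_bonds 0 ?T) x = component (tangle_bonds 0 ?T) y"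
    using MM' T x w(1) unfolding equivalent_def covered_def T_eq by blast
  define y' where "y' = (if fst y \<le> length (P @ A) then y else (fst y - length M + length M', snd y))"
  have yy': "corresponds (length (P @ A)) (length M) (length M') y y'"
    using y(2) by (auto simp: corresponds_def y'_def)
  have "y' \<in> tangle_points 0 ?T'"
    using corresponding_point[OF yy'] y(1) w unfolding T_eq by metis
  then obtain z' where z': "z' \<in> tangle_points 0 ?T'"
    "fst z' \<le> length P \<or> length P + length (A @ M' @ B) \<le> fst z'"
    "component (tangle_bonds 0 ?T') y' = component (tangle_bonds 0 ?T') z'"
    using AB T' T(2) unfolding covered_def by blast
  define z where "z = (if fst z' \<le> length P then z' else (fst z' - length M' + length M, snd z'))"
  have zz': "corresponds (length (P @ A)) (length M') (length M) z' z"
    and z_out: "fst z \<le> length P \<or> length P + length (A @ M @ B) \<le> fst z"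
    using z'(2) by (auto simp: corresponds_def z_def)
  have "z \<in> tangle_points 0 ?T"
    using corresponding_point[OF zz'] z'(1) w unfolding T_eq by metis
  moreover have "corresponds (length (P @ A)) (length M') (length M) y' y"
    using yy' by (auto simp: corresponds_def)
  then have "component (tangle_bonds 0 ?T) y = component (tangle_bonds 0 ?T) z"
    using MM' T(1) T' w(1) \<open>y' \<in> _\<close> z'(1,3) zz' unfolding equivalent_def simulates_def T_eq by blast
  ultimately show "\<exists>z\<in>tangle_points 0 ?T. (fst z \<le> length P \<or> length P + length (A @ M @ B) \<le> fst z) \<and>
      component (tangle_bonds 0 ?T) x = component (tangle_bonds 0 ?T) z"
    using y(3) z_out by metis
qed

text \<open>
  One rewriting step: tangles are brought to a common normal form \<open>N\<close> by replacing parts of them.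
\<close>

lemma equivalent_context_trans:
  assumes "equivalent (width w A) M M'" "equivalent w (A @ M' @ B) N" "fits w A"
  shows "equivalent w (A @ M @ B) N"
proof -
  have "simulates w (A @ M @ B) (A @ M' @ B)" "simulates w (A @ M' @ B) (A @ M @ B)"
    using assms(1) by (auto simp: equivalent_def intro: simulates_context)
  then show ?thesis
    using assms covered_context[OF assms(1), of B]
    by (auto simp: equivalent_def intro: simulates_trans)
qed

text \<open>
  The working criterion for a simulation is local: it suffices to have a map \<open>f\<close> from the points of
  \<open>M\<close> to those of \<open>M'\<close> that sends bonds to connected points and boundary points to boundary points,
  up to connectedness.
\<close>

lemma simulates_by_map:
  assumes bond: "\<And>x y. (x, y) \<in> tangle_bonds w M \<Longrightarrow>
      component (tangle_bonds w M') (f x) = component (tangle_bonds w M') (f y)"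
    and bottom: "\<And>p. p < w \<Longrightarrow>
      component (tangle_bonds w M') (f (0, p)) = component (tangle_bonds w M') (0, p)"
    and top: "\<And>p. p < width w M \<Longrightarrow>
      component (tangle_bonds w M') (f (length M, p)) = component (tangle_bonds w M') (length M', p)"
    and width: "width w M = width w M'"
  shows "simulates w M M'"
  unfolding simulates_def
proof (intro allI impI, elim conjE)
  fix P Q x x' y y'
  assume *: "fits 0 (P @ M @ Q)" "fits 0 (P @ M' @ Q)" "width 0 P = w"
    "x \<in> tangle_points 0 (P @ M @ Q)" "y \<in> tangle_points 0 (P @ M @ Q)"
    "corresponds (length P) (length M) (length M') x x'"
    "corresponds (length P) (length M) (length M') y y'"
    "component (tangle_bonds 0 (P @ M @ Q)) x = component (tangle_bonds 0 (P @ M @ Q)) y"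
  let ?a = "length P" and ?n = "length M" and ?n' = "length M'"
  let ?c' = "component (tangle_bonds 0 (P @ M' @ Q))"
  note E = tangle_bonds_part[OF *(3)]
  note inner = component_raise[OF _ *(3), of M' _ _ Q]
  \<comment> \<open>At the boundary of \<open>M\<close> the map \<open>F\<close> is given by \<open>f\<close>; \<open>bottom\<close> and \<open>top\<close> relate it to the
    identification of the points outside.\<close>
  define F where "F = (\<lambda>(l, p). if l < ?a then (l, p)
    else if l \<le> ?a + ?n then raise ?a (f (l - ?a, p)) else (l - ?n + ?n', p))"
  have F: "?c' (F u) = ?c' u'" if u_in: "u \<in> tangle_points 0 (P @ M @ Q)" and uu': "corresponds ?a ?n ?n' u u'" for u u'
  proof -
    obtain l p l' where u: "u = (l, p)" "u' = (l', p)"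
      using uu' by (cases u; cases u') (auto simp: corresponds_def)
    consider "l < ?a" "l' = l" | "l = ?a" "l' = ?a" | "l = ?a + ?n" "l' = ?a + ?n'" | "l > ?a + ?n" "l' = l - ?n + ?n'"
      using uu' u unfolding corresponds_def by fastforce
    then show ?thesis
    proof cases
      case 2
      then have "p < w" using u_in *(3) u by (simp add: tangle_points_def)
      from inner[OF bottom[OF this]] show ?thesis using 2 u by (simp add: F_def)
    next
      case 3
      then have "p < width w M" using u_in *(3) u by (simp add: tangle_points_def)
      from inner[OF top[OF this]] show ?thesis using 3 u by (simp add: F_def add.commute)
    qed (auto simp: F_def u)
  qed
  have "?c' (F u) = ?c' (F v)" if uv_bond: "(u, v) \<in> tangle_bonds 0 (P @ M @ Q)" for u v
  proof -
    have uv: "u \<in> tangle_points 0 (P @ M @ Q)" "v \<in> tangle_points 0 (P @ M @ Q)"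
      using tangle_bonds_subset[OF *(1)] uv_bond by auto
    consider "(u, v) \<in> tangle_bonds 0 P"
      | u0 v0 where "u = raise ?a u0" "v = raise ?a v0" "(u0, v0) \<in> tangle_bonds w M"
      | u0 v0 where "u = raise (?a + ?n) u0" "v = raise (?a + ?n) v0" "(u0, v0) \<in> tangle_bonds (width w M) Q"
      using uv_bond unfolding E by auto
    then show ?thesis
    proof cases
      case 1
      then have "u \<in> tangle_points 0 P" "v \<in> tangle_points 0 P"
        using tangle_bonds_subset[of 0 P] *(1) by auto
      then have "corresponds ?a ?n ?n' u u" "corresponds ?a ?n ?n' v v"
        by (auto simp: corresponds_def tangle_points_def)
      moreover have "?c' u = ?c' v" using 1 by (intro component_bond) (simp add: E)
      ultimately show ?thesis using F[OF uv(1)] F[OF uv(2)] by metis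
    next
      case 2
      have "u0 \<in> tangle_points w M" "v0 \<in> tangle_points w M"
        using tangle_bonds_subset[of w M] *(1,3) 2(3) by auto
      then have "F u = raise ?a (f u0)" "F v = raise ?a (f v0)"
        using 2(1,2) by (cases u0; cases v0; auto simp: F_def tangle_points_def)+
      then show ?thesis using inner[OF bond[OF 2(3)]] by simp
    next
      case 3
      let ?u = "raise (?a + ?n') u0" and ?v = "raise (?a + ?n') v0"
      have "corresponds ?a ?n ?n' u ?u" "corresponds ?a ?n ?n' v ?v"
        using 3(1,2) by (cases u0; cases v0; simp add: corresponds_def)+
      moreover have "?c' ?u = ?c' ?v" using 3(3) width by (intro component_bond) (auto simp: E)
      ultimately show ?thesis using F[OF uv(1)] F[OF uv(2)] by metis
    qed
  qed
  then have "?c' (F x) = ?c' (F y)" by (rule component_invariant[OF *(8), of "\<lambda>u. ?c' (F u)"])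
  then show "?c' x' = ?c' y'" using F *(4-7) by metis
qed

lemma coveredI:
  assumes "\<And>l p. \<lbrakk>0 < l; l < length M; p < width w (take l M)\<rbrakk> \<Longrightarrow> \<exists>q.
      q < w \<and> component (tangle_bonds w M) (l, p) = component (tangle_bonds w M) (0, q) \<or>
      q < width w M \<and> component (tangle_bonds w M) (l, p) = component (tangle_bonds w M) (length M, q)"
  shows "covered w M"
  unfolding covered_def
proof (intro allI impI ballI, elim conjE)
  fix P Q x
  let ?T = "P @ M @ Q" and ?a = "length P"
  assume T: "fits 0 ?T" "width 0 P = w" and x: "x \<in> tangle_points 0 ?T"
  let ?c = "component (tangle_bonds 0 ?T)"
  obtain l p where lp: "x = (l, p)" by (cases x)
  note inner = component_raise[OF _ T(2), of M _ _ Q]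
  show "\<exists>y\<in>tangle_points 0 ?T. (fst y \<le> ?a \<or> ?a + length M \<le> fst y) \<and> ?c x = ?c y"
  proof (cases "?a < l \<and> l < ?a + length M")
    case True
    then obtain q where "q < w \<and> component (tangle_bonds w M) (l - ?a, p) = component (tangle_bonds w M) (0, q) \<or>
      q < width w M \<and> component (tangle_bonds w M) (l - ?a, p) = component (tangle_bonds w M) (length M, q)"
      using assms[of "l - ?a" p] x lp T(2) less_diff_conv2[of ?a l "length M"]
      by (auto simp: tangle_points_def add.commute)
    then show ?thesis
    proof (elim disjE conjE)
      assume "q < w" "component (tangle_bonds w M) (l - ?a, p) = component (tangle_bonds w M) (0, q)"
      with inner[OF this(2)] True show ?thesis
        using lp T(2) by (intro bexI[of _ "(?a, q)"]) (auto simp: tangle_points_def)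
    next
      assume "q < width w M"
        "component (tangle_bonds w M) (l - ?a, p) = component (tangle_bonds w M) (length M, q)"
      with inner[OF this(2)] True show ?thesis
        using lp T(2) by (intro bexI[of _ "(?a + length M, q)"]) (auto simp: tangle_points_def add.commute)
    qed
  next
    case False
    then show ?thesis using x lp by (intro bexI[of _ x]) auto
  qed
qed


section \<open>Elementary equivalences of resolved tangles\<close>

lemma equivalent_vertical:
  assumes "i + 1 < w" "k = (\<not> one)"
  shows "equivalent w [(Cross i k, one)] []"
proof -
  let ?M = "[(Cross i k, one)]"
  have b: "component (tangle_bonds w ?M) (0, p) = component (tangle_bonds w ?M) (1, p)" if "p < w" for p
    using that assms by (intro component_bond) auto
  have "simulates w ?M []"
    by (rule simulates_by_map[where f = "\<lambda>(l, p). (0, p)"]) (use assms in \<open>auto split: if_splits\<close>)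
  moreover have "simulates w [] ?M"
    by (rule simulates_by_map[where f = id]) (use b in auto)
  moreover have "covered w ?M" "covered w []" by (auto intro: coveredI)
  ultimately show ?thesis using assms by (simp add: equivalent_def)
qed

lemma cup_cap_bonds:
  assumes "p \<noteq> i" "p \<noteq> i + 1" "p < w"
  shows "component (tangle_bonds w [(Cap i, b1), (Cup i b, b2)]) (0, p)
       = component (tangle_bonds w [(Cap i, b1), (Cup i b, b2)]) (2, p)"
proof -
  let ?E = "tangle_bonds w [(Cap i, b1), (Cup i b, b2)]"
  define q where "q = (if p < i then p else p - 2)"
  have "((0, p), (1, q)) \<in> ?E" "((1, q), (2, p)) \<in> ?E"
    using assms by (auto simp: q_def numeral_2_eq_2)
  then show ?thesis using component_bond by metis
qed

text \<open>
  The horizontal resolution is a maximum followed by a minimum, drawn in a single slice.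
\<close>

lemma equivalent_horizontal:
  assumes "i + 1 < w" "k = one"
  shows "equivalent w [(Cross i k, one)] [(Cap i, b1), (Cup i b, b2)]"
proof -
  let ?M = "[(Cross i k, one)]" and ?M' = "[(Cap i, b1), (Cup i b, b2)]"
  have ends: "component (tangle_bonds w ?M') (0, i) = component (tangle_bonds w ?M') (0, i + 1)"
    "component (tangle_bonds w ?M') (2, i) = component (tangle_bonds w ?M') (2, i + 1)"
    by (intro component_bond; simp add: numeral_2_eq_2)+
  have "simulates w ?M ?M'"
  proof (rule simulates_by_map[where f = "\<lambda>(l, p). (2 * l, p)"])
    fix x y assume "(x, y) \<in> tangle_bonds w ?M"
    then show "component (tangle_bonds w ?M') (case x of (l, p) \<Rightarrow> (2 * l, p)) =
       component (tangle_bonds w ?M') (case y of (l, p) \<Rightarrow> (2 * l, p))"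
      using assms cup_cap_bonds[of _ i w b1 b b2] ends
      by (auto simp del: tangle_bonds_simps(3) split: if_splits)
  qed (use assms in \<open>auto simp: numeral_2_eq_2\<close>)
  moreover have "simulates w ?M' ?M"
  proof (rule simulates_by_map[where f = "\<lambda>(l, p). if l = 0 then (0, p) else if l = 2 then (1, p)
        else if p < i then (0, p) else (0, p + 2)"])
    have v: "component (tangle_bonds w ?M) (0, p) = component (tangle_bonds w ?M) (Suc 0, p)"
      if "p < i \<or> i + 2 \<le> p" "p < w" for p
      using that assms by (intro component_bond) auto
    have "component (tangle_bonds w ?M) (0, i) = component (tangle_bonds w ?M) (0, Suc i)"
      "component (tangle_bonds w ?M) (Suc 0, i) = component (tangle_bonds w ?M) (Suc 0, Suc i)"
      using assms by (intro component_bond; simp)+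
    note bs = this v
    fix x y assume xy: "(x, y) \<in> tangle_bonds w ?M'"
    show "component (tangle_bonds w ?M) (case x of (l, p) \<Rightarrow> if l = 0 then (0, p) else if l = 2 then (1, p)
        else if p < i then (0, p) else (0, p + 2)) =
       component (tangle_bonds w ?M) (case y of (l, p) \<Rightarrow> if l = 0 then (0, p) else if l = 2 then (1, p)
        else if p < i then (0, p) else (0, p + 2))"
      using assms xy bs by (auto simp: numeral_2_eq_2 simp del: tangle_bonds_simps(2))
  qed (use assms in \<open>auto simp: numeral_2_eq_2\<close>)
  moreover have "covered w ?M'"
  proof (rule coveredI)
    fix l p assume "0 < l" "l < length ?M'" "p < width w (take l ?M')"
    then have "l = 1" by simp
    then have l: "l = 1" "p + 2 < w" using \<open>p < _\<close> by auto
    define q where "q = (if p < i then p else p + 2)"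
    have "((0, q), (1, p)) \<in> tangle_bonds w ?M'" "q < w" using l by (auto simp: q_def)
    then show "\<exists>q. q < w \<and> component (tangle_bonds w ?M') (l, p) = component (tangle_bonds w ?M') (0, q) \<or>
      q < width w ?M' \<and> component (tangle_bonds w ?M') (l, p) = component (tangle_bonds w ?M') (length ?M', q)"
      using component_bond l by metis
  qed
  moreover have "covered w ?M" by (auto intro: coveredI)
  moreover have "i \<le> w - 2" "w = Suc (Suc (w - 2))" using assms by auto
  ultimately show ?thesis using assms by (simp add: equivalent_def)
qed

lemma equivalent_zigzag:
  assumes "i < w" "M = [(Cup i b, b1), (Cap (i + 1), b2)] \<or> M = [(Cup (i + 1) b, b1), (Cap i, b2)]"
  shows "equivalent w M []"
proof -
  \<comment> \<open>at the middle level the zigzag passes through the positions \<open>i\<close>, \<open>i + 1\<close> and \<open>i + 2\<close>\<close>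
  let ?f = "\<lambda>p. if p \<le> i then p else if p \<le> i + 2 then i else p - 2"
  let ?c = "component (tangle_bonds w M)"
  have len: "length M = 2" and wM: "width w M = w" using assms by auto
  have "simulates w M []"
    by (rule simulates_by_map[where f = "\<lambda>(l, p). (0, if l = 1 then ?f p else p)"])
       (use assms in \<open>auto simp: numeral_2_eq_2\<close>)
  moreover have "?c (0, p) = ?c (2, p)" if "p < w" for p
  proof -
    consider "p < i" | "p = i" | "p > i" by linarith
    then show ?thesis
    proof cases
      case 1
      then have "((0, p), (1, p)) \<in> tangle_bonds w M" "((1, p), (2, p)) \<in> tangle_bonds w M"
        using assms by (auto simp: numeral_2_eq_2)
      then show ?thesis using component_bond by metis
    next
      case 3
      then have "((0, p), (1, p + 2)) \<in> tangle_bonds w M" "((1, p + 2), (2, p)) \<in> tangle_bonds w M"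
        using assms that by (auto simp: numeral_2_eq_2)
      then show ?thesis using component_bond by metis
    next
      case 2
      have m: "((1, i), (1, i + 1)) \<in> tangle_bonds w M" "((1, i + 1), (1, i + 2)) \<in> tangle_bonds w M"
        using assms by auto
      from assms(2) show ?thesis
      proof
        assume "M = [(Cup i b, b1), (Cap (i + 1), b2)]"
        then have "((0, i), (1, i + 2)) \<in> tangle_bonds w M" "((1, i), (2, i)) \<in> tangle_bonds w M"
          using assms by (auto simp: numeral_2_eq_2)
        then show ?thesis using m 2 component_bond by metis
      next
        assume "M = [(Cup (i + 1) b, b1), (Cap i, b2)]"
        then have "((0, i), (1, i)) \<in> tangle_bonds w M" "((1, i + 2), (2, i)) \<in> tangle_bonds w M"
          using assms by (auto simp: numeral_2_eq_2)
        then show ?thesis using m 2 component_bond by metis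
      qed
    qed
  qed
  then have "simulates w [] M"
    by (intro simulates_by_map[where f = id]) (use len wM in auto)
  moreover have "covered w M"
  proof (rule coveredI)
    fix l p assume "0 < l" "l < length M" "p < width w (take l M)"
    then have "l = 1" using len by simp
    then have l: "l = 1" "p < w + 2" using \<open>p < _\<close> assms by auto
    have m: "?c (1, i) = ?c (1, i + 1)" "?c (1, i + 1) = ?c (1, i + 2)"
      using assms by (intro component_bond; auto)+
    consider "p < i" | "p \<in> {i, i + 1, i + 2}" | "p > i + 2" by fastforce
    then have "?c (1, p) = ?c (0, ?f p)"
    proof cases
      case 1
      then show ?thesis using assms by (intro component_bond[symmetric]) auto
    next
      case 2
      have "?c (0, i) = ?c (1, i) \<or> ?c (0, i) = ?c (1, i + 2)"
        using assms component_bond[of "(0, i)" "(1, i)" "tangle_bonds w M"]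
          component_bond[of "(0, i)" "(1, i + 2)" "tangle_bonds w M"] by auto
      then show ?thesis using 2 m by auto
    next
      case 3
      then obtain r where "p = i + 3 + r" by (auto simp: less_iff_Suc_add)
      then show ?thesis using assms l by (intro component_bond[symmetric]) (auto simp: eval_nat_numeral)
    qed
    moreover have "?f p < w" using l assms(1) by auto
    ultimately show "\<exists>q. q < w \<and> ?c (l, p) = ?c (0, q) \<or> q < width w M \<and> ?c (l, p) = ?c (length M, q)"
      using l by blast
  qed
  moreover have "covered w []" by (auto intro: coveredI)
  ultimately show ?thesis using assms by (auto simp: equivalent_def)
qed

text \<open>
  The bonds of a slice at position \<open>i\<close> are those between the strands to its left, those between the
  strands to its right, and bonds that involve only the strands of the slice itself, given here by
  the height above the slice's lower level and the offset from \<open>i\<close>.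
\<close>

fun local_bonds :: "slice \<Rightarrow> bool \<Rightarrow> (point \<times> point) set" where
  "local_bonds (Cup i b) one = {((1, 0), (1, 1))}"
| "local_bonds (Cap i) one = {((0, 0), (0, 1))}"
| "local_bonds (Cross i k) one =
     (if k = (\<not> one) then {((0, 0), (1, 0)), ((0, 1), (1, 1))}
      else {((0, 0), (0, 1)), ((1, 0), (1, 1))})"

lemma fits_width_iff: "fits_width n s \<longleftrightarrow> position s + strands_below s \<le> n"
  by (cases s) auto

lemma out_width_eq: "out_width n s = n - strands_below s + strands_above s"
  if "fits_width n s"
  using that by (cases s) auto

lemma slice_bonds_cases:
  assumes "(u, v) \<in> slice_bonds s one l n" "fits_width n s"
  obtains (left) p where "u = (l, p)" "v = (Suc l, p)" "p < position s"
  | (right) p where "u = (l, position s + strands_below s + p)"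
      "v = (Suc l, position s + strands_above s + p)" "position s + strands_below s + p < n"
  | (inner) e j e' j' where "u = (l + e, position s + j)" "v = (l + e', position s + j')"
      "((e, j), (e', j')) \<in> local_bonds s one"
proof (cases s)
  case (Cup i b)
  then show ?thesis using assms left right inner[of 1 0 1 1] by (auto simp: le_iff_add)
next
  case (Cap i)
  then show ?thesis using assms left right inner[of 0 0 0 1] by (auto simp: le_iff_add)
next
  case (Cross i k)
  from assms(1) Cross consider (strand) p where "u = (l, p)" "v = (Suc l, p)" "p < n"
      "p \<notin> {i, i + 1} \<or> k = (\<not> one)"
    | (lower) "k = one" "u = (l, i)" "v = (l, i + 1)" | (upper) "k = one" "u = (Suc l, i)" "v = (Suc l, i + 1)"
    by (fastforce split: if_splits)
  then show ?thesis
  proof cases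
    case strand
    have "p < i \<or> p = i \<or> p = i + 1 \<or> p = i + 2 + (p - i - 2)" by arith
    with strand(4) consider "p < i" | q where "p = i + 2 + q" | "p = i" "k = (\<not> one)" | "p = i + 1" "k = (\<not> one)"
      by blast
    then show ?thesis
      by cases (use strand Cross left right inner[of 0 0 1 0] inner[of 0 1 1 1] in \<open>simp_all\<close>)
  qed (use Cross inner[of 0 0 0 1] inner[of 1 0 1 1] in \<open>simp_all\<close>)
qed

lemma slice_component:
  assumes "slice_bonds s one l n \<subseteq> E" "fits_width n s"
  shows "p < position s \<Longrightarrow> component E (l, p) = component E (Suc l, p)"
    and "position s + strands_below s + p < n \<Longrightarrow>
      component E (l, position s + strands_below s + p) = component E (Suc l, position s + strands_above s + p)"
    and "((e, j), (e', j')) \<in> local_bonds s one \<Longrightarrow>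
      component E (l + e, position s + j) = component E (l + e', position s + j')"
proof -
  have *: "component E u = component E v" if "(u, v) \<in> slice_bonds s one l n" for u v
    using that assms(1) by (intro component_bond) auto
  show "p < position s \<Longrightarrow> component E (l, p) = component E (Suc l, p)"
    by (rule *, cases s) (use assms(2) in auto)
  show "position s + strands_below s + p < n \<Longrightarrow>
      component E (l, position s + strands_below s + p) = component E (Suc l, position s + strands_above s + p)"
    by (rule *, cases s) auto
  show "((e, j), (e', j')) \<in> local_bonds s one \<Longrightarrow>
      component E (l + e, position s + j) = component E (l + e', position s + j')"
    by (rule *, cases s) (use assms(2) in \<open>auto split: if_splits\<close>)
qed

lemma local_bonds_range:
  "((e, j), (e', j')) \<in> local_bonds s one \<Longrightarrow>
     (e = 0 \<and> j < strands_below s \<or> e = 1 \<and> j < strands_above s) \<and>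
     (e' = 0 \<and> j' < strands_below s \<or> e' = 1 \<and> j' < strands_above s)"
  by (cases s) (auto split: if_splits)

lemma at_position_simps [simp]:
  "position (at_position s j) = j"
  "strands_below (at_position s j) = strands_below s"
  "strands_above (at_position s j) = strands_above s"
  "local_bonds (at_position s j) = local_bonds s"
  by (cases s; auto simp: fun_eq_iff)+

text \<open>
  Two distant slices in either order: every strand at the middle level runs straight through at
  least one of the two slices, along which it is followed to the boundary.
\<close>

lemma equivalent_exchange:
  fixes x y :: slice and j :: nat and b1 b2 :: bool
  defines "i \<equiv> position x"
  defines "M \<equiv> [(x, b1), (at_position y (i + strands_above x + j), b2)]"
    and "M' \<equiv> [(at_position y (i + strands_below x + j), b2), (x, b1)]"
  assumes fit: "fits w M" "fits w M'"
  shows "equivalent w M M'"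
proof -
  define lx ux ly uy where defs: "lx = strands_below x" "ux = strands_above x"
    "ly = strands_below y" "uy = strands_above y"
  have w: "i + lx + j + ly \<le> w"
    using fit by (simp add: M'_def fits_width_iff defs)
  let ?y = "at_position y (i + ux + j)" and ?y' = "at_position y (i + lx + j)"
  have fx: "fits_width w x" "fits_width (out_width w ?y') x"
    and fy: "fits_width w ?y'" "fits_width (out_width w x) ?y"
    using fit by (simp_all add: M_def M'_def defs)
  have wx: "out_width w x = w - lx + ux" and wy: "out_width w ?y' = w - ly + uy"
    using fx(1) fy(1) by (simp_all add: out_width_eq defs)
  have wM: "width w M = w - lx + ux - ly + uy" "width w M' = w - ly + uy - lx + ux"
    using fx fy wx wy by (simp_all add: M_def M'_def out_width_eq defs)
  then have width: "width w M = width w M'" using w by simp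
  let ?E = "tangle_bonds w M" and ?E' = "tangle_bonds w M'"
  have E: "?E = slice_bonds x b1 0 w \<union> slice_bonds ?y b2 1 (w - lx + ux)"
    using wx by (simp add: M_def defs)
  have E': "?E' = slice_bonds ?y' b2 0 w \<union> slice_bonds x b1 1 (w - ly + uy)"
    using wy by (simp add: M'_def defs)
  have sub: "slice_bonds x b1 0 w \<subseteq> ?E" "slice_bonds ?y b2 1 (w - lx + ux) \<subseteq> ?E"
    "slice_bonds ?y' b2 0 w \<subseteq> ?E'" "slice_bonds x b1 1 (w - ly + uy) \<subseteq> ?E'"
    unfolding E E' by auto
  note cx = slice_component[OF sub(1) fx(1), folded i_def defs]
    and cy = slice_component[OF sub(2) fy(2)[unfolded wx], unfolded at_position_simps, folded defs]
    and cy' = slice_component[OF sub(3) fy(1), unfolded at_position_simps, folded defs]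
    and cx' = slice_component[OF sub(4) fx(2)[unfolded wy], folded i_def defs]
  have split: "p < i + m \<or> (\<exists>q<n. p = i + m + q) \<or> (\<exists>q. p = i + m + n + q)" for p m n :: nat
  proof -
    have "\<exists>q<n. p = i + m + q" if "i + m \<le> p" "p < i + m + n"
      using that by (intro exI[of _ "p - i - m"]) auto
    moreover have "\<exists>q. p = i + m + n + q" if "i + m + n \<le> p"
      using that by (intro exI[of _ "p - i - m - n"]) auto
    ultimately show ?thesis by (meson not_less)
  qed
  \<comment> \<open>From the middle level, the strands that enter the upper slice are followed downwards, and all others
    upwards; \<open>f'\<close> does the same in the other tangle.\<close>
  define f :: "point \<Rightarrow> point" where "f = (\<lambda>(l, p). if l \<noteq> 1 then (l, p) else if p < i + ux + j then (2, p)
    else if p < i + ux + j + ly then (0, p - ux + lx) else (2, p - ly + uy))"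
  define f' :: "point \<Rightarrow> point" where "f' = (\<lambda>(l, p). if l \<noteq> 1 then (l, p) else if p < i then (2, p)
    else if p < i + lx then (0, p) else (2, p - lx + ux))"
  have f_simps: "f (0, p) = (0, p)" "f (Suc (Suc 0), p) = (Suc (Suc 0), p)"
    "p < i + ux + j \<Longrightarrow> f (Suc 0, p) = (Suc (Suc 0), p)"
    "q < ly \<Longrightarrow> f (Suc 0, i + ux + j + q) = (0, i + lx + j + q)"
    "f (Suc 0, i + ux + j + ly + q) = (Suc (Suc 0), i + ux + j + uy + q)" for p q
    by (simp_all add: f_def)
  have f'_simps: "f' (0, p) = (0, p)" "f' (Suc (Suc 0), p) = (Suc (Suc 0), p)" "p < i \<Longrightarrow> f' (Suc 0, p) = (Suc (Suc 0), p)"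
    "q < lx \<Longrightarrow> f' (Suc 0, i + q) = (0, i + q)" "f' (Suc 0, i + lx + q) = (Suc (Suc 0), i + ux + q)" for p q
    by (simp_all add: f'_def)
  let ?c = "component ?E" and ?c' = "component ?E'"
  have "simulates w M M'"
  proof (rule simulates_by_map[where f = f])
    fix u v assume "(u, v) \<in> ?E"
    then consider "(u, v) \<in> slice_bonds x b1 0 w" | "(u, v) \<in> slice_bonds ?y b2 1 (w - lx + ux)"
      unfolding E by blast
    then show "?c' (f u) = ?c' (f v)"
    proof cases
      case 1
      from this fx(1) show ?thesis
      proof (cases rule: slice_bonds_cases)
        case (left p)
        then show ?thesis using cy'(1)[of p] cx'(1)[of p] by (simp add: f_simps i_def)
      next
        case (right p)
        show ?thesis
        proof (cases "p < j")
          case True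
          then show ?thesis
            using right cy'(1)[of "i + lx + p"] cx'(2)[of p] w f_simps
            by (simp add: i_def defs numeral_2_eq_2)
        next
          case False
          then obtain q where q: "p = j + q" using le_Suc_ex not_less by blast
          show ?thesis
          proof (cases "q < ly")
            case True
            then show ?thesis using right q f_simps(4)[of q] by (simp add: i_def defs f_simps add.assoc)
          next
            case False
            then obtain r where r: "q = ly + r" using le_Suc_ex not_less by blast
            then show ?thesis
              using right q f_simps(5)[of r] cy'(2)[of r] cx'(2)[of "j + uy + r"] w
              by (simp add: i_def defs f_simps add.assoc numeral_2_eq_2)
          qed
        qed
      next
        case (inner e p e' p')
        have "?c' (f (e, i + p)) = ?c' (1 + e, i + p)"
          if "e = 0 \<and> p < lx \<or> e = 1 \<and> p < ux" for e p
          using that cy'(1)[of "i + p"] f_simps by (auto simp: numeral_2_eq_2)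
        then show ?thesis
          using inner local_bonds_range[OF inner(3)] cx'(3)[OF inner(3)] by (simp add: i_def defs)
      qed
    next
      case 2
      from this fy(2)[unfolded wx] show ?thesis
      proof (cases rule: slice_bonds_cases)
        case (left p)
        then show ?thesis using f_simps by (simp add: numeral_2_eq_2)
      next
        case (right p)
        then show ?thesis using f_simps by (simp add: defs numeral_2_eq_2)
      next
        case (inner e p e' p')
        have "?c' (f (1 + e, i + ux + j + p)) = ?c' (e, i + lx + j + p)"
          if "e = 0 \<and> p < ly \<or> e = 1 \<and> p < uy" for e p
          using that cx'(2)[of "j + p"] w f_simps by (auto simp: numeral_2_eq_2 add.assoc)
        then show ?thesis
          using inner local_bonds_range cy'(3)[of e p e' p'] by (simp add: defs)
      qed
    qed
  qed (use width in \<open>simp_all add: f_simps M_def M'_def\<close>)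
  moreover have "simulates w M' M"
  proof (rule simulates_by_map[where f = f'])
    fix u v assume "(u, v) \<in> ?E'"
    then consider "(u, v) \<in> slice_bonds ?y' b2 0 w" | "(u, v) \<in> slice_bonds x b1 1 (w - ly + uy)"
      unfolding E' by blast
    then show "?c (f' u) = ?c (f' v)"
    proof cases
      case 1
      from this fy(1) show ?thesis
      proof (cases rule: slice_bonds_cases)
        case (left p)
        then consider "p < i" | q where "q < lx" "p = i + q" | q where "p = i + lx + q" "q < j"
          using split[of p 0 lx] by fastforce
        then show ?thesis
        proof cases
          case 1
          then show ?thesis using left cx(1)[of p] cy(1)[of p] f'_simps by (simp add: numeral_2_eq_2)
        next
          case 2
          then show ?thesis using left f'_simps by simp
        next
          case 3
          then show ?thesis
            using left cx(2)[of q] cy(1)[of "i + ux + q"] w f'_simps by (simp add: numeral_2_eq_2)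
        qed
      next
        case (right p)
        then show ?thesis
          using cx(2)[of "j + ly + p"] cy(2)[of p] w f'_simps(1) f'_simps(5)[of "j + uy + p"]
          by (simp add: numeral_2_eq_2 add.assoc defs)
      next
        case (inner e p e' p')
        have "?c (f' (e, i + lx + j + p)) = ?c (1 + e, i + ux + j + p)"
          if "e = 0 \<and> p < ly \<or> e = 1 \<and> p < uy" for e p
          using that cx(2)[of "j + p"] w f'_simps(1) f'_simps(5)[of "j + p"]
          by (auto simp: numeral_2_eq_2 add.assoc)
        then show ?thesis
          using inner local_bonds_range cy(3)[of e p e' p'] by (simp add: defs)
      qed
    next
      case 2
      from this fx(2)[unfolded wy] show ?thesis
      proof (cases rule: slice_bonds_cases)
        case (left p)
        then show ?thesis using f'_simps by (simp add: i_def numeral_2_eq_2)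
      next
        case (right p)
        then show ?thesis using f'_simps by (simp add: i_def defs numeral_2_eq_2)
      next
        case (inner e p e' p')
        have "?c (f' (1 + e, i + p)) = ?c (e, i + p)"
          if "e = 0 \<and> p < lx \<or> e = 1 \<and> p < ux" for e p
          using that cy(1)[of "i + p"] f'_simps by (auto simp: numeral_2_eq_2)
        then show ?thesis
          using inner local_bonds_range[OF inner(3)] cx(3)[OF inner(3)] by (simp add: i_def defs)
      qed
    qed
  qed (use width in \<open>simp_all add: f'_simps M_def M'_def\<close>)
  moreover have "covered w M"
  proof (rule coveredI)
    fix l p assume lp: "0 < l" "l < length M" "p < width w (take l M)"
    then have l: "l = 1" by (simp add: M_def)
    have p: "p < w - lx + ux" using lp wx by (simp add: l M_def)
    have wM2: "length M = 2" by (simp add: M_def)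
    from split[of p "ux + j" ly] consider "p < i + ux + j" | q where "q < ly" "p = i + ux + j + q"
      | q where "p = i + ux + j + ly + q" by (auto simp: add.assoc)
    then show "\<exists>q. q < w \<and> ?c (l, p) = ?c (0, q) \<or> q < width w M \<and> ?c (l, p) = ?c (length M, q)"
    proof cases
      case 1
      then have "p < width w M" using wM(1) w by arith
      then show ?thesis using 1 cy(1)[of p] l wM2
        by (intro exI[of _ p]) (simp add: numeral_2_eq_2)
    next
      case 2
      then show ?thesis using cx(2)[of "j + q"] w l
        by (intro exI[of _ "i + lx + j + q"]) (simp add: add.assoc)
    next
      case 3
      then have "i + ux + j + uy + q < width w M" using p wM(1) w by arith
      then show ?thesis using 3 cy(2)[of q] p l wM2
        by (intro exI[of _ "i + ux + j + uy + q"]) (simp add: numeral_2_eq_2)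
    qed
  qed
  moreover have "covered w M'"
  proof (rule coveredI)
    fix l p assume lp: "0 < l" "l < length M'" "p < width w (take l M')"
    then have l: "l = 1" by (simp add: M'_def)
    have p: "p < w - ly + uy" using lp wy by (simp add: l M'_def defs)
    have wM2: "length M' = 2" by (simp add: M'_def)
    from split[of p 0 lx] consider "p < i" | q where "q < lx" "p = i + q"
      | q where "p = i + lx + q" by auto
    then show "\<exists>q. q < w \<and> ?c' (l, p) = ?c' (0, q) \<or> q < width w M' \<and> ?c' (l, p) = ?c' (length M', q)"
    proof cases
      case 1
      then have "p < width w M'" using wM(2) w by arith
      then show ?thesis using 1 cx'(1)[of p] l wM2
        by (intro exI[of _ p]) (simp add: numeral_2_eq_2)
    next
      case 2
      then show ?thesis using cy'(1)[of "i + q"] w l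
        by (intro exI[of _ "i + q"]) simp
    next
      case 3
      then have "i + ux + q < width w M'" using p wM(2) w by arith
      then show ?thesis using 3 cx'(2)[of q] p l wM2
        by (intro exI[of _ "i + ux + q"]) (simp add: numeral_2_eq_2)
    qed
  qed
  ultimately show ?thesis using fit width by (simp add: equivalent_def)
qed


section \<open>Equivalences used by the moves\<close>

lemma simulates_refl: "simulates w M M"
  by (rule simulates_by_map[where f = id]) (simp_all add: component_bond)

lemma equivalent_refl: "fits w M \<Longrightarrow> covered w M \<Longrightarrow> equivalent w M M"
  by (simp add: equivalent_def simulates_refl)

lemma equivalent_single: "fits w [x] \<Longrightarrow> equivalent w [x] [x]"
  by (intro equivalent_refl coveredI) auto

lemma equivalent_trans: "equivalent w M M' \<Longrightarrow> equivalent w M' N \<Longrightarrow> equivalent w M N"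
  using equivalent_context_trans[of w "[]" M M' "[]" N] by simp

text \<open>
  The rewriting steps below are all made at the position given by the context \<open>A\<close>, \<open>B\<close>:
  straight strands are dropped, horizontal resolutions are cut into a maximum and a minimum, and
  zigzags are pulled tight.
\<close>

lemma drop_vertical:
  assumes "equivalent w (A @ B) N" "fits w A" "i + 1 < width w A" "k = (\<not> one)"
  shows "equivalent w (A @ (Cross i k, one) # B) N"
  using equivalent_context_trans[of w A "[(Cross i k, one)]" "[]" B N] equivalent_vertical assms by simp

lemma cut_horizontal:
  assumes "equivalent w (A @ (Cap i, b1) # (Cup i b, b2) # B) N" "fits w A" "i + 1 < width w A" "k = one"
  shows "equivalent w (A @ (Cross i k, one) # B) N"
  using equivalent_context_trans[of w A "[(Cross i k, one)]" "[(Cap i, b1), (Cup i b, b2)]" B N]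
    equivalent_horizontal assms by simp

lemma pull_zigzag:
  assumes "equivalent w (A @ B) N" "fits w A" "min i j < width w A" "j = i + 1 \<or> i = j + 1"
  shows "equivalent w (A @ (Cup i b, b1) # (Cap j, b2) # B) N"
  using equivalent_context_trans[of w A "[(Cup i b, b1), (Cap j, b2)]" "[]" B N]
    equivalent_zigzag[of "min i j" "width w A" "[(Cup i b, b1), (Cap j, b2)]" b b1 b2] assms by auto

text \<open>
  Both sides are equivalent to a minimum: on one of them the crossing is a pair of straight strands,
  on the other one it is horizontal and gives rise to a zigzag.
\<close>

lemma equivalent_turn_cup:
  assumes "i < w"
  shows "equivalent w [(Cup i b, b1), (Cross (i + 1) k, one)] [(Cup (i + 1) b, b1), (Cross i (\<not> k), one)]"
proof (cases "k = one")
  case True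
  let ?N = "[(Cup (i + 1) b, b1)]"
  have N: "equivalent w ?N ?N" using assms by (intro equivalent_single) simp
  have "equivalent w [(Cup i b, b1), (Cap (i + 1), True), (Cup (i + 1) b, b1)] ?N"
    using pull_zigzag[of w "[]" ?N ?N i "i + 1" b b1 True] N assms by simp
  then have "equivalent w [(Cup i b, b1), (Cross (i + 1) k, one)] ?N"
    using cut_horizontal[of w "[(Cup i b, b1)]" "i + 1" True b b1 "[]" ?N k one] True assms by simp
  moreover have "equivalent w [(Cup (i + 1) b, b1), (Cross i (\<not> k), one)] ?N"
    using drop_vertical[of w "[(Cup (i + 1) b, b1)]" "[]" ?N i "\<not> k" one] N True assms by simp
  ultimately show ?thesis using equivalent_trans equivalent_sym by blast
next
  case False
  let ?N = "[(Cup i b, b1)]"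
  have N: "equivalent w ?N ?N" using assms by (intro equivalent_single) simp
  have "equivalent w [(Cup (i + 1) b, b1), (Cap i, True), (Cup i b, b1)] ?N"
    using pull_zigzag[of w "[]" ?N ?N "i + 1" i b b1 True] N assms by simp
  then have "equivalent w [(Cup (i + 1) b, b1), (Cross i (\<not> k), one)] ?N"
    using cut_horizontal[of w "[(Cup (i + 1) b, b1)]" i True b b1 "[]" ?N "\<not> k" one] False assms by simp
  moreover have "equivalent w [(Cup i b, b1), (Cross (i + 1) k, one)] ?N"
    using drop_vertical[of w "[(Cup i b, b1)]" "[]" ?N "i + 1" k one] N False assms by simp
  ultimately show ?thesis using equivalent_trans equivalent_sym by blast
qed

lemma equivalent_turn_cap:
  assumes "i + 2 < w"
  shows "equivalent w [(Cross (i + 1) k, one), (Cap i, b1)] [(Cross i (\<not> k), one), (Cap (i + 1), b1)]"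
proof (cases "k = one")
  case True
  let ?N = "[(Cap (i + 1), b1)]"
  have N: "equivalent w ?N ?N" using assms by (intro equivalent_single) simp
  have "equivalent w [(Cap (i + 1), b1), (Cup (i + 1) True, True), (Cap i, b1)] ?N"
    using pull_zigzag[of w ?N "[]" ?N "i + 1" i True True b1] N assms by simp
  then have "equivalent w [(Cross (i + 1) k, one), (Cap i, b1)] ?N"
    using cut_horizontal[of w "[]" "i + 1" b1 True True "[(Cap i, b1)]" ?N k one] True assms by simp
  moreover have "equivalent w [(Cross i (\<not> k), one), (Cap (i + 1), b1)] ?N"
    using drop_vertical[of w "[]" ?N ?N i "\<not> k" one] N True assms by simp
  ultimately show ?thesis using equivalent_trans equivalent_sym by blast
next
  case False
  let ?N = "[(Cap i, b1)]"
  have N: "equivalent w ?N ?N" using assms by (intro equivalent_single) simp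
  have "equivalent w [(Cap i, b1), (Cup i True, True), (Cap (i + 1), b1)] ?N"
    using pull_zigzag[of w ?N "[]" ?N i "i + 1" True True b1] N assms by simp
  then have "equivalent w [(Cross i (\<not> k), one), (Cap (i + 1), b1)] ?N"
    using cut_horizontal[of w "[]" i b1 True True "[(Cap (i + 1), b1)]" ?N "\<not> k" one] False assms by simp
  moreover have "equivalent w [(Cross (i + 1) k, one), (Cap i, b1)] ?N"
    using drop_vertical[of w "[]" ?N ?N "i + 1" k one] N False assms by simp
  ultimately show ?thesis using equivalent_trans equivalent_sym by blast
qed

lemma equivalent_bigon:
  assumes "i + 1 < w"
  shows "equivalent w [(Cross i k, \<not> k), (Cross i (\<not> k), k)] []"
  using drop_vertical[of w "[]" "[(Cross i (\<not> k), k)]" "[]" i k "\<not> k"]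
    equivalent_vertical[of i w "\<not> k" k] assms by simp

text \<open>Two adjacent horizontal resolutions close up no circle.\<close>

lemma equivalent_two_horizontal:
  assumes "p + 1 < w" "q + 1 < w" "q = p + 1 \<or> p = q + 1"
    "k1 = one1" "k2 = one2" "k1' = one1'" "k2' = one2'"
  shows "equivalent w [(Cross p k1, one1), (Cross q k2, one2)] [(Cross p k1', one1'), (Cross q k2', one2')]"
proof -
  let ?M = "[(Cross p k1', one1'), (Cross q k2', one2')]"
  let ?c = "component (tangle_bonds w ?M)"
  have "covered w ?M"
  proof (rule coveredI)
    fix l x assume lx: "0 < l" "l < length ?M" "x < width w (take l ?M)"
    then have l: "l = 1" by simp
    with lx have x: "x < w" by simp
    have q: "?c (1, q) = ?c (1, q + 1)" using assms by (intro component_bond) simp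
    have down: "?c (1, y) = ?c (0, y)" if "y \<noteq> p" "y \<noteq> p + 1" "y < w" for y
      using that assms by (intro component_bond[symmetric]) simp
    have up: "?c (1, y) = ?c (2, y)" if "y \<noteq> q" "y \<noteq> q + 1" "y < w" for y
      using that assms by (intro component_bond) (simp add: numeral_2_eq_2)
    consider "x \<noteq> p" "x \<noteq> p + 1" | "x \<noteq> q" "x \<noteq> q + 1" | "x = q" "x = p + 1" | "x = q + 1" "x = p"
      using assms(3) by fastforce
    then show "\<exists>y. y < w \<and> ?c (l, x) = ?c (0, y) \<or> y < width w ?M \<and> ?c (l, x) = ?c (length ?M, y)"
    proof cases
      case 1
      then show ?thesis using down[of x] x l by auto
    next
      case 2
      then show ?thesis using up[of x] x l by (intro exI[of _ x]) (simp add: numeral_2_eq_2)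
    next
      case 3
      then show ?thesis using down[of "q + 1"] q assms l by (intro exI[of _ "q + 1"]) simp
    next
      case 4
      then show ?thesis using down[of q] q assms l by (intro exI[of _ q]) simp
    qed
  qed
  then have M: "equivalent w ?M ?M" using assms by (intro equivalent_refl) simp_all
  have switch: "equivalent v [(Cross i k, k)] [(Cross i k', k')]" if "i + 1 < v" for v i k k'
    using equivalent_horizontal[OF that refl, of k True True True]
      equivalent_horizontal[OF that refl, of k' True True True] equivalent_trans equivalent_sym by blast
  have "equivalent w [(Cross p k1', one1'), (Cross q k2, one2)] ?M"
    using equivalent_context_trans[of w "[(Cross p k1', one1')]" "[(Cross q k2, one2)]"
      "[(Cross q k2', one2')]" "[]" ?M] switch M assms by simp
  then show ?thesis
    using equivalent_context_trans[of w "[]" "[(Cross p k1, one1)]" "[(Cross p k1', one1')]"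
      "[(Cross q k2, one2)]" ?M] switch assms by simp
qed

text \<open>
  The Temperley-Lieb relation: cut into maxima and minima, the three horizontal resolutions
  contain two zigzags.
\<close>

lemma equivalent_three_horizontal:
  assumes "p + 1 < w" "q + 1 < w" "q = p + 1 \<or> p = q + 1"
    "k1 = one1" "k2 = one2" "k3 = one3" "k = one"
  shows "equivalent w [(Cross p k1, one1), (Cross q k2, one2), (Cross p k3, one3)] [(Cross p k, one)]"
proof -
  let ?N = "[(Cap p, True), (Cup p True, True)]" and ?C = "\<lambda>i. (Cap i, True)" and ?U = "\<lambda>i. (Cup i True, True)"
  have N: "equivalent w ?N [(Cross p k, one)]"
    using equivalent_horizontal equivalent_sym assms by blast
  have "min q p < w - 2" "p \<le> w - 2" "w - 2 + 2 = w" using assms by auto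
  note w = this
  have "equivalent w [?C p, ?U p, ?C q, ?U q, ?C p, ?U p] [(Cross p k, one)]"
    using pull_zigzag[of w "[?C p]" "[?U q, ?C p, ?U p]" "[(Cross p k, one)]" p q True True True]
      pull_zigzag[of w "[?C p]" "[?U p]" "[(Cross p k, one)]" q p True True True] N w assms
    by (simp add: min.commute) auto
  then have "equivalent w [?C p, ?U p, ?C q, ?U q, (Cross p k3, one3)] [(Cross p k, one)]"
    using cut_horizontal[of w "[?C p, ?U p, ?C q, ?U q]" p True True True "[]" "[(Cross p k, one)]" k3 one3]
      w assms by simp
  then have "equivalent w [?C p, ?U p, (Cross q k2, one2), (Cross p k3, one3)] [(Cross p k, one)]"
    using cut_horizontal[of w "[?C p, ?U p]" q True True True "[(Cross p k3, one3)]" "[(Cross p k, one)]" k2 one2]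
      w assms by simp
  then show ?thesis
    using cut_horizontal[of w "[]" p True True True "[(Cross q k2, one2), (Cross p k3, one3)]"
        "[(Cross p k, one)]" k1 one1]
      w assms by simp
qed

text \<open>
  Both sides of the third move, with the middle crossing resolved horizontally.  Depending on the
  outer crossings this is a mere relabelling or the relation between three adjacent horizontal
  resolutions and a single one.
\<close>

lemma equivalent_third_move:
  assumes "i + 2 < w"
  shows "equivalent w [(Cross (i + 1) False, b1), (Cross i True, True), (Cross (i + 1) True, b3)]
    [(Cross i True, b1), (Cross (i + 1) True, True), (Cross i False, b3)]" (is "equivalent w ?M ?M'")
proof -
  consider "b1" "b3" | "b1" "\<not> b3" | "\<not> b1" "b3" | "\<not> b1" "\<not> b3" by blast
  then show ?thesis
  proof cases
    case 1
    let ?H = "[(Cross i True, True), (Cross (i + 1) True, True)]"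
    have H: "equivalent w ?H ?H"
      using assms by (intro equivalent_two_horizontal) auto
    have "equivalent w ?M ?H"
      using drop_vertical[of w "[]" ?H ?H "i + 1" False True] H 1 assms by simp
    moreover have "equivalent w ?M' ?H"
      using drop_vertical[of w ?H "[]" ?H i False True] H 1 assms by simp
    ultimately show ?thesis using equivalent_trans equivalent_sym by blast
  next
    case 2
    let ?H = "[(Cross i True, True)]"
    have H: "equivalent w ?H ?H" using assms by (intro equivalent_single) auto
    have "equivalent w (?H @ [(Cross (i + 1) True, False)]) ?H"
      using drop_vertical[of w ?H "[]" ?H "i + 1" True False] H assms by simp
    then have "equivalent w ?M ?H"
      using drop_vertical[of w "[]" "?H @ [(Cross (i + 1) True, False)]" ?H "i + 1" False True] 2 assms by simp
    moreover have "equivalent w ?M' ?H"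
      using 2 assms by (intro equivalent_three_horizontal) auto
    ultimately show ?thesis using equivalent_trans equivalent_sym by blast
  next
    case 3
    let ?H = "[(Cross (i + 1) True, True)]"
    have H: "equivalent w ?H ?H" using assms by (intro equivalent_single) auto
    have "equivalent w (?H @ [(Cross i False, True)]) ?H"
      using drop_vertical[of w ?H "[]" ?H i False True] H assms by simp
    then have "equivalent w ?M' ?H"
      using drop_vertical[of w "[]" "?H @ [(Cross i False, True)]" ?H i True False] 3 assms by simp
    moreover have "equivalent w ?M ?H"
      using 3 assms by (intro equivalent_three_horizontal) auto
    ultimately show ?thesis using equivalent_trans equivalent_sym by blast
  next
    case 4
    let ?H = "[(Cross (i + 1) False, False), (Cross i True, True)]"
      and ?H' = "[(Cross (i + 1) True, True), (Cross i False, False)]"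
    have H: "equivalent w ?H ?H'" "equivalent w ?H' ?H'"
      using assms by (intro equivalent_two_horizontal; simp)+
    have "equivalent w ?M ?H'"
      using drop_vertical[of w ?H "[]" ?H' "i + 1" True False] H 4 assms by simp
    moreover have "equivalent w ?M' ?H'"
      using drop_vertical[of w "[]" ?H' ?H' i True False] H 4 assms by simp
    ultimately show ?thesis using equivalent_trans equivalent_sym by blast
  qed
qed

text \<open>
  The correspondence of crossings is its own inverse for each of the elementary isotopies, so that it
  describes the transport of resolutions in both directions.
\<close>

lemma isotopy_involution:
  assumes "elementary_isotopy M M' \<rho>" "j < length M" "j' < length M'"
  shows "\<rho> j = j' \<longleftrightarrow> \<rho> j' = j"
  using assms by (induction arbitrary: j j') (auto simp: less_Suc_eq)

lemma isotopy_range: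
  assumes "elementary_isotopy M M' \<rho>" "j < length M" "M ! j = Cross i k"
  shows "\<rho> j < length M'"
proof -
  have "(\<forall>j<length M. (\<exists>i k. M ! j = Cross i k) \<longrightarrow> \<rho> j < length M') \<and>
    (\<forall>j<length M'. (\<exists>i k. M' ! j = Cross i k) \<longrightarrow> \<rho> j < length M)"
    using assms(1) by induction (auto simp: less_Suc_eq)
  then show ?thesis using assms(2,3) by blast
qed

lemma equivalent_isotopy:
  assumes "elementary_isotopy M M' \<rho>"
    and "\<And>j j'. \<lbrakk>j < length M; j' < length M'; \<rho> j = j'\<rbrakk> \<Longrightarrow> ones ! j = ones' ! j'"
    and "length ones = length M" "length ones' = length M'"
    and "fits w (zip M ones)" "fits w (zip M' ones')"
  shows "equivalent w (zip M ones) (zip M' ones')"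
  using assms
proof (induction arbitrary: ones ones')
  case (exchange x y j)
  then obtain b1 b2 b1' b2' where ones: "ones = [b1, b2]" "ones' = [b1', b2']"
    by (auto simp: length_Suc_conv numeral_2_eq_2)
  then have "b1' = b2" "b2' = b1"
    using exchange(1)[of 0 1] exchange(1)[of 1 0] by simp_all
  then show ?case using equivalent_exchange[of w x b1 y j b2] exchange(4,5) ones by simp
next
  case (zigzag_right i b)
  then obtain b1 b2 where "ones = [b1, b2]" "ones' = []"
    by (auto simp: length_Suc_conv numeral_2_eq_2)
  then show ?case using equivalent_zigzag[of i w _ b b1 b2] zigzag_right(4) by simp
next
  case (zigzag_left i b)
  then obtain b1 b2 where "ones = [b1, b2]" "ones' = []"
    by (auto simp: length_Suc_conv numeral_2_eq_2)
  then show ?case using equivalent_zigzag[of i w _ b b1 b2] zigzag_left(4) by simp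
next
  case (turn_cup i b k)
  then obtain b1 b2 b1' b2' where ones: "ones = [b1, b2]" "ones' = [b1', b2']"
    by (auto simp: length_Suc_conv numeral_2_eq_2)
  then have "b1' = b1" "b2' = b2"
    using turn_cup(1)[of 0 0] turn_cup(1)[of 1 1] by simp_all
  then show ?case using equivalent_turn_cup[of i w b b1 k b2] turn_cup(4) ones by simp
next
  case (turn_cap i k)
  then obtain b1 b2 b1' b2' where ones: "ones = [b1, b2]" "ones' = [b1', b2']"
    by (auto simp: length_Suc_conv numeral_2_eq_2)
  then have "b1' = b1" "b2' = b2"
    using turn_cap(1)[of 0 0] turn_cap(1)[of 1 1] by simp_all
  then show ?case using equivalent_turn_cap[of i w k b1 b2] turn_cap(4) ones by simp
next
  case (reverse M M' \<rho>)
  have "equivalent w (zip M ones') (zip M' ones)"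
  proof (rule reverse.IH)
    fix j j' assume "j < length M" "j' < length M'" "\<rho> j = j'"
    then show "ones' ! j = ones ! j'"
      using reverse.prems(1)[of j' j] isotopy_involution[OF reverse.hyps] by simp
  qed (use reverse.prems in auto)
  then show ?case by (rule equivalent_sym)
qed

text \<open>The loop of a curl splits off; the rest of the curl is a straight strand.\<close>

lemma simulates_circle:
  assumes "j \<le> w" "M = [(Cup j b, b1), (Cap j, b2)]"
  shows "simulates w M []" "simulates w [] M"
proof -
  \<comment> \<open>the small circle, which is not connected to the boundary, may be sent to any point, here to 0\<close>
  show "simulates w M []"
    by (rule simulates_by_map[where f = "\<lambda>(l, p). (0, if l = 1 then if p < j then p else if p \<le> j + 1 then 0 else p - 2 else p)"])
       (use assms in \<open>auto simp: numeral_2_eq_2\<close>)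
  have "component (tangle_bonds w M) (0, p) = component (tangle_bonds w M) (2, p)" if "p < w" for p
  proof -
    let ?q = "if p < j then p else p + 2"
    have "((0, p), (1, ?q)) \<in> tangle_bonds w M" "((1, ?q), (2, p)) \<in> tangle_bonds w M"
      using assms that by (auto simp: numeral_2_eq_2)
    then show ?thesis using component_bond by metis
  qed
  then show "simulates w [] M"
    by (intro simulates_by_map[where f = id]) (use assms in \<open>auto simp: numeral_2_eq_2\<close>)
qed

lemma simulates_curl:
  assumes "i < w" "k = (\<not> one)" "M = [(Cup (i + 1) b, b1), (Cross i k, one), (Cap (i + 1), b2)]"
  shows "simulates w M []" "simulates w [] M"
proof -
  let ?C = "[(Cup (i + 1) b, b1), (Cap (i + 1), b2)]"
  have v: "equivalent (w + 2) [(Cross i k, one)] []" using assms by (intro equivalent_vertical) auto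
  have C: "fits w ?C" "width w ?C = w" using assms by auto
  have "simulates w M ?C" "simulates w ?C M"
    using simulates_context[of w "[(Cup (i + 1) b, b1)]" "[(Cross i k, one)]" "[]" "[(Cap (i + 1), b2)]"]
      simulates_context[of w "[(Cup (i + 1) b, b1)]" "[]" "[(Cross i k, one)]" "[(Cap (i + 1), b2)]"]
      v assms(3) by (simp_all add: equivalent_def)
  moreover have "simulates w ?C []" "simulates w [] ?C"
    using simulates_circle[of "i + 1" w ?C] assms by auto
  ultimately show "simulates w M []" "simulates w [] M"
    using simulates_trans[of w M ?C "[]"] simulates_trans[of w "[]" ?C M] C assms by auto
qed


section \<open>Circles of a resolved diagram\<close>

text \<open>
  The tangle obtained from the part \<open>M\<close> of a diagram that begins at level \<open>a\<close>.
\<close>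

definition resolve :: "nat \<Rightarrow> diagram \<Rightarrow> resolution \<Rightarrow> tangle" where
  "resolve a M r = zip M (map (\<lambda>j. a + j \<in> r) [0..<length M])"

text \<open>
  For the circles only the numbers of strands matter.  Unlike \<open>link_diagram\<close>, this condition
  passes to the diagrams that occur within a third move, where crossings have been deleted without
  regard to orientations.
\<close>

definition diagram_fits :: "nat \<Rightarrow> diagram \<Rightarrow> bool" where
  "diagram_fits w M = fits w (map (\<lambda>s. (s, False)) M)"

definition diagram_width :: "nat \<Rightarrow> diagram \<Rightarrow> nat" where
  "diagram_width w M = width w (map (\<lambda>s. (s, False)) M)"

lemma length_resolve [simp]: "length (resolve a M r) = length M"
  by (simp add: resolve_def)

lemma map_fst_resolve [simp]: "map fst (resolve a M r) = M"
  by (simp add: resolve_def)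

lemma nth_resolve [simp]: "l < length M \<Longrightarrow> resolve a M r ! l = (M ! l, a + l \<in> r)"
  by (simp add: resolve_def)

lemma resolve_Nil [simp]: "resolve a [] r = []"
  by (simp add: resolve_def)

lemma resolve_append: "resolve a (M @ N) r = resolve a M r @ resolve (a + length M) N r"
  by (intro nth_equalityI) (auto simp: nth_append)

lemma resolve_Cons [simp]: "resolve a (s # M) r = (s, a \<in> r) # resolve (Suc a) M r"
  by (rule nth_equalityI) (auto simp: nth_Cons split: nat.split)

lemma resolve_cong:
  "(\<And>j. j < length M \<Longrightarrow> a + j \<in> r \<longleftrightarrow> b + j \<in> r') \<Longrightarrow> resolve a M r = resolve b M r'"
  by (intro nth_equalityI) auto

lemma fits_fst: "map fst S = map fst T \<Longrightarrow> fits w S \<longleftrightarrow> fits w T"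
proof (induction S arbitrary: T w)
  case (Cons x S)
  then obtain y T' where "T = y # T'" "fst x = fst y" "map fst S = map fst T'" by (cases T) auto
  then show ?case using Cons.IH by simp
qed simp

lemma width_fst: "map fst S = map fst T \<Longrightarrow> width w S = width w T"
proof (induction S arbitrary: T w)
  case (Cons x S)
  then obtain y T' where "T = y # T'" "fst x = fst y" "map fst S = map fst T'" by (cases T) auto
  then show ?case using Cons.IH by simp
qed simp

lemma fits_resolve [simp]: "fits w (resolve a M r) \<longleftrightarrow> diagram_fits w M"
  unfolding diagram_fits_def by (rule fits_fst) (simp add: comp_def)

lemma width_resolve [simp]: "width w (resolve a M r) = diagram_width w M"
  unfolding diagram_width_def by (rule width_fst) (simp add: comp_def)

lemma diagram_fits_simps [simp]:
  "diagram_fits w []" "diagram_fits w (s # M) \<longleftrightarrow> fits_width w s \<and> diagram_fits (out_width w s) M"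
  "diagram_fits w (M @ N) \<longleftrightarrow> diagram_fits w M \<and> diagram_fits (diagram_width w M) N"
  by (simp_all add: diagram_fits_def diagram_width_def)

lemma diagram_width_simps [simp]:
  "diagram_width w [] = w" "diagram_width w (s # M) = diagram_width (out_width w s) M"
  "diagram_width w (M @ N) = diagram_width (diagram_width w M) N"
  by (simp_all add: diagram_width_def)

lemma length_fold_slice_step:
  "diagram_fits (length st) M \<Longrightarrow> length (fold slice_step M st) = diagram_width (length st) M"
proof (induction M arbitrary: st)
  case (Cons s M)
  then have "length (slice_step s st) = out_width (length st) s" by (cases s) auto
  then show ?case using Cons by simp
qed simp

lemma length_strands:
  assumes "diagram_fits 0 D"
  shows "length (strands D l) = diagram_width 0 (take l D)"
proof -
  have "diagram_fits 0 (take l D @ drop l D)" using assms by simp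
  then have "diagram_fits 0 (take l D)" by (simp del: append_take_drop_id)
  then show ?thesis using length_fold_slice_step[of "[]"] by (simp add: strands_def)
qed

lemma fits_slice_steps:
  "(\<And>l. l < length M \<Longrightarrow> slice_fits (M ! l) (fold slice_step (take l M) st)) \<Longrightarrow> diagram_fits (length st) M"
proof (induction M arbitrary: st)
  case (Cons s M)
  have s: "slice_fits s st" using Cons.prems[of 0] by simp
  have "diagram_fits (length (slice_step s st)) M"
    by (rule Cons.IH) (use Cons.prems[of "Suc _"] in simp)
  moreover have "fits_width (length st) s" "length (slice_step s st) = out_width (length st) s"
    using s by (cases s; auto)+
  ultimately show ?case by simp
qed simp

lemma link_diagram_fits: "link_diagram D \<Longrightarrow> diagram_fits 0 D"
  using fits_slice_steps[of D "[]"] by (auto simp: link_diagram_def strands_def)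

lemma take_resolve: "take l (resolve a M r) = resolve a (take l M) r"
  by (intro nth_equalityI) auto

lemma points_tangle:
  "diagram_fits 0 D \<Longrightarrow> points D = tangle_points 0 (resolve 0 D r)"
  by (simp add: points_def tangle_points_def length_strands take_resolve)

lemma bonds_tangle:
  "diagram_fits 0 D \<Longrightarrow> bonds D r = tangle_bonds 0 (resolve 0 D r)"
  by (simp add: bonds_def tangle_bonds_def length_strands take_resolve)

lemma circle_component: "circle D r = component (bonds D r)"
  by (simp add: fun_eq_iff circle_def component_def)

lemma finite_circles: "diagram_fits 0 D \<Longrightarrow> finite (circles D r)"
  using finite_tangle_points by (simp add: circles_def points_tangle[of D r])

lemma finite_crossings: "finite (crossings D)"
  by (simp add: crossings_def)

text \<open>
  Circles are disjoint, so a circle is labelled \<open>X\<close> as soon as one of its points lies on a circle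
  labelled \<open>X\<close>.
\<close>

lemma circle_labelled:
  assumes "g \<in> generators D"
  shows "circle D (fst g) z \<in> snd g \<longleftrightarrow> has_X g z"
proof
  assume "circle D (fst g) z \<in> snd g"
  then show "has_X g z"
    unfolding has_X_def circle_component using component_refl[of z] by blast
next
  assume "has_X g z"
  then obtain \<gamma> where "\<gamma> \<in> snd g" "z \<in> \<gamma>" by (auto simp: has_X_def)
  moreover from this obtain y where "\<gamma> = circle D (fst g) y"
    using assms by (auto simp: generators_def circles_def)
  ultimately show "circle D (fst g) z \<in> snd g" by (simp add: circle_component component_eq_iff[symmetric])
qed

lemma has_X_circle:
  assumes "g \<in> generators D" "circle D (fst g) x = circle D (fst g) y"
  shows "has_X g x = has_X g y"
  using assms by (simp flip: circle_labelled)


section \<open>Comparison of label degrees\<close>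

definition weight :: "bool \<Rightarrow> int" where
  "weight x = (if x then -1 else 1)"

definition degree_on :: "diagram \<Rightarrow> generator \<Rightarrow> point set \<Rightarrow> int" where
  "degree_on D g X = (\<Sum>\<gamma>\<in>circle D (fst g) ` X. weight (\<gamma> \<in> snd g))"

lemma label_degree_points: "label_degree D g = degree_on D g (points D)"
  by (simp add: label_degree_def degree_on_def circles_def weight_def)

text \<open>
  Here \<open>X\<close> and \<open>X'\<close> are points on the affected circles; \<open>Z\<close> relates points with equal labels on the
  other circles and meets each of these.
\<close>

lemma label_degree_compare:
  assumes D: "diagram_fits 0 D" "diagram_fits 0 D'"
    and g: "g \<in> generators D" "g' \<in> generators D'"
    and X: "X \<subseteq> points D" "X' \<subseteq> points D'"
    and Z: "\<And>x x'. (x, x') \<in> Z \<Longrightarrow> x \<in> points D \<and> x' \<in> points D' \<and>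
        circle D (fst g) x \<notin> circle D (fst g) ` X \<and>
        circle D' (fst g') x' \<notin> circle D' (fst g') ` X' \<and> has_X g x = has_X g' x'"
    and left: "\<And>x. \<lbrakk>x \<in> points D; circle D (fst g) x \<notin> circle D (fst g) ` X\<rbrakk>
        \<Longrightarrow> \<exists>(y, y')\<in>Z. circle D (fst g) y = circle D (fst g) x"
    and right: "\<And>x'. \<lbrakk>x' \<in> points D'; circle D' (fst g') x' \<notin> circle D' (fst g') ` X'\<rbrakk>
        \<Longrightarrow> \<exists>(y, y')\<in>Z. circle D' (fst g') y' = circle D' (fst g') x'"
    and eq: "\<And>x x' y y'. \<lbrakk>(x, x') \<in> Z; (y, y') \<in> Z\<rbrakk> \<Longrightarrow>
        circle D (fst g) x = circle D (fst g) y \<longleftrightarrow> circle D' (fst g') x' = circle D' (fst g') y'"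
  shows "label_degree D g - degree_on D g X = label_degree D' g' - degree_on D' g' X'"
  unfolding label_degree_points degree_on_def
proof (rule sum_matched_components[where Z = Z])
  show "finite (circle D (fst g) ` points D)" "finite (circle D' (fst g') ` points D')"
    using finite_circles[of D] finite_circles[of D'] D by (simp_all add: circles_def)
next
  fix \<gamma> assume "\<gamma> \<in> circle D (fst g) ` points D - circle D (fst g) ` X"
  then obtain x where "x \<in> points D" "\<gamma> = circle D (fst g) x" "\<gamma> \<notin> circle D (fst g) ` X" by blast
  then show "\<exists>(x, x')\<in>Z. circle D (fst g) x = \<gamma>" using left[of x] by auto
next
  fix \<gamma> assume "\<gamma> \<in> circle D' (fst g') ` points D' - circle D' (fst g') ` X'"
  then obtain x where "x \<in> points D'" "\<gamma> = circle D' (fst g') x" "\<gamma> \<notin> circle D' (fst g') ` X'" by blast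
  then show "\<exists>(x, x')\<in>Z. circle D' (fst g') x' = \<gamma>" using right[of x] by auto
next
  fix x x' assume "(x, x') \<in> Z"
  from Z[OF this] show "circle D (fst g) x \<in> circle D (fst g) ` points D - circle D (fst g) ` X \<and>
       circle D' (fst g') x' \<in> circle D' (fst g') ` points D' - circle D' (fst g') ` X' \<and>
       weight (circle D (fst g) x \<in> snd g) = weight (circle D' (fst g') x' \<in> snd g')"
    using g by (auto simp: circle_labelled)
qed (use X eq in auto)

text \<open>
  For two resolutions of the same diagram, the circles that avoid the region \<open>T\<close> of the change are
  literally the same sets of points.
\<close>

lemma circle_in_image_iff:
  "circle D r x \<in> circle D r ` T \<longleftrightarrow> circle D r x \<inter> T \<noteq> {}"
  by (auto simp: circle_component component_eq_iff)

lemma circle_local_change: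
  assumes "bonds D r - bonds D r' \<subseteq> T \<times> T" "bonds D r' - bonds D r \<subseteq> T \<times> T"
    and "circle D r x \<notin> circle D r ` T"
  shows "circle D r' x = circle D r x" "circle D r' x \<notin> circle D r' ` T"
proof -
  have x: "circle D r x \<inter> T = {}" using assms(3) by (simp add: circle_in_image_iff)
  then show "circle D r' x = circle D r x"
    using component_local_change_eq[OF assms(1,2)] by (simp add: circle_component)
  then show "circle D r' x \<notin> circle D r' ` T" using x circle_in_image_iff[of D r' x T] by simp
qed

lemma label_degree_local_change:
  assumes D: "diagram_fits 0 D" and g: "g \<in> generators D" "g' \<in> generators D"
    and bonds: "bonds D (fst g) - bonds D (fst g') \<subseteq> T \<times> T" "bonds D (fst g') - bonds D (fst g) \<subseteq> T \<times> T"
    and T: "T \<subseteq> points D"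
    and labels: "\<And>x. \<lbrakk>x \<in> points D; circle D (fst g) x \<notin> circle D (fst g) ` T\<rbrakk> \<Longrightarrow> has_X g x = has_X g' x"
  shows "label_degree D g - degree_on D g T = label_degree D g' - degree_on D g' T"
proof (rule label_degree_compare[OF D D g T T])
  let ?Z = "{(x, x) | x. x \<in> points D \<and> circle D (fst g) x \<notin> circle D (fst g) ` T}"
  note change = circle_local_change[OF bonds] circle_local_change[OF bonds(2,1)]
  show "x \<in> points D \<and> x' \<in> points D \<and> circle D (fst g) x \<notin> circle D (fst g) ` T \<and>
      circle D (fst g') x' \<notin> circle D (fst g') ` T \<and> has_X g x = has_X g' x'" if "(x, x') \<in> ?Z" for x x'
    using that change(2)[of x] labels[of x] by auto
  show "\<exists>(y, y')\<in>?Z. circle D (fst g) y = circle D (fst g) x"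
    if "x \<in> points D" "circle D (fst g) x \<notin> circle D (fst g) ` T" for x
    using that by (cases x) (intro bexI[of _ "(x, x)"], auto)
  show "\<exists>(y, y')\<in>?Z. circle D (fst g') y' = circle D (fst g') x"
    if "x \<in> points D" "circle D (fst g') x \<notin> circle D (fst g') ` T" for x
    using that change(4)[of x] by (cases x) (intro bexI[of _ "(x, x)"], auto)
  show "circle D (fst g) x = circle D (fst g) y \<longleftrightarrow> circle D (fst g') x' = circle D (fst g') y'"
    if "(x, x') \<in> ?Z" "(y, y') \<in> ?Z" for x x' y y'
    using that change(1)[of x] change(1)[of y] by auto
qed


section \<open>Comparison of diagrams that differ in one part\<close>

definition agree_outside :: "nat \<Rightarrow> nat \<Rightarrow> nat \<Rightarrow> resolution \<Rightarrow> resolution \<Rightarrow> bool" where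
  "agree_outside a n n' r r' \<longleftrightarrow>
     (\<forall>l<a. l \<in> r \<longleftrightarrow> l \<in> r') \<and> (\<forall>l. a + n + l \<in> r \<longleftrightarrow> a + n' + l \<in> r')"

lemma same_outside_iff:
  "same_outside a n n' S g g' \<longleftrightarrow>
     (\<forall>x x'. corresponds a n n' x x' \<and> x \<notin> S \<longrightarrow> has_X g x = has_X g' x')"
  by (auto simp: same_outside_def corresponds_def)

lemma corresponds_sym: "corresponds a n n' x x' \<longleftrightarrow> corresponds a n' n x' x"
  by (auto simp: corresponds_def)

lemma same_outside_sym: "same_outside a n n' {} g g' \<longleftrightarrow> same_outside a n' n {} g' g"
  using corresponds_sym[of a n n'] by (auto simp: same_outside_iff)

lemma corresponds_points:
  assumes "corresponds (length P) (length M) (length M') x x'" "x \<in> points (P @ M @ Q)"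
    and "diagram_fits 0 (P @ M @ Q)" "diagram_fits 0 (P @ M' @ Q)"
    and "diagram_width (diagram_width 0 P) M = diagram_width (diagram_width 0 P) M'"
  shows "x' \<in> points (P @ M' @ Q)"
  using corresponding_point[of "resolve 0 P {}" "resolve (length P) M {}" "resolve (length P) M' {}" x x' 0
      "resolve (length P + length M) Q {}"] assms
    resolve_cong[of Q "length P + length M'" "{}" "length P + length M" "{}"]
  by (simp add: points_tangle[where r = "{}"] resolve_append)

text \<open>
  All that is required to compare the circles of the two resolved diagrams, apart from the relation
  between the resolved parts \<open>M\<close> and \<open>M'\<close> themselves.
\<close>

definition replacement ::
  "diagram \<Rightarrow> diagram \<Rightarrow> diagram \<Rightarrow> diagram \<Rightarrow> resolution \<Rightarrow> resolution \<Rightarrow> bool" where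
  "replacement P M M' Q r r' \<longleftrightarrow> diagram_fits 0 (P @ M @ Q) \<and> diagram_fits 0 (P @ M' @ Q) \<and>
     diagram_width (diagram_width 0 P) M = diagram_width (diagram_width 0 P) M' \<and>
     agree_outside (length P) (length M) (length M') r r'"

lemma replacement_sym: "replacement P M M' Q r r' \<Longrightarrow> replacement P M' M Q r' r"
  by (auto simp: replacement_def agree_outside_def)

lemma replacement_tangles:
  assumes "replacement P M M' Q r r'"
  defines "P0 \<equiv> resolve 0 P r" and "Q0 \<equiv> resolve (length P + length M) Q r"
  shows "resolve 0 (P @ M @ Q) r = P0 @ resolve (length P) M r @ Q0"
    and "resolve 0 (P @ M' @ Q) r' = P0 @ resolve (length P) M' r' @ Q0"
proof -
  show "resolve 0 (P @ M @ Q) r = P0 @ resolve (length P) M r @ Q0"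
    by (simp add: resolve_append P0_def Q0_def)
  have "resolve 0 P r' = P0" "resolve (length P + length M') Q r' = Q0"
    using assms unfolding replacement_def agree_outside_def P0_def Q0_def
    by (auto intro!: resolve_cong)
  then show "resolve 0 (P @ M' @ Q) r' = P0 @ resolve (length P) M' r' @ Q0"
    by (simp add: resolve_append)
qed

lemma simulates_circles:
  assumes rep: "replacement P M M' Q r r'"
    and sim: "simulates (diagram_width 0 P) (resolve (length P) M r) (resolve (length P) M' r')"
    and x: "x \<in> points (P @ M @ Q)" "corresponds (length P) (length M) (length M') x x'"
    and y: "y \<in> points (P @ M @ Q)" "corresponds (length P) (length M) (length M') y y'"
    and eq: "circle (P @ M @ Q) r x = circle (P @ M @ Q) r y"
  shows "circle (P @ M' @ Q) r' x' = circle (P @ M' @ Q) r' y'"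
proof -
  let ?P = "resolve 0 P r" and ?Q = "resolve (length P + length M) Q r"
  note T = replacement_tangles[OF rep]
  have fits: "diagram_fits 0 (P @ M @ Q)" "diagram_fits 0 (P @ M' @ Q)"
    using rep by (simp_all add: replacement_def)
  then have "fits 0 (?P @ resolve (length P) M r @ ?Q)" "fits 0 (?P @ resolve (length P) M' r' @ ?Q)"
    using rep by (simp_all add: replacement_def)
  then show ?thesis
    using sim[unfolded simulates_def, rule_format, of ?P ?Q x y x' y'] x y eq fits
    by (simp add: circle_component bonds_tangle T points_tangle[of "P @ M @ Q" r])
qed

lemma equivalent_circles:
  assumes rep: "replacement P M M' Q r r'"
    and equiv: "equivalent (diagram_width 0 P) (resolve (length P) M r) (resolve (length P) M' r')"
    and x: "x \<in> points (P @ M @ Q)" "corresponds (length P) (length M) (length M') x x'"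
    and y: "y \<in> points (P @ M @ Q)" "corresponds (length P) (length M) (length M') y y'"
  shows "circle (P @ M @ Q) r x = circle (P @ M @ Q) r y
     \<longleftrightarrow> circle (P @ M' @ Q) r' x' = circle (P @ M' @ Q) r' y'"
proof -
  have "x' \<in> points (P @ M' @ Q)" "y' \<in> points (P @ M' @ Q)"
    using rep x y corresponds_points[of P M M' _ _ Q] unfolding replacement_def by blast+
  then show ?thesis
    using simulates_circles[OF rep _ x y] simulates_circles[OF replacement_sym[OF rep], of x' x y' y]
      equiv x y by (auto simp: equivalent_def corresponds_sym)
qed

lemma covered_circles:
  assumes "diagram_fits 0 (P @ M @ Q)" "covered (diagram_width 0 P) (resolve (length P) M r)"
    and "x \<in> points (P @ M @ Q)"
  obtains y y' where "y \<in> points (P @ M @ Q)" "circle (P @ M @ Q) r y = circle (P @ M @ Q) r x"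
    "corresponds (length P) (length M) n' y y'"
proof -
  let ?D = "P @ M @ Q"
  have T: "resolve 0 ?D r = resolve 0 P r @ resolve (length P) M r @ resolve (length P + length M) Q r"
    by (simp add: resolve_append)
  have "fits 0 (resolve 0 P r @ resolve (length P) M r @ resolve (length P + length M) Q r)"
    using assms(1) by simp
  then obtain y where y: "y \<in> points ?D" "fst y \<le> length P \<or> length P + length M \<le> fst y"
    "circle ?D r x = circle ?D r y"
    using assms(2)[unfolded covered_def, rule_format, of "resolve 0 P r" "resolve (length P + length M) Q r" x]
      assms(1,3) by (auto simp: circle_component bonds_tangle T points_tangle[of ?D r])
  define y' where "y' = (if fst y \<le> length P then y else (fst y - length M + n', snd y))"
  have "corresponds (length P) (length M) n' y y'" using y(2) by (auto simp: corresponds_def y'_def)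
  then show ?thesis using y that by metis
qed

lemma equivalent_label_degree:
  assumes rep: "replacement P M M' Q (fst g) (fst g')"
    and equiv: "equivalent (diagram_width 0 P) (resolve (length P) M (fst g)) (resolve (length P) M' (fst g'))"
    and g: "g \<in> generators (P @ M @ Q)" "g' \<in> generators (P @ M' @ Q)"
    and same: "same_outside (length P) (length M) (length M') {} g g'"
  shows "label_degree (P @ M @ Q) g = label_degree (P @ M' @ Q) g'"
proof -
  let ?D = "P @ M @ Q" and ?D' = "P @ M' @ Q" and ?r = "fst g" and ?r' = "fst g'"
  let ?corr = "corresponds (length P) (length M) (length M')"
  let ?Z = "{(x, x'). x \<in> points ?D \<and> x' \<in> points ?D' \<and> ?corr x x'}"
  have fits: "diagram_fits 0 ?D" "diagram_fits 0 ?D'"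
    and width: "diagram_width (diagram_width 0 P) M = diagram_width (diagram_width 0 P) M'"
    using rep by (simp_all add: replacement_def)
  have "label_degree ?D g - degree_on ?D g {} = label_degree ?D' g' - degree_on ?D' g' {}"
  proof (rule label_degree_compare[OF fits g, where Z = ?Z])
    show "x \<in> points ?D \<and> x' \<in> points ?D' \<and> circle ?D ?r x \<notin> circle ?D ?r ` {} \<and>
        circle ?D' ?r' x' \<notin> circle ?D' ?r' ` {} \<and> has_X g x = has_X g' x'" if "(x, x') \<in> ?Z" for x x'
      using that same[unfolded same_outside_iff, rule_format, of x x'] by auto
    show "\<exists>(y, y')\<in>?Z. circle ?D ?r y = circle ?D ?r x" if x: "x \<in> points ?D" for x
    proof -
      obtain y y' where "y \<in> points ?D" "circle ?D ?r y = circle ?D ?r x" "?corr y y'"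
        using covered_circles[OF fits(1) _ x] equiv unfolding equivalent_def by metis
      then show ?thesis using corresponds_points[OF _ _ fits width] by blast
    qed
    show "\<exists>(y, y')\<in>?Z. circle ?D' ?r' y' = circle ?D' ?r' x" if x: "x \<in> points ?D'" for x
    proof -
      obtain y y' where "y \<in> points ?D'" "circle ?D' ?r' y = circle ?D' ?r' x"
        "corresponds (length P) (length M') (length M) y y'"
        using covered_circles[OF fits(2) _ x] equiv unfolding equivalent_def by metis
      moreover from this have "y' \<in> points ?D"
        using corresponds_points[OF _ _ fits(2,1) width[symmetric]] by blast
      ultimately show ?thesis
        using corresponds_sym[of _ _ _ y y'] by (intro bexI[of _ "(y', y)"]) auto
    qed
  qed (use equivalent_circles[OF rep equiv] in auto)
  then show ?thesis by (simp add: degree_on_def)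
qed


section \<open>Saddles\<close>

lemma circle_bond:
  assumes "l < length D" "(u, v) \<in> slice_bonds (D ! l) (l \<in> r) l (length (strands D l))"
  shows "circle D r u = circle D r v"
  unfolding circle_component by (rule component_bond) (use assms in \<open>auto simp: bonds_def\<close>)

lemma crossing_width:
  assumes "diagram_fits 0 D" "l < length D" "D ! l = Cross i k"
  shows "i + 1 < length (strands D l)" "length (strands D (Suc l)) = length (strands D l)"
proof -
  have "fits_width (width 0 (take l (resolve 0 D {}))) (fst (resolve 0 D {} ! l))"
    using assms by (intro fits_nth) auto
  then show "i + 1 < length (strands D l)"
    using assms by (simp add: take_resolve length_strands)
  show "length (strands D (Suc l)) = length (strands D l)"
    using assms by (simp add: length_strands take_Suc_conv_app_nth)
qed

lemma crossing_points:
  assumes "diagram_fits 0 D" "l < length D" "D ! l = Cross i k"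
  shows "{(l, i), (l, i + 1), (Suc l, i), (Suc l, i + 1)} \<subseteq> points D"
  using crossing_width[OF assms] assms(2) by (simp add: points_def)

lemma circle_vertical:
  assumes "diagram_fits 0 D" "l < length D" "D ! l = Cross i k" "k \<longleftrightarrow> l \<notin> r"
  shows "circle D r (Suc l, i) = circle D r (l, i)" "circle D r (Suc l, i + 1) = circle D r (l, i + 1)"
  using crossing_width[OF assms(1-3)] assms by (intro circle_bond[symmetric, of l]; simp)+

lemma circle_horizontal:
  assumes "l < length D" "D ! l = Cross i k" "k \<longleftrightarrow> l \<in> r"
  shows "circle D r (l, i + 1) = circle D r (l, i)" "circle D r (Suc l, i + 1) = circle D r (Suc l, i)"
  using assms by (intro circle_bond[symmetric, of l]; simp)+

lemma bonds_change:
  assumes "\<And>l. \<lbrakk>l < length D; (l \<in> r) \<noteq> (l \<in> r')\<rbrakk> \<Longrightarrow>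
    \<exists>i k. D ! l = Cross i k \<and> {(l, i), (l, i + 1), (Suc l, i), (Suc l, i + 1)} \<subseteq> T"
  shows "bonds D r - bonds D r' \<subseteq> T \<times> T"
proof
  fix x assume "x \<in> bonds D r - bonds D r'"
  then obtain l where l: "l < length D" "x \<in> slice_bonds (D ! l) (l \<in> r) l (length (strands D l))"
    "x \<notin> slice_bonds (D ! l) (l \<in> r') l (length (strands D l))"
    by (auto simp: bonds_def)
  have "(l \<in> r) \<noteq> (l \<in> r')"
  proof
    assume "(l \<in> r) = (l \<in> r')"
    then show False using l(2,3) by (simp only:)
  qed
  from assms[OF l(1) this] l(2,3) show "x \<in> T \<times> T"
    by (auto split: if_splits)
qed

lemma coeff_bn_U: "coeff (bn_U :: 'f::field poly) n \<noteq> 0 \<Longrightarrow> n = 1"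
  by (auto simp: bn_U_def coeff_pCons split: nat.splits)

lemma mult_coeff_degree:
  "coeff (mult_coeff (bn_U :: 'f::field poly) x y z) n \<noteq> 0 \<Longrightarrow>
     weight x + weight y = weight z - 2 * int n + 1"
  using coeff_bn_U[of n, where 'f = 'f]
  by (cases x; cases y; cases z)
     (auto simp: mult_coeff_def alg_coeff_def alg_mult_def alg_basis_def alg_X_def alg_one_def
        weight_def split: if_splits)

lemma comult_coeff_degree:
  "coeff (comult_coeff (bn_U :: 'f::field poly) x y z) n \<noteq> 0 \<Longrightarrow>
     weight x = weight y + weight z - 2 * int n + 1"
  using coeff_bn_U[of n, where 'f = 'f]
  by (cases x; cases y; cases z)
     (auto simp: comult_coeff_def alg_comult_def alg_basis_def alg_X_def alg_one_def
        weight_def split: if_splits)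

lemma degree_on_pair:
  assumes "g \<in> generators D"
  shows "degree_on D g {p, q} = (if circle D (fst g) p = circle D (fst g) q then weight (has_X g p)
    else weight (has_X g p) + weight (has_X g q))"
  using assms has_X_circle[OF assms, of p q] by (simp add: degree_on_def circle_labelled)

text \<open>
  Multiplication and comultiplication lower the degree by 1, counting \<open>U\<close> as -2.
\<close>

lemma saddle_coeff_degree:
  assumes g: "g \<in> generators D" "g' \<in> generators D'"
    and "coeff (saddle_coeff (bn_U :: 'f::field poly) (circle D (fst g)) (circle D' (fst g')) g g' p q p' q') n \<noteq> 0"
  shows "degree_on D g {p, q} = degree_on D' g' {p', q'} - 2 * int n + 1"
  using assms(3) unfolding saddle_coeff_def degree_on_pair[OF g(1)] degree_on_pair[OF g(2)]
  by (auto split: if_splits dest: mult_coeff_degree comult_coeff_degree)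

lemma degree_on_cong:
  "circle D (fst g) ` X = circle D (fst g) ` Y \<Longrightarrow> degree_on D g X = degree_on D g Y"
  by (simp add: degree_on_def)

text \<open>
  The four ends of the arcs at a crossing lie on the circles through the ends of the saddle's arc, so
  the difference of the label degrees is that of the two sides of the saddle.
\<close>

lemma edge_coeff_degree:
  assumes D: "diagram_fits 0 D" and l: "l < length D" "D ! l = Cross i k"
    and r: "l \<notin> fst g" "fst g' = insert l (fst g)"
    and g: "g \<in> generators D" "g' \<in> generators D"
    and pq: "(p, q, p', q') = (if k then ((l, i), (l, i + 1), (l, i), (Suc l, i))
      else ((l, i), (Suc l, i), (l, i), (l, i + 1)))"
    and coeff: "coeff (edge_coeff (bn_U :: 'f::field poly) D g g' p q p' q') n \<noteq> 0"
  shows "label_degree D g = label_degree D g' - 2 * int n + 1"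
proof -
  let ?c = "circle D (fst g)" and ?c' = "circle D (fst g')"
  let ?T = "{(l, i), (l, i + 1), (Suc l, i), (Suc l, i + 1)}"
  have T: "?c ` ?T = ?c ` {p, q}" "?c' ` ?T = ?c' ` {p', q'}"
    using circle_vertical[OF D l, of "fst g"] circle_vertical[OF D l, of "fst g'"]
      circle_horizontal[OF l, of "fst g"] circle_horizontal[OF l, of "fst g'"] r pq
    by (auto split: if_splits)
  have same: "same_outside 0 0 0 (?c p \<union> ?c q) g g'"
    and "coeff (saddle_coeff (bn_U :: 'f poly) ?c ?c' g g' p q p' q') n \<noteq> 0"
    using coeff by (auto simp: edge_coeff_def Let_def split: if_splits)
  note saddle = saddle_coeff_degree[OF g this(2)]
  have "label_degree D g - degree_on D g ?T = label_degree D g' - degree_on D g' ?T"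
  proof (rule label_degree_local_change[OF D g])
    show "bonds D (fst g) - bonds D (fst g') \<subseteq> ?T \<times> ?T" "bonds D (fst g') - bonds D (fst g) \<subseteq> ?T \<times> ?T"
      by (rule bonds_change; use r l in auto)+
    show "?T \<subseteq> points D" using crossing_points[OF D l] .
    fix x assume "?c x \<notin> ?c ` ?T"
    then have "x \<notin> ?c p \<union> ?c q" unfolding T by (auto simp: circle_component component_eq_iff[symmetric])
    then show "has_X g x = has_X g' x"
      using same[unfolded same_outside_iff, rule_format, of x x] by (auto simp: corresponds_def)
  qed
  then show ?thesis using saddle degree_on_cong[OF T(1)] degree_on_cong[OF T(2)] by simp
qed


section \<open>Curls and bigons\<close>

lemma slice_bonds_levels:
  "((l1, p1), (l2, p2)) \<in> slice_bonds s one l n \<Longrightarrow> l1 \<in> {l, Suc l} \<and> l2 \<in> {l, Suc l}"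
  by (cases s) (auto split: if_splits)

lemma tangle_bonds_three:
  "tangle_bonds w [x, y, z] = slice_bonds (fst x) (snd x) 0 w
     \<union> slice_bonds (fst y) (snd y) 1 (out_width w (fst x))
     \<union> slice_bonds (fst z) (snd z) 2 (out_width (out_width w (fst x)) (fst y))"
  by (auto simp: tangle_bonds_def lessThan_Suc numeral_2_eq_2)

lemma circle_raise:
  assumes "diagram_fits 0 (P @ M @ Q)"
    and "component (tangle_bonds (diagram_width 0 P) (resolve (length P) M r)) (l, p)
       = component (tangle_bonds (diagram_width 0 P) (resolve (length P) M r)) (l', p')"
  shows "circle (P @ M @ Q) r (length P + l, p) = circle (P @ M @ Q) r (length P + l', p')"
  using component_raise[OF assms(2), of "resolve 0 P r" "resolve (length P + length M) Q r"] assms(1)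
  by (simp add: circle_component bonds_tangle resolve_append add.commute)

text \<open>
  With its crossing resolved vertically a curl consists of a loop and a strand parallel to the
  original one.  Only the circle through the strand at position \<open>i\<close> may carry different labels
  before and after.
\<close>

lemma curl_label_degree:
  assumes fits: "diagram_fits 0 (P @ Q)" "diagram_fits 0 (add_curl P i b k Q)"
    and g: "g \<in> generators (P @ Q)" "g' \<in> generators (add_curl P i b k Q)"
    and r: "agree_outside (length P) 0 3 (fst g) (fst g')" "k \<longleftrightarrow> length P + 1 \<notin> fst g'"
    and labels: "\<And>x x'. \<lbrakk>corresponds (length P) 0 3 x x';
        circle (P @ Q) (fst g) x \<noteq> circle (P @ Q) (fst g) (length P, i)\<rbrakk> \<Longrightarrow> has_X g x = has_X g' x'"
  shows "label_degree (P @ Q) g - weight (has_X g (length P, i))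
    = label_degree (add_curl P i b k Q) g'
      - weight (has_X g' (length P, i)) - weight (has_X g' (length P + 1, i + 1))"
proof -
  let ?a = "length P" and ?w = "diagram_width 0 P" and ?D = "P @ Q" and ?D' = "add_curl P i b k Q"
  let ?c = "circle ?D (fst g)" and ?c' = "circle ?D' (fst g')"
  let ?M = "resolve ?a (curl i b k) (fst g')"
  have D': "?D' = P @ curl i b k @ Q" by (simp add: add_curl_def)
  have i: "i < ?w" using fits(2) by (simp add: D' curl_def)
  have M: "?M = [(Cup (i + 1) b, ?a \<in> fst g'), (Cross i k, \<not> k), (Cap (i + 1), ?a + 2 \<in> fst g')]"
    using r(2) by (simp add: curl_def)
  have rep: "replacement P [] (curl i b k) Q (fst g) (fst g')"
    using fits r(1) by (simp add: replacement_def D' curl_def numeral_3_eq_3)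
  have sim: "simulates ?w (resolve ?a [] (fst g)) ?M" "simulates ?w ?M (resolve ?a [] (fst g))"
    using simulates_curl[OF i _ M] by simp_all
  have eq: "?c x = ?c y \<longleftrightarrow> ?c' x' = ?c' y'"
    if "x \<in> points ?D" "corresponds ?a 0 3 x x'" "y \<in> points ?D" "corresponds ?a 0 3 y y'" for x x' y y'
  proof -
    have "x' \<in> points ?D'" "y' \<in> points ?D'"
      using that corresponds_points[of P "[]" "curl i b k" _ _ Q] fits
      by (auto simp: D' curl_def numeral_3_eq_3)
    then show ?thesis
      using simulates_circles[OF rep sim(1), of x x' y y']
        simulates_circles[OF replacement_sym[OF rep] sim(2), of x' x y' y] that corresponds_sym[of ?a 0 3]
      by (auto simp: D' curl_def numeral_3_eq_3)
  qed
  \<comment> \<open>The loop of the curl consists of four points and contains no point outside of the curl.\<close>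
  let ?L = "{(?a + 1, i + 1), (?a + 1, i + 2), (?a + 2, i + 1), (?a + 2, i + 2)}"
  have loop: "x \<in> ?L" if "?c' x = ?c' (?a + 1, i + 1)" for x
  proof -
    have "(x \<in> ?L) = ((?a + 1, i + 1) \<in> ?L)"
    proof (rule component_invariant[OF that[unfolded circle_component]])
      fix u v assume "(u, v) \<in> bonds ?D' (fst g')"
      then obtain l where l: "l < length ?D'"
        "(u, v) \<in> slice_bonds (?D' ! l) (l \<in> fst g') l (length (strands ?D' l))"
        by (auto simp: bonds_def)
      consider "l = ?a" "?D' ! l = Cup (i + 1) b" | "l = ?a + 1" "?D' ! l = Cross i k"
        | "l = ?a + 2" "?D' ! l = Cap (i + 1)" | "l < ?a \<or> l > ?a + 2"
      proof -
        have "?D' ! ?a = Cup (i + 1) b" "?D' ! (?a + 1) = Cross i k" "?D' ! (?a + 2) = Cap (i + 1)"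
          by (simp_all add: D' curl_def nth_append)
        moreover have "l = ?a \<or> l = ?a + 1 \<or> l = ?a + 2 \<or> l < ?a \<or> l > ?a + 2" by arith
        ultimately show ?thesis using that by blast
      qed
      then show "(u \<in> ?L) = (v \<in> ?L)"
      proof cases
        case 4
        then show ?thesis using l(2) by (cases u; cases v) (auto dest!: slice_bonds_levels)
      qed (use l(2) r(2) in auto)
    qed
    then show ?thesis by simp
  qed
  let ?d = "component (tangle_bonds ?w ?M)"
  have bond: "?d u = ?d v" if "(u, v) \<in> tangle_bonds ?w ?M" for u v
    using that by (rule component_bond)
  have inner: "?c' (?a + l, p) = ?c' (?a + 1, i + 1) \<or> (\<exists>q<?w. ?c' (?a + l, p) = ?c' (?a, q))"
    if "l \<in> {1, 2}" "p < ?w + 2" for l p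
  proof -
    have l1: "?d (l, p) = ?d (1, p)"
    proof (cases "l = 1")
      case False
      then show ?thesis
        using that by (intro bond[symmetric]) (auto simp: M tangle_bonds_three numeral_2_eq_2)
    qed simp
    consider "p \<le> i" | "p = i + 1" | "p = i + 2" | q where "p = i + 3 + q"
    proof -
      have "p \<le> i \<or> p = i + 1 \<or> p = i + 2 \<or> p = i + 3 + (p - i - 3)" by arith
      then show ?thesis using that by blast
    qed
    then have "?d (l, p) = ?d (1, i + 1) \<or> (\<exists>q<?w. ?d (l, p) = ?d (0, q))"
    proof cases
      case 1
      then have "?d (0, p) = ?d (1, p)" by (intro bond) (auto simp: M tangle_bonds_three)
      then show ?thesis using 1 l1 i by (intro disjI2 exI[of _ p]) simp
    next
      case 3
      then have "?d (1, i + 1) = ?d (1, p)" by (intro bond) (auto simp: M tangle_bonds_three)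
      then show ?thesis using l1 by simp
    next
      case 4
      then have "?d (0, i + 1 + q) = ?d (1, p)" using that
        by (intro bond) (auto simp: M tangle_bonds_three)
      then show ?thesis using 4 l1 that by (intro disjI2 exI[of _ "i + 1 + q"]) simp
    qed (use l1 in simp)
    then show ?thesis
      using circle_raise[OF fits(2)[unfolded D'], of "fst g'" l p 1 "i + 1"]
        circle_raise[OF fits(2)[unfolded D'], of "fst g'" l p 0] by (fastforce simp: D')
  qed
  have ai: "(?a, i) \<in> points ?D" "corresponds ?a 0 3 (?a, i) (?a, i)"
    using i fits(1) by (simp_all add: points_def length_strands corresponds_def)
  have ai': "(?a, i) \<in> points ?D'" "(?a + 1, i + 1) \<in> points ?D'"
    using i fits(2) by (simp_all add: points_def length_strands D' curl_def)
  have ne: "?c' (?a, i) \<noteq> ?c' (?a + 1, i + 1)" using loop[of "(?a, i)"] by auto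
  let ?Z = "{(x, x'). x \<in> points ?D \<and> x' \<in> points ?D' \<and> corresponds ?a 0 3 x x' \<and> ?c x \<noteq> ?c (?a, i)}"
  have "label_degree ?D g - degree_on ?D g {(?a, i)}
      = label_degree ?D' g' - degree_on ?D' g' {(?a, i), (?a + 1, i + 1)}"
  proof (rule label_degree_compare[OF fits g, where Z = ?Z])
    show "x \<in> points ?D \<and> x' \<in> points ?D' \<and> ?c x \<notin> ?c ` {(?a, i)} \<and>
        ?c' x' \<notin> ?c' ` {(?a, i), (?a + 1, i + 1)} \<and> has_X g x = has_X g' x'" if "(x, x') \<in> ?Z" for x x'
    proof -
      have "x' \<notin> ?L" using that by (auto simp: corresponds_def)
      then have "?c' x' \<noteq> ?c' (?a + 1, i + 1)" using loop by blast
      then show ?thesis using that eq[of x x' "(?a, i)" "(?a, i)"] ai labels[of x x'] by auto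
    qed
    have outer: "\<exists>(y, y')\<in>?Z. ?c' y' = ?c' x'"
      if "x' \<in> points ?D'" "fst x' \<le> ?a \<or> ?a + 3 \<le> fst x'" "?c' x' \<noteq> ?c' (?a, i)" for x'
    proof -
      define x where "x = (if fst x' \<le> ?a then x' else (fst x' - 3, snd x'))"
      have x: "corresponds ?a 0 3 x x'" using that(2) by (auto simp: corresponds_def x_def)
      moreover have "x \<in> points ?D"
        using corresponds_points[of P "curl i b k" "[]" x' x Q] x that(1) fits corresponds_sym[of ?a 0 3 x x']
        by (simp add: D' curl_def numeral_3_eq_3)
      ultimately show ?thesis using that eq[of x x' "(?a, i)" "(?a, i)"] ai
        by (intro bexI[of _ "(x, x')"]) auto
    qed
    show "\<exists>(y, y')\<in>?Z. ?c' y' = ?c' x'"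
      if x': "x' \<in> points ?D'" "?c' x' \<notin> ?c' ` {(?a, i), (?a + 1, i + 1)}" for x'
    proof (cases "fst x' \<le> ?a \<or> ?a + 3 \<le> fst x'")
      case True
      then show ?thesis using x' by (intro outer) auto
    next
      case False
      define l p where "l = fst x' - ?a" and "p = snd x'"
      have lp: "x' = (?a + l, p)" "l \<in> {1, 2}"
        using False by (cases x'; auto simp: l_def p_def)+
      then have "p < ?w + 2"
        using x'(1) fits(2) by (auto simp: points_def length_strands D' curl_def)
      from inner[OF lp(2) this] x'(2) lp(1) obtain q where q: "q < ?w" "?c' x' = ?c' (?a, q)" by auto
      then have "(?a, q) \<in> points ?D'"
        using fits(2) by (simp add: points_def length_strands D')
      then show ?thesis using x'(2) unfolding q(2) by (intro outer) auto
    qed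
    show "\<exists>(y, y')\<in>?Z. ?c y = ?c x" if "x \<in> points ?D" "?c x \<notin> ?c ` {(?a, i)}" for x
    proof -
      define x' where "x' = (if fst x \<le> ?a then x else (fst x + 3, snd x))"
      have "corresponds ?a 0 3 x x'" by (auto simp: corresponds_def x'_def)
      moreover from this have "x' \<in> points ?D'"
        using corresponds_points[of P "[]" "curl i b k" x x' Q] that(1) fits
        by (simp add: D' curl_def numeral_3_eq_3)
      ultimately show ?thesis using that by (intro bexI[of _ "(x, x')"]) auto
    qed
    show "?c x = ?c y \<longleftrightarrow> ?c' x' = ?c' y'" if "(x, x') \<in> ?Z" "(y, y') \<in> ?Z" for x x' y y'
      using that eq[of x x' y y'] by blast
  qed (use ai ai' in auto)
  then show ?thesis using ne g by (simp add: degree_on_pair) (simp add: degree_on_def circle_labelled)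
qed


text \<open>
  The resolution of a bigon with two horizontal crossings.  Making both crossings vertical changes
  bonds within six points only, and a vertical bigon is a replacement of two straight strands.
  Composing the two comparisons relates the diagram without the bigon to the resolution in which the
  bigon has become a small circle and a saddle has been made.
\<close>

lemma bigon_circles:
  fixes P Q i k r r'
  defines "a \<equiv> length P" and "D \<equiv> P @ Q" and "D' \<equiv> add_bigon P i k Q"
  defines "c \<equiv> circle D r" and "c' \<equiv> circle D' r'"
  defines "T \<equiv> {(a, i), (a, i + 1), (a + 1, i), (a + 1, i + 1), (a + 2, i), (a + 2, i + 1)}"
  assumes fits: "diagram_fits 0 D'" and r: "agree_outside a 0 2 r r'" "a \<in> r' \<longleftrightarrow> k" "a + 1 \<in> r' \<longleftrightarrow> \<not> k"
  shows bigon_image: "c' ` T = insert (c' (a + 1, i)) (c' ` {(a, i), (a + 2, i)})"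
    and bigon_loop: "c' x' = c' (a + 1, i) \<Longrightarrow> x' \<in> {(a + 1, i), (a + 1, i + 1)}"
    and bigon_affected: "\<lbrakk>corresponds a 0 2 x x'; x \<in> points D\<rbrakk> \<Longrightarrow>
      c x \<in> c ` {(a, i), (a, i + 1)} \<longleftrightarrow> c' x' \<in> c' ` {(a, i), (a + 2, i)}"
    and bigon_matched: "\<lbrakk>corresponds a 0 2 x x'; x \<in> points D; corresponds a 0 2 y y'; y \<in> points D;
      c x \<notin> c ` {(a, i), (a, i + 1)}; c y \<notin> c ` {(a, i), (a, i + 1)}\<rbrakk> \<Longrightarrow> c x = c y \<longleftrightarrow> c' x' = c' y'"
    and bigon_covered: "\<lbrakk>x' \<in> points D'; c' x' \<notin> c' ` T\<rbrakk> \<Longrightarrow>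
      \<exists>y y'. y \<in> points D \<and> y' \<in> points D' \<and> corresponds a 0 2 y y' \<and> c' y' = c' x'"
proof -
  let ?M = "[Cross i k, Cross i (\<not> k)]" and ?w = "diagram_width 0 P"
  have D': "D' = P @ ?M @ Q" by (simp add: D'_def add_bigon_def)
  have i: "i + 1 < ?w" using fits by (simp add: D')
  have fits0: "diagram_fits 0 (P @ [] @ Q)" "diagram_fits 0 (P @ ?M @ Q)" using fits by (simp_all add: D')
  have l: "a < length D'" "D' ! a = Cross i k" "a + 1 < length D'" "D' ! (a + 1) = Cross i (\<not> k)"
    by (simp_all add: D' a_def nth_append)
  \<comment> \<open>the resolution that agrees with \<open>r'\<close> except that both crossings of the bigon are vertical\<close>
  define r0 where "r0 = (r' - {a, a + 1}) \<union> (if k then {a + 1} else {a})"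
  define d where "d = circle D' r0"
  have r0: "a \<in> r0 \<longleftrightarrow> \<not> k" "a + 1 \<in> r0 \<longleftrightarrow> k" by (auto simp: r0_def)
  have rep: "replacement P [] ?M Q r r0"
    using fits r(1) by (auto simp: replacement_def D' agree_outside_def r0_def a_def)
  have equiv: "equivalent ?w (resolve (length P) [] r) (resolve (length P) ?M r0)"
  proof -
    have "resolve (length P) ?M r0 = [(Cross i k, \<not> k), (Cross i (\<not> k), k)]"
      using r0 by (simp add: a_def)
    then show ?thesis using equivalent_bigon[OF i, of k] equivalent_sym by simp
  qed
  have cd: "c x = c y \<longleftrightarrow> d x' = d y'"
    if "corresponds a 0 2 x x'" "x \<in> points D" "corresponds a 0 2 y y'" "y \<in> points D" for x x' y y'
    using equivalent_circles[OF rep equiv, of x x' y y'] that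
    by (simp add: c_def d_def D' D_def a_def numeral_2_eq_2)
  have bonds: "bonds D' r' - bonds D' r0 \<subseteq> T \<times> T" "bonds D' r0 - bonds D' r' \<subseteq> T \<times> T"
  proof -
    have *: "l = a \<or> l = a + 1" if "(l \<in> r') \<noteq> (l \<in> r0)" for l
      using that by (auto simp: r0_def split: if_splits)
    have **: "\<exists>i k. D' ! l = Cross i k \<and> {(l, i), (l, i + 1), (Suc l, i), (Suc l, i + 1)} \<subseteq> T"
      if "(l \<in> r') \<noteq> (l \<in> r0)" for l
    proof -
      have T: "{(a, i), (a, i + 1), (Suc a, i), (Suc a, i + 1)} \<subseteq> T"
        "{(a + 1, i), (a + 1, i + 1), (Suc (a + 1), i), (Suc (a + 1), i + 1)} \<subseteq> T"
        by (auto simp: T_def)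
      from * [OF that] show ?thesis by (elim disjE) (use l T in blast)+
    qed
    show "bonds D' r' - bonds D' r0 \<subseteq> T \<times> T" by (rule bonds_change, rule **)
    show "bonds D' r0 - bonds D' r' \<subseteq> T \<times> T" by (rule bonds_change, rule **) auto
  qed
  have dT: "d ` T = d ` {(a, i), (a, i + 1)}"
    using circle_vertical[OF fits l(1,2), of r0] circle_vertical[OF fits l(3,4), of r0] r0
    by (auto simp: d_def T_def)
  show c'T: "c' ` T = insert (c' (a + 1, i)) (c' ` {(a, i), (a + 2, i)})"
    using circle_horizontal[OF l(1,2), of r'] circle_horizontal[OF l(3,4), of r'] r
    by (auto simp: c'_def T_def)
  have loop: "x' \<in> {(a + 1, i), (a + 1, i + 1)}" if "c' x' = c' (a + 1, i)" for x'
  proof -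
    let ?L = "{(a + 1, i), (a + 1, i + 1)}"
    have "(x' \<in> ?L) = ((a + 1, i) \<in> ?L)"
    proof (rule component_invariant[OF that[unfolded c'_def circle_component]])
      fix u v assume "(u, v) \<in> bonds D' r'"
      then obtain l' where l': "l' < length D'"
        "(u, v) \<in> slice_bonds (D' ! l') (l' \<in> r') l' (length (strands D' l'))"
        by (auto simp: bonds_def)
      consider "l' = a" | "l' = a + 1" | "l' < a \<or> l' > a + 1" by linarith
      then show "(u \<in> ?L) = (v \<in> ?L)"
      proof cases
        case 3
        then show ?thesis using l'(2) by (cases u; cases v) (auto dest!: slice_bonds_levels)
      qed (use l'(2) l r in auto)
    qed
    then show ?thesis by simp
  qed
  then show "c' x' = c' (a + 1, i) \<Longrightarrow> x' \<in> {(a + 1, i), (a + 1, i + 1)}" for x' .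
  note change = circle_local_change[OF bonds(2,1), folded d_def c'_def]
    circle_local_change[OF bonds, folded d_def c'_def]
  have ai: "corresponds a 0 2 (a, i) (a, i)" "corresponds a 0 2 (a, i + 1) (a, i + 1)"
    "(a, i) \<in> points D" "(a, i + 1) \<in> points D"
    using i fits0 by (simp_all add: corresponds_def points_def length_strands D_def a_def)
  have c_d: "c x \<in> c ` {(a, i), (a, i + 1)} \<longleftrightarrow> d x' \<in> d ` T"
    if "corresponds a 0 2 x x'" "x \<in> points D" for x x'
    unfolding dT using cd[OF that ai(1,3)] cd[OF that ai(2,4)] by simp
  have c_c': "c x \<in> c ` {(a, i), (a, i + 1)} \<longleftrightarrow> c' x' \<in> c' ` T"
    if "corresponds a 0 2 x x'" "x \<in> points D" for x x'
    using c_d[OF that] change(2)[of x'] change(4)[of x'] by blast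
  show "c x \<in> c ` {(a, i), (a, i + 1)} \<longleftrightarrow> c' x' \<in> c' ` {(a, i), (a + 2, i)}"
    if "corresponds a 0 2 x x'" "x \<in> points D" for x x'
  proof -
    have "fst x' \<noteq> a + 1" using that(1) by (auto simp: corresponds_def)
    then have "c' x' \<noteq> c' (a + 1, i)" using loop[of x'] by auto
    then show ?thesis using c_c'[OF that] c'T by simp
  qed
  show "c x = c y \<longleftrightarrow> c' x' = c' y'"
    if "corresponds a 0 2 x x'" "x \<in> points D" "corresponds a 0 2 y y'" "y \<in> points D"
      "c x \<notin> c ` {(a, i), (a, i + 1)}" "c y \<notin> c ` {(a, i), (a, i + 1)}" for x x' y y'
    using cd[OF that(1-4)] change(1)[of x'] change(1)[of y'] c_d that by metis
  show "\<exists>y y'. y \<in> points D \<and> y' \<in> points D' \<and> corresponds a 0 2 y y' \<and> c' y' = c' x'"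
    if x': "x' \<in> points D'" "c' x' \<notin> c' ` T" for x'
  proof -
    have "covered ?w (resolve (length P) ?M r0)" "x' \<in> points (P @ ?M @ Q)"
      using equiv x' by (simp_all only: equivalent_def D')
    then obtain y' y where "y' \<in> points (P @ ?M @ Q)"
      "circle (P @ ?M @ Q) r0 y' = circle (P @ ?M @ Q) r0 x'" "corresponds (length P) (length ?M) 0 y' y"
      by (rule covered_circles[OF fits0(2)])
    then have y: "y' \<in> points D'" "d y' = d x'" "corresponds a 2 0 y' y"
      by (simp_all add: D' d_def a_def numeral_2_eq_2)
    moreover have "y \<in> points D"
      using corresponds_points[of P ?M "[]" y' y Q] y fits0 by (simp add: D' D_def a_def numeral_2_eq_2)
    moreover have "d x' = c' x'" "d x' \<notin> d ` T" using change(3,4)[OF x'(2)] by auto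
    moreover from this y have "c' y' = d y'" by (intro change(1)) simp
    ultimately show ?thesis using y corresponds_sym[of a 2 0 y' y] by metis
  qed
qed

lemma bigon_label_degree:
  assumes fits: "diagram_fits 0 (add_bigon P i k Q)"
    and g: "g \<in> generators (P @ Q)" "g' \<in> generators (add_bigon P i k Q)"
    and r: "agree_outside (length P) 0 2 (fst g) (fst g')" "length P \<in> fst g' \<longleftrightarrow> k" "length P + 1 \<in> fst g' \<longleftrightarrow> \<not> k"
    and labels: "\<And>x x'. \<lbrakk>corresponds (length P) 0 2 x x'; x \<in> points (P @ Q);
        circle (P @ Q) (fst g) x \<notin> circle (P @ Q) (fst g) ` {(length P, i), (length P, i + 1)}\<rbrakk> \<Longrightarrow>
        has_X g x = has_X g' x'"
  shows "label_degree (P @ Q) g - degree_on (P @ Q) g {(length P, i), (length P, i + 1)}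
    = label_degree (add_bigon P i k Q) g' - degree_on (add_bigon P i k Q) g' {(length P, i), (length P + 2, i)}
      - weight (has_X g' (length P + 1, i))"
proof -
  let ?a = "length P" and ?D = "P @ Q" and ?D' = "add_bigon P i k Q"
  let ?c = "circle ?D (fst g)" and ?c' = "circle ?D' (fst g')"
  let ?X = "{(?a, i), (?a, i + 1)}" and ?X' = "{(?a, i), (?a + 2, i)}"
  let ?T = "{(?a, i), (?a, i + 1), (?a + 1, i), (?a + 1, i + 1), (?a + 2, i), (?a + 2, i + 1)}"
  have D': "?D' = P @ [Cross i k, Cross i (\<not> k)] @ Q" by (simp add: add_bigon_def)
  have fits0: "diagram_fits 0 (P @ Q)" and i: "i + 1 < diagram_width 0 P" using fits by (simp_all add: D')
  note bigon = bigon_image[OF fits r] bigon_loop[OF fits r] bigon_affected[OF fits r]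
    bigon_matched[OF fits r] bigon_covered[OF fits r]
  let ?Z = "{(x, x'). x \<in> points ?D \<and> x' \<in> points ?D' \<and> corresponds ?a 0 2 x x' \<and> ?c x \<notin> ?c ` ?X}"
  have ne: "?c' x' \<noteq> ?c' (?a + 1, i)" if "fst x' \<noteq> ?a + 1" for x'
    using bigon(2)[of x'] that by auto
  have "label_degree ?D g - degree_on ?D g ?X = label_degree ?D' g' - degree_on ?D' g' ?T"
  proof (rule label_degree_compare[OF fits0 fits g, where Z = ?Z])
    show "?X \<subseteq> points ?D" using i fits0 by (simp add: points_def length_strands)
    show "?T \<subseteq> points ?D'" using i fits by (simp add: points_def length_strands D')
    show "x \<in> points ?D \<and> x' \<in> points ?D' \<and> ?c x \<notin> ?c ` ?X \<and> ?c' x' \<notin> ?c' ` ?T \<and> has_X g x = has_X g' x'"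
      if "(x, x') \<in> ?Z" for x x'
    proof -
      have "fst x' \<noteq> ?a + 1" using that by (auto simp: corresponds_def)
      then show ?thesis using that bigon(3)[of x x'] ne[of x'] labels[of x x'] unfolding bigon(1) by blast
    qed
    show "\<exists>(y, y')\<in>?Z. ?c y = ?c x" if "x \<in> points ?D" "?c x \<notin> ?c ` ?X" for x
    proof -
      define x' where "x' = (if fst x \<le> ?a then x else (fst x + 2, snd x))"
      have "corresponds ?a 0 2 x x'" by (auto simp: corresponds_def x'_def)
      moreover from this have "x' \<in> points ?D'"
        using corresponds_points[of P "[]" "[Cross i k, Cross i (\<not> k)]" x x' Q] that(1) fits fits0
        by (simp add: D' numeral_2_eq_2)
      ultimately show ?thesis using that by (intro bexI[of _ "(x, x')"]) auto
    qed
    show "\<exists>(y, y')\<in>?Z. ?c' y' = ?c' x'" if x': "x' \<in> points ?D'" "?c' x' \<notin> ?c' ` ?T" for x'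
    proof -
      obtain y y' where y: "y \<in> points ?D" "y' \<in> points ?D'" "corresponds ?a 0 2 y y'" "?c' y' = ?c' x'"
        using bigon(5)[OF x'] by blast
      moreover have "?c y \<notin> ?c ` ?X"
        using bigon(3)[OF y(3,1)] y(4) x'(2) unfolding bigon(1) by auto
      ultimately show ?thesis by (intro bexI[of _ "(y, y')"]) auto
    qed
    show "?c x = ?c y \<longleftrightarrow> ?c' x' = ?c' y'" if "(x, x') \<in> ?Z" "(y, y') \<in> ?Z" for x x' y y'
      using that bigon(4)[of x x' y y'] by blast
  qed
  moreover have "degree_on ?D' g' ?T = degree_on ?D' g' ?X' + weight (has_X g' (?a + 1, i))"
  proof -
    have "?c' (?a + 1, i) \<notin> ?c' ` ?X'" using ne[of "(?a, i)"] ne[of "(?a + 2, i)"] by auto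
    then show ?thesis using g(2) unfolding degree_on_def bigon(1) by (simp add: circle_labelled)
  qed
  ultimately show ?thesis by simp
qed


section \<open>Homogeneous chains and graded maps\<close>

text \<open>
  The quantum degree up to the contribution of the crossings' signs.  It makes sense for diagrams
  that are not consistently oriented, as they occur within a third move.
\<close>

definition unsigned_degree :: "diagram \<Rightarrow> generator \<Rightarrow> int" where
  "unsigned_degree D g = label_degree D g + int (card (fst g))"

definition homogeneous :: "diagram \<Rightarrow> int \<Rightarrow> 'f::field poly chain \<Rightarrow> bool" where
  "homogeneous D q x \<longleftrightarrow> (\<forall>g n. coeff (x g) n \<noteq> 0 \<longrightarrow> unsigned_degree D g - 2 * int n = q)"

definition set_one :: "'f::field poly chain \<Rightarrow> 'f chain" where
  "set_one x = (\<lambda>g. poly (x g) 1)"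

text \<open>A map for \<open>BN\<close> of degree \<open>j\<close> together with the map for \<open>TLee\<close> that it induces.\<close>

definition graded_pair ::
  "diagram \<Rightarrow> diagram \<Rightarrow> int \<Rightarrow> ('f::field poly chain \<Rightarrow> 'f poly chain) \<Rightarrow> ('f chain \<Rightarrow> 'f chain) \<Rightarrow> bool"
  where
  "graded_pair D D' j \<Phi> \<phi> \<longleftrightarrow>
     (\<forall>q x. homogeneous D q x \<longrightarrow> homogeneous D' (q + j) (\<Phi> x)) \<and>
     (\<forall>x. set_one (\<Phi> x) = \<phi> (set_one x))"

lemma graded_pair_id: "graded_pair D D 0 id id"
  by (simp add: graded_pair_def)

lemma graded_pair_comp:
  assumes "graded_pair D D' j \<Phi> \<phi>" "graded_pair D' D'' j' \<Phi>' \<phi>'"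
  shows "graded_pair D D'' (j + j') (\<Phi>' \<circ> \<Phi>) (\<phi>' \<circ> \<phi>)"
  using assms by (fastforce simp: graded_pair_def add.assoc)

text \<open>
  The two properties of a pair of maps can be read off from the matrices.
\<close>

lemma graded_pair_linear_map:
  assumes K: "\<And>g g' n. \<lbrakk>g \<in> generators D; g' \<in> generators D'; coeff (K g g') n \<noteq> 0\<rbrakk>
      \<Longrightarrow> unsigned_degree D' g' - 2 * int n = unsigned_degree D g + j"
    and K1: "\<And>g g'. K1 g g' = poly (K g g') 1"
  shows "graded_pair D D' j (linear_map D D' K) (linear_map D D' K1)"
  unfolding graded_pair_def
proof (intro conjI allI impI)
  fix q :: int and x :: "'a poly chain" assume x: "homogeneous D q x"
  show "homogeneous D' (q + j) (linear_map D D' K x)"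
    unfolding homogeneous_def
  proof (intro allI impI)
    fix g' n assume n: "coeff (linear_map D D' K x g') n \<noteq> 0"
    then have g': "g' \<in> generators D'"
      unfolding linear_map_def by (cases "g' \<in> generators D'") simp_all
    then have "(\<Sum>g\<in>generators D. coeff (K g g' * x g) n) \<noteq> 0"
      using n by (simp add: linear_map_def coeff_sum)
    then obtain g where g: "g \<in> generators D" "coeff (K g g' * x g) n \<noteq> 0"
      by (rule sum.not_neutral_contains_not_neutral)
    then have "(\<Sum>i\<le>n. coeff (K g g') i * coeff (x g) (n - i)) \<noteq> 0" by (simp add: coeff_mult)
    then obtain i where "i \<in> {..n}" "coeff (K g g') i * coeff (x g) (n - i) \<noteq> 0"
      by (rule sum.not_neutral_contains_not_neutral)
    then have "i \<le> n" "coeff (K g g') i \<noteq> 0" "coeff (x g) (n - i) \<noteq> 0" by simp_all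
    moreover from this have "unsigned_degree D' g' - 2 * int i = unsigned_degree D g + j"
      "unsigned_degree D g - 2 * int (n - i) = q"
      using K[OF g(1) g'] x unfolding homogeneous_def by blast+
    ultimately show "unsigned_degree D' g' - 2 * int n = q + j" by simp
  qed
next
  fix x show "set_one (linear_map D D' K x) = linear_map D D' K1 (set_one x)"
    by (simp add: fun_eq_iff set_one_def linear_map_def poly_sum K1)
qed

lemma homogeneous_add:
  "homogeneous D q x \<Longrightarrow> homogeneous D q y \<Longrightarrow> homogeneous D q (\<lambda>g. x g + y g)"
  unfolding homogeneous_def by (metis add_cancel_right_left coeff_add)

lemma coeff_of_int_mult: "coeff (of_int e * p) n = of_int e * coeff p n"
  by (simp add: of_int_poly)

lemma poly_of_int [simp]: "poly (of_int e) x = of_int e"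
  by (simp add: of_int_poly)

lemma homogeneous_of_int:
  "homogeneous D q x \<Longrightarrow> homogeneous D q (\<lambda>g. of_int (e g) * x g)"
  by (auto simp: homogeneous_def coeff_of_int_mult)

lemma coeff_of_bool: "coeff (of_bool b) n \<noteq> 0 \<Longrightarrow> b \<and> n = 0"
  by (cases b) (auto simp: coeff_1 split: if_splits)

lemma poly_of_bool [simp]: "poly (of_bool b) x = of_bool b"
  by (cases b) auto

lemma poly_bn_U [simp]: "poly bn_U 1 = 1"
  by (simp add: bn_U_def)

lemma poly_mult_coeff [simp]: "poly (mult_coeff bn_U x y z) 1 = mult_coeff 1 x y z"
  by (simp add: mult_coeff_def alg_coeff_def alg_mult_def alg_basis_def alg_X_def alg_one_def)

lemma poly_comult_coeff [simp]: "poly (comult_coeff bn_U x y z) 1 = comult_coeff 1 x y z"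
  by (simp add: comult_coeff_def alg_comult_def alg_basis_def alg_X_def alg_one_def)

lemma poly_saddle_coeff [simp]:
  "poly (saddle_coeff bn_U c c' g g' p q p' q') 1 = saddle_coeff 1 c c' g g' p q p' q'"
  by (simp add: saddle_coeff_def)

lemma poly_edge_coeff [simp]:
  "poly (edge_coeff bn_U D g g' p q p' q') 1 = edge_coeff 1 D g g' p q p' q'"
  by (simp add: edge_coeff_def Let_def)

lemma alg_coeff_one [simp]: "alg_coeff alg_one z = (if z then 0 else 1)"
  by (simp add: alg_coeff_def alg_one_def)

lemma alg_counit_basis [simp]: "alg_counit (alg_basis z) = (if z then 1 else 0)"
  by (simp add: alg_counit_def alg_basis_def alg_X_def alg_one_def)


section \<open>Transport of resolutions\<close>

lemma finite_resolution: "g \<in> generators D \<Longrightarrow> finite (fst g)"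
  by (auto simp: generators_def intro: finite_subset[OF _ finite_crossings[of D]])

lemma agree_outside_transport:
  assumes "\<And>j. \<lbrakk>j < n; a + j \<in> r\<rbrakk> \<Longrightarrow> \<rho> j < n'"
  shows "agree_outside a n n' r (transport a n n' \<rho> r)"
  using assms by (force simp: agree_outside_def transport_def)

lemma mem_transport:
  assumes "j' < n'"
  shows "a + j' \<in> transport a n n' \<rho> r \<longleftrightarrow> (\<exists>j<n. \<rho> j = j' \<and> a + j \<in> r)"
  using assms by (auto simp: transport_def)

text \<open>
  Transport is an injective renumbering of the levels.
\<close>

lemma card_transport:
  assumes "finite r" "inj_on \<rho> {j. j < n \<and> a + j \<in> r}"
    and "\<And>j. \<lbrakk>j < n; a + j \<in> r\<rbrakk> \<Longrightarrow> \<rho> j < n'"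
  shows "card (transport a n n' \<rho> r) = card r"
proof -
  define f where "f = (\<lambda>l. if l < a then l else if l < a + n then a + \<rho> (l - a) else l - n + n')"
  have "transport a n n' \<rho> r = f ` r"
  proof (intro subset_antisym subsetI)
    fix l assume "l \<in> transport a n n' \<rho> r"
    then consider "l \<in> r" "l < a" | j where "l = a + \<rho> j" "j < n" "a + j \<in> r"
      | j where "l = a + n' + j" "a + n + j \<in> r" by (auto simp: transport_def)
    then show "l \<in> f ` r"
    proof cases
      case 1
      then show ?thesis by (intro image_eqI[of _ _ l]) (auto simp: f_def)
    next
      case (2 j)
      then show ?thesis by (intro image_eqI[of _ _ "a + j"]) (auto simp: f_def)
    next
      case (3 j)
      then show ?thesis by (intro image_eqI[of _ _ "a + n + j"]) (auto simp: f_def)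
    qed
  next
    fix l' assume "l' \<in> f ` r"
    then obtain l where l: "l \<in> r" "l' = f l" by blast
    consider "l < a" | j where "l = a + j" "j < n" | j where "l = a + n + j"
    proof -
      have "l < a \<or> l = a + (l - a) \<and> l - a < n \<or> l = a + n + (l - a - n)" by arith
      then show ?thesis using that by blast
    qed
    then show "l' \<in> transport a n n' \<rho> r"
      by cases (use l in \<open>auto simp: transport_def f_def\<close>)
  qed
  moreover have "inj_on f r"
  proof (rule inj_onI)
    fix l m assume lm: "l \<in> r" "m \<in> r" "f l = f m"
    have zone: "f k < a \<longleftrightarrow> k < a" "f k < a + n' \<longleftrightarrow> k < a + n" if "k \<in> r" for k
      using assms(3)[of "k - a"] that by (auto simp: f_def)
    have "l = m" if "a \<le> l" "l < a + n" "a \<le> m" "m < a + n"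
    proof -
      have "l - a = m - a" using that lm inj_onD[OF assms(2), of "l - a" "m - a"] by (auto simp: f_def)
      then show ?thesis using that by arith
    qed
    then show "l = m" using lm(3) zone[OF lm(1)] zone[OF lm(2)]
      by (cases "l < a"; cases "l < a + n"; cases "m < a"; cases "m < a + n"; simp add: f_def)
  qed
  ultimately show ?thesis by (simp add: card_image)
qed

lemma card_transport_insert: "finite r \<Longrightarrow> card (transport a 0 n' id r) = card r"
  by (rule card_transport) auto

lemma finite_transport:
  assumes "finite r" shows "finite (transport a 0 n' id r)"
proof -
  have "transport a 0 n' id r \<subseteq> r \<union> (\<lambda>l. l + n') ` r" by (force simp: transport_def image_iff)
  then show ?thesis using assms finite_subset by blast
qed

lemma agree_outside_insert:
  "agree_outside a n n' r r' \<Longrightarrow> j < n' \<Longrightarrow> agree_outside a n n' r (insert (a + j) r')"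
  by (auto simp: agree_outside_def)

lemma resolution_10_eq: "resolution_10 a k r = insert (a + (if k then 1 else 0)) (transport a 0 2 id r)"
  and resolution_01_eq: "resolution_01 a k r = insert (a + (if k then 0 else 1)) (transport a 0 2 id r)"
  by (simp_all add: resolution_10_def resolution_01_def)

lemma not_mem_transport_insert: "j < n' \<Longrightarrow> a + j \<notin> transport a 0 n' id r"
  by (simp add: mem_transport)

lemma resolution_10_01:
  assumes "finite r"
  shows "agree_outside a 0 2 r (resolution_10 a k r)" "card (resolution_10 a k r) = card r + 1"
    "a \<in> resolution_10 a k r \<longleftrightarrow> \<not> k" "a + 1 \<in> resolution_10 a k r \<longleftrightarrow> k"
    "agree_outside a 0 2 r (resolution_01 a k r)" "card (resolution_01 a k r) = card r + 1"
    "a \<in> resolution_01 a k r \<longleftrightarrow> k" "a + 1 \<in> resolution_01 a k r \<longleftrightarrow> \<not> k"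
proof -
  note agree = agree_outside_transport[of 0 a r id 2]
  note notin = not_mem_transport_insert[of 0 2 a r] not_mem_transport_insert[of 1 2 a r]
  note card = card_transport_insert[OF assms, of a 2] finite_transport[OF assms, of a 2]
  show "agree_outside a 0 2 r (resolution_10 a k r)" "agree_outside a 0 2 r (resolution_01 a k r)"
    unfolding resolution_10_eq resolution_01_eq by (intro agree_outside_insert agree; simp)+
  show "card (resolution_10 a k r) = card r + 1" "card (resolution_01 a k r) = card r + 1"
    unfolding resolution_10_eq resolution_01_eq using notin card by (cases k; simp)+
  show "a \<in> resolution_10 a k r \<longleftrightarrow> \<not> k" "a + 1 \<in> resolution_10 a k r \<longleftrightarrow> k"
    "a \<in> resolution_01 a k r \<longleftrightarrow> k" "a + 1 \<in> resolution_01 a k r \<longleftrightarrow> \<not> k"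
    unfolding resolution_10_eq resolution_01_eq using notin by (cases k; simp)+
qed


section \<open>The degrees of the maps\<close>

text \<open>
  A saddle lowers the label degree by 1, which is made up for by the additional 1-resolution.
\<close>

lemma graded_differential:
  assumes D: "diagram_fits 0 D"
  shows "graded_pair D D 0 (differential bn_U D s) (differential 1 D s)"
  unfolding differential_def
proof (rule graded_pair_linear_map, goal_cases)
  case (1 g g' n)
  let ?K = "\<lambda>l. case D ! l of
       Cross i k \<Rightarrow>
         if l \<notin> fst g \<and> fst g' = insert l (fst g) then
           of_int (s (fst g) (fst g')) *
           (if k then edge_coeff (bn_U :: 'a poly) D g g' (l, i) (l, i + 1) (l, i) (l + 1, i)
            else edge_coeff bn_U D g g' (l, i) (l + 1, i) (l, i) (l, i + 1))
         else 0
     | _ \<Rightarrow> 0"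
  from 1(3) have "(\<Sum>l<length D. coeff (?K l) n) \<noteq> 0" unfolding coeff_sum .
  then obtain l where l: "l < length D" "coeff (?K l) n \<noteq> 0"
    by (rule sum.not_neutral_contains_not_neutral) simp
  then obtain i k where D_l: "D ! l = Cross i k" by (cases "D ! l") auto
  then have r: "l \<notin> fst g" "fst g' = insert l (fst g)" using l(2) by (auto split: if_splits)
  let ?pq = "if k then ((l, i), (l, i + 1), (l, i), (Suc l, i)) else ((l, i), (Suc l, i), (l, i), (l, i + 1))"
  obtain p q p' q' where pq: "(p, q, p', q') = ?pq" by (cases ?pq) metis
  have "coeff (edge_coeff (bn_U :: 'a poly) D g g' p q p' q') n \<noteq> 0"
    using l(2) D_l r pq by (auto simp: coeff_of_int_mult split: if_splits)
  from edge_coeff_degree[OF D l(1) D_l r 1(1,2) pq this] show ?case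
    using r finite_resolution[OF 1(1)] by (simp add: unsigned_degree_def)
qed (auto simp: poly_sum intro!: sum.cong split: slice.split)

lemma graded_sign_map: "graded_pair D D 0 (sign_map \<tau>) (sign_map \<tau>)"
  unfolding graded_pair_def sign_map_def
  by (auto simp: homogeneous_of_int set_one_def)

lemma graded_isotopy_map:
  assumes iso: "elementary_isotopy M M' \<rho>"
    and fits: "diagram_fits 0 (P @ M @ Q)" "diagram_fits 0 (P @ M' @ Q)"
      "diagram_width (diagram_width 0 P) M = diagram_width (diagram_width 0 P) M'"
  shows "graded_pair (P @ M @ Q) (P @ M' @ Q) 0
    (isotopy_map P M M' Q \<rho> :: 'f::field poly chain \<Rightarrow> _) (isotopy_map P M M' Q \<rho>)"
  unfolding isotopy_map_def Let_def
proof (rule graded_pair_linear_map, goal_cases)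
  case (1 g g' n)
  let ?a = "length P" and ?n = "length M" and ?n' = "length M'"
  note g = 1(1,2)
  have r': "fst g' = transport ?a ?n ?n' \<rho> (fst g)" and same: "same_outside ?a ?n ?n' {} g g'" and n: "n = 0"
    using coeff_of_bool[OF 1(3)] by simp_all
  have range: "\<rho> j < ?n'" if j: "j < ?n" "?a + j \<in> fst g" for j
  proof -
    have "?a + j \<in> crossings (P @ M @ Q)" using g(1) j by (auto simp: generators_def)
    then obtain i k where "M ! j = Cross i k" using j by (auto simp: crossings_def nth_append)
    then show ?thesis using isotopy_range[OF iso j(1)] by blast
  qed
  have inj: "inj_on \<rho> {j. j < ?n \<and> ?a + j \<in> fst g}"
  proof (rule inj_onI)
    fix j j' assume j: "j \<in> {j. j < ?n \<and> ?a + j \<in> fst g}" "j' \<in> {j. j < ?n \<and> ?a + j \<in> fst g}" "\<rho> j = \<rho> j'"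
    then have "\<rho> j < ?n'" using range by blast
    then show "j = j'"
      using isotopy_involution[OF iso, of j "\<rho> j"] isotopy_involution[OF iso, of j' "\<rho> j"] j
      by (metis (no_types, lifting) mem_Collect_eq)
  qed
  have rep: "replacement P M M' Q (fst g) (fst g')"
    using fits agree_outside_transport[OF range] by (simp add: replacement_def r')
  have bits: "(?a + j \<in> fst g) = (?a + j' \<in> fst g')" if j: "j < ?n" "j' < ?n'" "\<rho> j = j'" for j j'
  proof -
    have "j1 = j" if "j1 < ?n" "\<rho> j1 = j'" for j1
      using isotopy_involution[OF iso that(1) j(2)] isotopy_involution[OF iso j(1,2)] that(2) j(3) by metis
    then show ?thesis unfolding r' mem_transport[OF j(2)] using j by blast
  qed
  have "fits (diagram_width 0 P) (resolve ?a M (fst g))" "fits (diagram_width 0 P) (resolve ?a M' (fst g'))"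
    using fits by simp_all
  then have "equivalent (diagram_width 0 P) (resolve ?a M (fst g)) (resolve ?a M' (fst g'))"
    unfolding resolve_def using bits by (intro equivalent_isotopy[OF iso]) auto
  from equivalent_label_degree[OF rep this g same] show ?case
    using card_transport[OF finite_resolution[OF g(1)] inj range] by (simp add: unsigned_degree_def r' n)
qed simp

text \<open>
  The middle crossing of a third move, when 0-resolved, is a pair of straight strands.
\<close>

lemma vertical_crossing_degree:
  assumes fits: "diagram_fits 0 (P @ [Cross i True] @ Q)"
    and g: "g \<in> generators (P @ Q)" "g' \<in> generators (P @ [Cross i True] @ Q)"
    and r: "fst g' = transport (length P) 0 1 id (fst g)" and same: "same_outside (length P) 0 1 {} g g'"
  shows "unsigned_degree (P @ Q) g = unsigned_degree (P @ [Cross i True] @ Q) g'"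
proof -
  have rep: "replacement P [] [Cross i True] Q (fst g) (fst g')"
    using fits agree_outside_transport[of 0 "length P" "fst g" id 1] by (simp add: replacement_def r)
  have "equivalent (diagram_width 0 P) (resolve (length P) [] (fst g)) (resolve (length P) [Cross i True] (fst g'))"
    using fits not_mem_transport_insert[of 0 1 "length P" "fst g"] equivalent_vertical[of i "diagram_width 0 P" True False]
      equivalent_sym by (simp add: r)
  from equivalent_label_degree[OF rep this] g same show ?thesis
    using card_transport_insert[OF finite_resolution[OF g(1)]] by (simp add: unsigned_degree_def r)
qed

lemma same_outside_mono: "same_outside a n n' {} g g' \<Longrightarrow> same_outside a n n' S g g'"
  by (auto simp: same_outside_def)

lemma R1_curl_degree:
  assumes fits: "diagram_fits 0 (add_curl P i b k Q)"
    and g: "g \<in> generators (P @ Q)" "g' \<in> generators (add_curl P i b k Q)"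
    and r: "fst g' = (if k then transport (length P) 0 3 id (fst g) else R1_neg_resolution (length P) (fst g))"
    and same: "same_outside (length P) 0 3 (circle (P @ Q) (fst g) (length P, i)) g g'"
  shows "unsigned_degree (P @ Q) g - weight (has_X g (length P, i))
    = unsigned_degree (add_curl P i b k Q) g' - (if k then 0 else 1)
      - weight (has_X g' (length P, i)) - weight (has_X g' (length P + 1, i + 1))"
proof -
  let ?a = "length P"
  note agree = agree_outside_transport[of 0 ?a "fst g" id 3]
  have notin: "?a + 1 \<notin> transport ?a 0 3 id (fst g)" by (rule not_mem_transport_insert) simp
  have fits0: "diagram_fits 0 (P @ Q)"
    using fits by (simp add: add_curl_def curl_def)
  have "agree_outside ?a 0 3 (fst g) (fst g')" "k \<longleftrightarrow> ?a + 1 \<notin> fst g'"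
    using agree notin agree_outside_insert[OF agree, of 1] by (simp_all add: r R1_neg_resolution_def)
  moreover have "card (fst g') = card (fst g) + (if k then 0 else 1)"
    using notin finite_transport card_transport_insert finite_resolution[OF g(1)]
    by (simp add: r R1_neg_resolution_def)
  moreover have "has_X g x = has_X g' x'"
    if "corresponds ?a 0 3 x x'" "circle (P @ Q) (fst g) x \<noteq> circle (P @ Q) (fst g) (?a, i)" for x x'
  proof -
    have "x \<notin> circle (P @ Q) (fst g) (?a, i)"
      using that(2) by (auto simp: circle_component component_eq_iff[symmetric])
    then show ?thesis using same[unfolded same_outside_iff, rule_format, of x x'] that(1) by blast
  qed
  ultimately show ?thesis
    using curl_label_degree[OF fits0 fits g] by (simp add: unsigned_degree_def)
qed

text \<open>
  The element \<open>m (\<Delta> 1) = 2 X - U\<close> is homogeneous of degree -1, as is the map \<open>\<Delta>\<close>.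
\<close>

lemma mult_comult_one_degree:
  assumes "coeff (of_bool (x = y) * mult_comult_one_coeff (bn_U :: 'f::field poly) z - comult_coeff bn_U x y z) n \<noteq> 0"
  shows "weight x = weight y + weight z - 2 * int n + 1"
proof (cases "coeff (comult_coeff (bn_U :: 'f poly) x y z) n = 0")
  case True
  then have "x = y" "coeff (mult_comult_one_coeff (bn_U :: 'f poly) z) n \<noteq> 0"
    using assms by (cases "x = y"; simp)+
  then have "x = y \<and> n = (if z then 0 else 1)"
    using coeff_bn_U[of n, where 'f = 'f]
    by (auto simp: mult_comult_one_coeff_def UNIV_bool alg_comult_def mult_coeff_def alg_coeff_def
        alg_mult_def alg_basis_def alg_X_def alg_one_def coeff_1 split: if_splits)
  then show ?thesis by (auto simp: weight_def)
qed (rule comult_coeff_degree)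

lemma poly_mult_comult_one [simp]: "poly (mult_comult_one_coeff bn_U z) 1 = mult_comult_one_coeff 1 z"
  by (simp add: mult_comult_one_coeff_def UNIV_bool alg_comult_def alg_one_def)

lemma graded_R1_pos:
  assumes fits: "diagram_fits 0 (add_curl P i b True Q)"
  shows "graded_pair (P @ Q) (add_curl P i b True Q) (-1)
    (R1_pos_map (bn_U :: 'f::field poly) P i b Q) (R1_pos_map 1 P i b Q)"
  unfolding R1_pos_map_def Let_def
proof (rule graded_pair_linear_map, goal_cases)
  case (1 g g' n)
  let ?x = "has_X g (length P, i)" and ?y = "has_X g' (length P, i)" and ?z = "has_X g' (length P + 1, i + 1)"
  from 1(3) have r: "fst g' = transport (length P) 0 3 id (fst g)"
    and same: "same_outside (length P) 0 3 (circle (P @ Q) (fst g) (length P, i)) g g'"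
    by (auto split: if_splits)
  then have "coeff (of_bool (?x = ?y) * mult_comult_one_coeff (bn_U :: 'f poly) ?z - comult_coeff bn_U ?x ?y ?z) n \<noteq> 0"
    using 1(3) by (simp only: simp_thms if_True)
  from mult_comult_one_degree[OF this] R1_curl_degree[OF fits 1(1,2) _ same] r show ?case by simp
qed simp

lemma graded_R1_pos_inv:
  assumes fits: "diagram_fits 0 (add_curl P i b True Q)"
  shows "graded_pair (add_curl P i b True Q) (P @ Q) 1
    (R1_pos_inv_map P i b Q :: 'f::field poly chain \<Rightarrow> _) (R1_pos_inv_map P i b Q)"
  unfolding R1_pos_inv_map_def Let_def
proof (rule graded_pair_linear_map, goal_cases)
  case (1 g g' n)
  from 1(3) have r: "fst g = transport (length P) 0 3 id (fst g')" and same: "same_outside (length P) 0 3 {} g' g"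
    and "has_X g (length P + 1, i + 1)" "n = 0"
    by (auto simp: same_outside_sym[of _ 3 0] coeff_1 split: if_splits)
  moreover have "has_X g' (length P, i) = has_X g (length P, i)"
    using same by (simp add: same_outside_def)
  moreover have "same_outside (length P) 0 3 (circle (P @ Q) (fst g') (length P, i)) g' g"
    using same by (rule same_outside_mono)
  ultimately show ?case using R1_curl_degree[OF fits 1(2,1)] by (simp add: weight_def)
qed simp

lemma graded_R1_neg:
  assumes fits: "diagram_fits 0 (add_curl P i b False Q)"
  shows "graded_pair (P @ Q) (add_curl P i b False Q) 2
    (R1_neg_map P i b Q :: 'f::field poly chain \<Rightarrow> _) (R1_neg_map P i b Q)"
  unfolding R1_neg_map_def Let_def
proof (rule graded_pair_linear_map, goal_cases)
  case (1 g g' n)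
  from 1(3) have r: "fst g' = R1_neg_resolution (length P) (fst g)" and same: "same_outside (length P) 0 3 {} g g'"
    and "\<not> has_X g' (length P + 1, i + 1)" "n = 0"
    by (auto simp: coeff_1 split: if_splits)
  moreover have "has_X g (length P, i) = has_X g' (length P, i)"
    using same by (simp add: same_outside_def)
  moreover have "same_outside (length P) 0 3 (circle (P @ Q) (fst g) (length P, i)) g g'"
    using same by (rule same_outside_mono)
  ultimately show ?case using R1_curl_degree[OF fits 1(1,2)] by (simp add: weight_def)
qed simp

lemma vertical_bigon_degree:
  assumes fits: "diagram_fits 0 (add_bigon P i k Q)"
    and g: "g \<in> generators (P @ Q)" "g' \<in> generators (add_bigon P i k Q)"
    and r: "fst g' = resolution_10 (length P) k (fst g)" and same: "same_outside (length P) 0 2 {} g g'"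
  shows "unsigned_degree (add_bigon P i k Q) g' = unsigned_degree (P @ Q) g + 1"
proof -
  let ?M = "[Cross i k, Cross i (\<not> k)]"
  note r10 = resolution_10_01[OF finite_resolution[OF g(1)], of "length P" k]
  have rep: "replacement P [] ?M Q (fst g) (fst g')"
    using fits r10(1) by (simp add: replacement_def r add_bigon_def numeral_2_eq_2)
  have "equivalent (diagram_width 0 P) (resolve (length P) [] (fst g)) (resolve (length P) ?M (fst g'))"
    using fits r10(3,4) equivalent_bigon[of i "diagram_width 0 P" k] equivalent_sym by (simp add: r add_bigon_def)
  from equivalent_label_degree[OF rep this] g same show ?thesis
    using r10(2) by (simp add: unsigned_degree_def r add_bigon_def numeral_2_eq_2)
qed

text \<open>
  The component of the second move maps on the 01-resolution, up to the contributions of the small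
  circle and of the circles that take part in the saddle.  The latter are excluded on either side,
  which makes the lemma fit both directions of the move.
\<close>

lemma horizontal_bigon_degree:
  assumes fits: "diagram_fits 0 (add_bigon P i k Q)"
    and g: "g \<in> generators (P @ Q)" "g' \<in> generators (add_bigon P i k Q)"
    and r: "fst g' = resolution_01 (length P) k (fst g)"
    and same: "same_outside (length P) 0 2 (circle (P @ Q) (fst g) (length P, i) \<union> circle (P @ Q) (fst g) (length P, i + 1)) g g'
      \<or> same_outside (length P) 2 0 (circle (add_bigon P i k Q) (fst g') (length P, i)
          \<union> circle (add_bigon P i k Q) (fst g') (length P + 2, i)) g' g"
  shows "unsigned_degree (P @ Q) g - degree_on (P @ Q) g {(length P, i), (length P, i + 1)}
    = unsigned_degree (add_bigon P i k Q) g' - 1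
      - degree_on (add_bigon P i k Q) g' {(length P, i), (length P + 2, i)}
      - weight (has_X g' (length P + 1, i))"
proof -
  note r01 = resolution_10_01(5-8)[OF finite_resolution[OF g(1)], of "length P" k, folded r]
  have "has_X g x = has_X g' x'"
    if x: "corresponds (length P) 0 2 x x'" "x \<in> points (P @ Q)"
      "circle (P @ Q) (fst g) x \<notin> circle (P @ Q) (fst g) ` {(length P, i), (length P, i + 1)}" for x x'
  proof -
    have "circle (add_bigon P i k Q) (fst g') x'
        \<notin> circle (add_bigon P i k Q) (fst g') ` {(length P, i), (length P + 2, i)}"
      using bigon_affected[OF fits r01(1,3,4) x(1,2)] x(3) by blast
    then have "x \<notin> circle (P @ Q) (fst g) (length P, i) \<union> circle (P @ Q) (fst g) (length P, i + 1)"
      "x' \<notin> circle (add_bigon P i k Q) (fst g') (length P, i) \<union> circle (add_bigon P i k Q) (fst g') (length P + 2, i)"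
      using x(3) by (auto simp: circle_component component_eq_iff[symmetric])
    then show ?thesis
      using same[unfolded same_outside_iff] x(1) corresponds_sym[of "length P" 0 2 x x'] by blast
  qed
  from bigon_label_degree[OF fits g r01(1,3,4) this] show ?thesis
    using r01(2) by (simp add: unsigned_degree_def)
qed

text \<open>
  The additional 1-resolution raises the degree by 1.  In the 01-component, the label 1 of the small
  circle and the saddle cancel.
\<close>

lemma graded_R2:
  assumes fits: "diagram_fits 0 (add_bigon P i k Q)"
  shows "graded_pair (P @ Q) (add_bigon P i k Q) 1
    (R2_map (bn_U :: 'f::field poly) P i k Q \<tau>) (R2_map 1 P i k Q \<tau>)"
  unfolding R2_map_def Let_def
proof (rule graded_pair_linear_map, goal_cases)
  case (1 g g' n)
  let ?a = "length P"
  note g = 1(1,2)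
  show ?case
  proof (cases "fst g' = resolution_10 ?a k (fst g)")
    case True
    then have "same_outside ?a 0 2 {} g g'" "n = 0" using 1(3) coeff_of_bool by force+
    then show ?thesis using vertical_bigon_degree[OF fits g True] by simp
  next
    case False
    let ?c = "circle (P @ Q) (fst g)" and ?c' = "circle (add_bigon P i k Q) (fst g')"
    have r: "fst g' = resolution_01 ?a k (fst g)" and z: "\<not> has_X g' (?a + 1, i)"
      and same: "same_outside ?a 0 2 (?c (?a, i) \<union> ?c (?a, i + 1)) g g'"
      and S: "coeff (saddle_coeff (bn_U :: 'f poly) ?c ?c' g g' (?a, i) (?a, i + 1) (?a, i) (?a + 2, i)) n \<noteq> 0"
      using 1(3) False by (auto simp: coeff_of_int_mult split: if_splits)
    show ?thesis
      using horizontal_bigon_degree[OF fits g r] same saddle_coeff_degree[OF g S] z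
      by (simp add: weight_def)
  qed
qed simp

lemma graded_R2_inv:
  assumes fits: "diagram_fits 0 (add_bigon P i k Q)"
  shows "graded_pair (add_bigon P i k Q) (P @ Q) (-1)
    (R2_inv_map (bn_U :: 'f::field poly) P i k Q \<tau>) (R2_inv_map 1 P i k Q \<tau>)"
  unfolding R2_inv_map_def Let_def
proof (rule graded_pair_linear_map, goal_cases)
  case (1 g g' n)
  let ?a = "length P"
  note g = 1(1,2)
  show ?case
  proof (cases "fst g = resolution_10 ?a k (fst g')")
    case True
    then have "same_outside ?a 0 2 {} g' g" "n = 0"
      using 1(3) coeff_of_bool same_outside_sym[of ?a 2 0 g g'] by force+
    then show ?thesis using vertical_bigon_degree[OF fits g(2,1) True] by simp
  next
    case False
    let ?c = "circle (add_bigon P i k Q) (fst g)" and ?c' = "circle (P @ Q) (fst g')"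
    have r: "fst g = resolution_01 ?a k (fst g')" and z: "has_X g (?a + 1, i)"
      and same: "same_outside ?a 2 0 (?c (?a, i) \<union> ?c (?a + 2, i)) g g'"
      and S: "coeff (saddle_coeff (bn_U :: 'f poly) ?c ?c' g g' (?a, i) (?a + 2, i) (?a, i) (?a, i + 1)) n \<noteq> 0"
      using 1(3) False by (auto simp: coeff_of_int_mult split: if_splits)
    show ?thesis
      using horizontal_bigon_degree[OF fits g(2,1) r] same saddle_coeff_degree[OF g S] z
      by (simp add: weight_def)
  qed
qed (simp only: if_distrib[of "\<lambda>p. poly p 1"] poly_mult poly_of_int poly_of_bool poly_saddle_coeff
    alg_counit_basis poly_1 poly_0)


section \<open>The third move\<close>

lemma graded_pair_add:
  assumes "graded_pair D D' j \<Phi> \<phi>" "graded_pair D D' j \<Phi>' \<phi>'"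
  shows "graded_pair D D' j (\<lambda>x g. \<Phi> x g + \<Phi>' x g) (\<lambda>x g. \<phi> x g + \<phi>' x g)"
  using assms unfolding graded_pair_def
  by (intro conjI allI impI homogeneous_add) (auto simp: set_one_def fun_eq_iff)

lemma graded_pair_of_int:
  assumes "graded_pair D D' j \<Phi> \<phi>"
  shows "graded_pair D D' j (\<lambda>x g. of_int e * \<Phi> x g) (\<lambda>x g. of_int e * \<phi> x g)"
  using assms unfolding graded_pair_def
  by (intro conjI allI impI homogeneous_of_int) (auto simp: set_one_def fun_eq_iff)

lemma graded_one_part: "graded_pair D D 0 (one_part P) (one_part P)"
  by (auto simp: graded_pair_def one_part_def homogeneous_def set_one_def fun_eq_iff)

lemma graded_R3_from_zero:
  assumes fits: "diagram_fits 0 (add_triple P (p, k, q) Q)"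
  shows "graded_pair (R3_zero P (p, k, q) Q) (add_triple P (p, k, q) Q) 0
    (R3_from_zero P (p, k, q) Q :: 'f::field poly chain \<Rightarrow> _) (R3_from_zero P (p, k, q) Q)"
  unfolding R3_from_zero_def Let_def
proof (rule graded_pair_linear_map, goal_cases)
  case (1 g g' n)
  from coeff_of_bool[OF 1(3)] 1(1,2) fits show ?case
    using vertical_crossing_degree[of "P @ [Cross p k]" q "[Cross p (\<not> k)] @ Q" g g'] by (simp add: add_bigon_def)
qed simp

lemma graded_R3_to_zero:
  assumes fits: "diagram_fits 0 (add_triple P (p, k, q) Q)"
  shows "graded_pair (add_triple P (p, k, q) Q) (R3_zero P (p, k, q) Q) 0
    (R3_to_zero P (p, k, q) Q :: 'f::field poly chain \<Rightarrow> _) (R3_to_zero P (p, k, q) Q)"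
  unfolding R3_to_zero_def Let_def
proof (rule graded_pair_linear_map, goal_cases)
  case (1 g g' n)
  from coeff_of_bool[OF 1(3)] have "same_outside (length P + 1) 0 1 {} g' g"
    "fst g = transport (length P + 1) 0 1 id (fst g')" "n = 0"
    using same_outside_sym by blast+
  then show ?case
    using vertical_crossing_degree[of "P @ [Cross p k]" q "[Cross p (\<not> k)] @ Q" g' g] 1(1,2) fits
    by (simp add: add_bigon_def)
qed simp

lemma R3_saddle_comp:
  "R3_saddle u P T Q s = one_part P \<circ> (differential u (add_triple P T Q) s \<circ> R3_from_zero P T Q)"
  by (simp add: fun_eq_iff R3_saddle_def)

lemma graded_R3_saddle:
  assumes fits: "diagram_fits 0 (add_triple P (p, k, q) Q)"
  shows "graded_pair (R3_zero P (p, k, q) Q) (add_triple P (p, k, q) Q) 0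
    (R3_saddle (bn_U :: 'f::field poly) P (p, k, q) Q s) (R3_saddle 1 P (p, k, q) Q s)"
proof -
  note graded_pair_comp[OF graded_pair_comp[OF graded_R3_from_zero[OF fits] graded_differential[OF fits]] graded_one_part]
  then show ?thesis unfolding R3_saddle_comp by simp
qed

lemma graded_R3_homotopy:
  assumes "bn_graded_homotopy D H"
  shows "graded_pair D D 0 (linear_map D D H) (linear_map D D (set_U_one H))"
proof (rule graded_pair_linear_map, goal_cases)
  case (1 g g' n)
  then have "qdeg D g' - 2 * int n = qdeg D g" using assms unfolding bn_graded_homotopy_def by blast
  then show ?case by (simp add: qdeg_def unsigned_degree_def)
qed (simp add: set_U_one_def)

definition third_move_triples :: "triple \<Rightarrow> triple \<Rightarrow> bool" where
  "third_move_triples T T' \<longleftrightarrow> (\<exists>i. (T, T') = (triple i, triple' i) \<or> (T, T') = (triple' i, triple i))"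

text \<open>
  The 1-resolutions of the middle crossings agree up to the equivalence of tangles
  \<open>equivalent_third_move\<close>; labels and 1-resolved crossings correspond.
\<close>

lemma graded_R3_identification:
  assumes T: "third_move_triples T T'"
    and fits: "diagram_fits 0 (add_triple P T Q)" "diagram_fits 0 (add_triple P T' Q)"
  shows "graded_pair (add_triple P T Q) (add_triple P T' Q) 0
    (linear_map (add_triple P T Q) (add_triple P T' Q) (\<lambda>g g'.
        of_bool (length P + 1 \<in> fst g \<and> fst g' = fst g \<and> same_outside (length P) 3 3 {} g g')
        * of_int (\<tau>1 (fst g)) :: 'f::field poly))
    (linear_map (add_triple P T Q) (add_triple P T' Q) (\<lambda>g g'.
        of_bool (length P + 1 \<in> fst g \<and> fst g' = fst g \<and> same_outside (length P) 3 3 {} g g')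
        * of_int (\<tau>1 (fst g))))"
proof (rule graded_pair_linear_map, goal_cases)
  case (1 g g' n)
  let ?a = "length P"
  obtain p k q p' k' q' where TT': "T = (p, k, q)" "T' = (p', k', q')" by (cases T; cases T')
  let ?M = "[Cross p k, Cross q True, Cross p (\<not> k)]" and ?M' = "[Cross p' k', Cross q' True, Cross p' (\<not> k')]"
  have D: "add_triple P T Q = P @ ?M @ Q" "add_triple P T' Q = P @ ?M' @ Q" by (simp_all add: TT')
  from 1(3) have "coeff (of_bool (?a + 1 \<in> fst g \<and> fst g' = fst g \<and> same_outside ?a 3 3 {} g g') :: 'f poly) n \<noteq> 0"
    by (metis coeff_of_int_mult mult.commute mult_zero_right)
  from coeff_of_bool[OF this] have r: "?a + 1 \<in> fst g" "fst g' = fst g" and same: "same_outside ?a 3 3 {} g g'"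
    and n: "n = 0" by auto
  have rep: "replacement P ?M ?M' Q (fst g) (fst g')"
    using fits by (simp add: replacement_def D agree_outside_def r(2))
  have "equivalent (diagram_width 0 P) (resolve ?a ?M (fst g)) (resolve ?a ?M' (fst g'))"
    using T fits r equivalent_third_move equivalent_sym
    by (auto simp: third_move_triples_def TT' triple_def triple'_def)
  from equivalent_label_degree[OF rep this] 1(1,2) same show ?case
    by (simp add: D unsigned_degree_def r(2) n numeral_3_eq_3)
qed simp

text \<open>
  The passage to the base diagram lowers the degree by 1 and the way back raises it by 1, while the
  homotopy and the saddle have degree 0.
\<close>

lemma graded_R3_maps:
  assumes maps: "R3_maps P T T' Q s s' \<Phi> \<phi>" and T: "third_move_triples T T'"
    and fits: "diagram_fits 0 (add_triple P T Q)" "diagram_fits 0 (add_triple P T' Q)"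
  shows "graded_pair (add_triple P T Q) (add_triple P T' Q) 0 \<Phi> (\<phi> :: 'f::field chain \<Rightarrow> _)"
proof -
  obtain p k q p' k' q' where TT': "T = (p, k, q)" "T' = (p', k', q')" by (cases T; cases T')
  let ?D = "add_triple P T Q" and ?D' = "add_triple P T' Q" and ?E = "R3_zero P T Q" and ?E' = "R3_zero P T' Q"
  from maps obtain \<tau>f \<tau>g' \<tau>0 \<tau>1 e and H :: "generator \<Rightarrow> generator \<Rightarrow> 'f poly" where
    H: "bn_graded_homotopy ?E H"
    and \<Phi>: "\<Phi> = R3_Psi bn_U P T' Q \<tau>g' \<circ> R3_identify P T T' Q \<tau>0 \<tau>1
             \<circ> R3_Phi bn_U P T Q s \<tau>f (linear_map ?E ?E H) e"
    and \<phi>: "\<phi> = R3_Psi 1 P T' Q \<tau>g' \<circ> R3_identify P T T' Q \<tau>0 \<tau>1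
             \<circ> R3_Phi 1 P T Q s \<tau>f (linear_map ?E ?E (set_U_one H)) e"
    unfolding R3_maps_def R3_homotopy_def Let_def by blast
  have fits_E: "diagram_fits 0 ?E" "diagram_fits 0 ?E'" using fits by (simp_all add: TT' add_bigon_def)
  define L :: "'f poly chain \<Rightarrow> 'f poly chain" where "L = linear_map ?D ?D' (\<lambda>g g'.
        of_bool (length P + 1 \<in> fst g \<and> fst g' = fst g \<and> same_outside (length P) 3 3 {} g g')
        * of_int (\<tau>1 (fst g)))"
  define L1 :: "'f chain \<Rightarrow> 'f chain" where "L1 = linear_map ?D ?D' (\<lambda>g g'.
        of_bool (length P + 1 \<in> fst g \<and> fst g' = fst g \<and> same_outside (length P) 3 3 {} g g')
        * of_int (\<tau>1 (fst g)))"
  have L: "graded_pair ?D ?D' 0 L L1"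
    unfolding L_def L1_def by (rule graded_R3_identification[OF T fits])
  let ?A = "\<lambda>u. R3_from_zero P T' Q \<circ> (R3_g u P T' Q \<tau>g' \<circ> (sign_map \<tau>0 \<circ> (R3_f u P T Q \<tau>f \<circ> R3_to_zero P T Q)))"
  have base: "graded_pair (P @ Q) ?E' 1 (R3_g (bn_U :: 'f poly) P T' Q \<tau>g') (R3_g 1 P T' Q \<tau>g')"
    "graded_pair ?E (P @ Q) (-1) (R3_f (bn_U :: 'f poly) P T Q \<tau>f) (R3_f 1 P T Q \<tau>f)"
    using graded_R2[of P p' k' Q \<tau>g'] graded_R2_inv[of P p k Q \<tau>f] fits_E by (simp_all add: TT')
  have zero: "graded_pair ?D ?E 0 (R3_to_zero P T Q :: 'f poly chain \<Rightarrow> _) (R3_to_zero P T Q)"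
    "graded_pair ?E' ?D' 0 (R3_from_zero P T' Q :: 'f poly chain \<Rightarrow> _) (R3_from_zero P T' Q)"
    "graded_pair ?E ?D 0 (R3_saddle (bn_U :: 'f poly) P T Q s) (R3_saddle 1 P T Q s)"
    using graded_R3_to_zero[of P p k q Q] graded_R3_from_zero[of P p' k' q' Q] graded_R3_saddle[of P p k q Q s]
      fits unfolding TT' by blast+
  have A: "graded_pair ?D ?D' 0 (?A (bn_U :: 'f poly)) (?A 1)"
    using graded_pair_comp[OF graded_pair_comp[OF graded_pair_comp[OF graded_pair_comp[OF
      zero(1) base(2)] graded_sign_map] base(1)] zero(2)] by simp
  let ?B = "\<lambda>u h x g. one_part P x g + of_int e * (R3_saddle u P T Q s \<circ> (h \<circ> R3_to_zero P T Q)) x g"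
  have "graded_pair ?D ?D 0 (R3_saddle (bn_U :: 'f poly) P T Q s \<circ> (linear_map ?E ?E H \<circ> R3_to_zero P T Q))
      (R3_saddle 1 P T Q s \<circ> (linear_map ?E ?E (set_U_one H) \<circ> R3_to_zero P T Q))"
    using graded_pair_comp[OF graded_pair_comp[OF zero(1) graded_R3_homotopy[OF H]] zero(3)] by simp
  then have B: "graded_pair ?D ?D 0 (?B (bn_U :: 'f poly) (linear_map ?E ?E H)) (?B 1 (linear_map ?E ?E (set_U_one H)))"
    by (rule graded_pair_add[OF graded_one_part graded_pair_of_int])
  have \<Phi>_eq: "\<Phi> = (\<lambda>x g. ?A bn_U x g + (L \<circ> ?B bn_U (linear_map ?E ?E H)) x g)"
    by (simp add: \<Phi> fun_eq_iff R3_Psi_def R3_identify_def R3_Phi_def L_def Let_def)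
  have \<phi>_eq: "\<phi> = (\<lambda>x g. ?A 1 x g + (L1 \<circ> ?B 1 (linear_map ?E ?E (set_U_one H))) x g)"
    by (simp add: \<phi> fun_eq_iff R3_Psi_def R3_identify_def R3_Phi_def L1_def Let_def)
  from graded_pair_comp[OF B L] have "graded_pair ?D ?D' 0 (L \<circ> ?B bn_U (linear_map ?E ?E H))
      (L1 \<circ> ?B 1 (linear_map ?E ?E (set_U_one H)))" by simp
  from graded_pair_add[OF A this] show ?thesis unfolding \<Phi>_eq \<phi>_eq .
qed


section \<open>Signs of the crossings\<close>

fun crossing_sign :: "int \<Rightarrow> slice \<Rightarrow> bool list \<Rightarrow> int" where
  "crossing_sign v (Cross i k) st = (if k = (st ! i = st ! (i + 1)) then 1 else v)"
| "crossing_sign v (Cup i b) st = 0"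
| "crossing_sign v (Cap i) st = 0"

text \<open>
  For \<open>v = -1\<close> this gives the writhe, for \<open>v = -2\<close> the contribution of the signs of the crossings
  to the quantum degree.
\<close>

fun crossing_total :: "int \<Rightarrow> bool list \<Rightarrow> diagram \<Rightarrow> int" where
  "crossing_total v st [] = 0"
| "crossing_total v st (s # M) = crossing_sign v s st + crossing_total v (slice_step s st) M"

fun oriented_fits :: "bool list \<Rightarrow> diagram \<Rightarrow> bool" where
  "oriented_fits st [] = True"
| "oriented_fits st (s # M) \<longleftrightarrow> slice_fits s st \<and> oriented_fits (slice_step s st) M"

lemma crossing_total_append [simp]:
  "crossing_total v st (M @ N) = crossing_total v st M + crossing_total v (fold slice_step M st) N"
  by (induction M arbitrary: st) auto

lemma oriented_fits_append [simp]:
  "oriented_fits st (M @ N) \<longleftrightarrow> oriented_fits st M \<and> oriented_fits (fold slice_step M st) N"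
  by (induction M arbitrary: st) auto

lemma oriented_fitsI:
  "(\<And>l. l < length M \<Longrightarrow> slice_fits (M ! l) (fold slice_step (take l M) st)) \<Longrightarrow> oriented_fits st M"
proof (induction M arbitrary: st)
  case (Cons s M)
  have "slice_fits s st" using Cons.prems[of 0] by simp
  moreover have "oriented_fits (slice_step s st) M"
    by (rule Cons.IH) (use Cons.prems[of "Suc _"] in simp)
  ultimately show ?case by simp
qed simp

lemma link_diagram_oriented_fits: "link_diagram D \<Longrightarrow> oriented_fits [] D"
  using oriented_fitsI[of D "[]"] by (auto simp: link_diagram_def strands_def)

lemma crossing_total_sum:
  "crossing_total v st M = (\<Sum>l<length M. crossing_sign v (M ! l) (fold slice_step (take l M) st))"
  by (induction M arbitrary: st) (simp_all add: sum.lessThan_Suc_shift del: sum.lessThan_Suc)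

lemma crossing_total_card:
  "crossing_total v [] D = int (card (pos_crossings D)) + v * int (card (neg_crossings D))"
proof -
  have "crossing_sign v (D ! l) (strands D l) = (if l \<in> pos_crossings D then 1 else 0)
      + v * (if l \<in> neg_crossings D then 1 else 0)" if "l < length D" for l
    using that by (cases "D ! l")
      (auto simp: pos_crossings_def neg_crossings_def crossings_def positive_crossing_def)
  then have "crossing_total v [] D = (\<Sum>l<length D. (if l \<in> pos_crossings D then 1 else 0)
      + v * (if l \<in> neg_crossings D then 1 else 0))"
    by (simp add: crossing_total_sum strands_def)
  also have "\<dots> = (\<Sum>l<length D. if l \<in> pos_crossings D then 1 else 0)
      + v * (\<Sum>l<length D. if l \<in> neg_crossings D then 1 else 0)"
    by (simp only: sum.distrib sum_distrib_left)
  finally have total: "crossing_total v [] D = \<dots>" .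
  have count: "(\<Sum>l<length D. if l \<in> S then 1 else 0) = int (card S)" if "S \<subseteq> {..<length D}" for S
    using that by (simp add: sum.If_cases Int_absorb1)
  have "pos_crossings D \<subseteq> {..<length D}" "neg_crossings D \<subseteq> {..<length D}"
    by (auto simp: pos_crossings_def neg_crossings_def crossings_def)
  then show ?thesis using total by (simp only: count)
qed

lemma split_strands:
  assumes "i < length st"
  obtains A s C where "st = A @ s # C" "length A = i"
  using that[OF id_take_nth_drop[OF assms]] assms by simp

lemma split_two_strands:
  assumes "i + 1 < length st"
  obtains A s t C where "st = A @ s # t # C" "length A = i"
proof -
  have "i < length st" using assms by simp
  then obtain A s C where 1: "st = A @ s # C" "length A = i" by (rule split_strands)
  then obtain t C' where "C = t # C'" using assms by (cases C) auto
  then show ?thesis using 1 that by blast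
qed

lemma split_three_strands:
  assumes "i + 2 < length st"
  obtains A s t u C where "st = A @ s # t # u # C" "length A = i"
proof -
  have "i + 1 < length st" using assms by simp
  then obtain A s t C where 1: "st = A @ s # t # C" "length A = i" by (rule split_two_strands)
  then obtain u C' where "C = u # C'" using assms by (cases C) auto
  then show ?thesis using 1 that by blast
qed

lemma slice_step_left:
  assumes "position s + strands_below s \<le> length A"
  shows "slice_step s (A @ B) = slice_step s A @ B" "crossing_sign v s (A @ B) = crossing_sign v s A"
  using assms by (cases s; simp add: list_update_append nth_append numeral_2_eq_2)+

lemma slice_step_right:
  assumes "j = length A" "strands_below s \<le> length B"
  shows "slice_step (at_position s j) (A @ B) = A @ slice_step (at_position s 0) B"
    "crossing_sign v (at_position s j) (A @ B) = crossing_sign v (at_position s 0) B"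
  using assms by (cases s; simp add: list_update_append nth_append numeral_2_eq_2)+

lemma slice_fits_width: "slice_fits s st \<Longrightarrow> position s + strands_below s \<le> length st"
  by (cases s) auto

lemma length_slice_step:
  "position s + strands_below s \<le> length st \<Longrightarrow>
     length (slice_step s st) = length st - strands_below s + strands_above s"
  by (cases s) auto

text \<open>
  With the list of strands split at the position of a slice, orientations and signs are computed by
  rewriting alone.
\<close>

lemma strand_simps:
  "slice_step (Cup (length A) b) (A @ C) = A @ b # (\<not> b) # C"
  "slice_step (Cup (Suc (length A)) b) (A @ s # C) = A @ s # b # (\<not> b) # C"
  "slice_step (Cap (length A)) (A @ s # t # C) = A @ C"
  "slice_step (Cap (Suc (length A))) (A @ r # s # t # C) = A @ r # C"
  "slice_step (Cross (length A) k) (A @ s # t # C) = A @ t # s # C"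
  "slice_step (Cross (Suc (length A)) k) (A @ r # s # t # C) = A @ r # t # s # C"
  "slice_fits (Cap (length A)) (A @ s # t # C) \<longleftrightarrow> s \<noteq> t"
  "slice_fits (Cap (Suc (length A))) (A @ r # s # t # C) \<longleftrightarrow> s \<noteq> t"
  "crossing_sign v (Cross (length A) k) (A @ s # t # C) = (if k = (s = t) then 1 else v)"
  "crossing_sign v (Cross (Suc (length A)) k) (A @ r # s # t # C) = (if k = (s = t) then 1 else v)"
  by (simp_all add: nth_append list_update_append)

lemmas strand_rules = strand_simps oriented_fits.simps crossing_total.simps crossing_sign.simps(2,3)
  fold_simps add_0 add_0_right add_Suc_right One_nat_def simp_thms if_True if_False

text \<open>
  Sliding two distant slices past each other does not change what either of them meets.  When a crossing
  is turned, over- and under-strand are swapped relative to the vertical direction, and so is the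
  relative orientation of the strands, because one of them now runs the other way.
\<close>

lemma isotopy_signs:
  assumes "elementary_isotopy M M' \<rho>" "oriented_fits st M" "oriented_fits st M'"
  shows "fold slice_step M st = fold slice_step M' st \<and> crossing_total v st M = crossing_total v st M'"
  using assms
proof (induction arbitrary: st)
  case (exchange x y j)
  let ?J = "position x + strands_below x + j"
  define A B where "A = take ?J st" and "B = drop ?J st"
  have "slice_fits (at_position y ?J) st" using exchange(2) by simp
  then have "?J + strands_below y \<le> length st" using slice_fits_width by fastforce
  then have st: "st = A @ B" "length A = ?J" "strands_below y \<le> length B"
    by (simp_all add: A_def B_def)
  then have A: "position x + strands_below x \<le> length A" by simp
  have "length (slice_step x A) = position x + strands_above x + j"
    using length_slice_step[OF A] st(2) by simp
  then show ?case
    using slice_step_left[OF A] slice_step_right[of "position x + strands_above x + j" "slice_step x A" y B]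
      slice_step_right[of ?J A y B] st by simp
next
  case (zigzag_right i b)
  then have "i < length st" by auto
  then obtain A s C where st: "st = A @ s # C" "i = length A" by (rule split_strands) simp
  show ?case using zigzag_right(1) unfolding st by (auto simp only: strand_rules)
next
  case (zigzag_left i b)
  then have "i < length st" by auto
  then obtain A s C where st: "st = A @ s # C" "i = length A" by (rule split_strands) simp
  show ?case using zigzag_left(1) unfolding st by (auto simp only: strand_rules)
next
  case (turn_cup i b k)
  then have "i < length st" by auto
  then obtain A s C where st: "st = A @ s # C" "i = length A" by (rule split_strands) simp
  show ?case unfolding st by (cases s; cases b; cases k; simp only: strand_rules)
next
  case (turn_cap i k)
  then have "i + 2 < length st" by auto
  then obtain A s t u C where st: "st = A @ s # t # u # C" "i = length A" by (rule split_three_strands) simp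
  show ?case using turn_cap(1) unfolding st by (cases s; cases t; cases u; cases k; simp only: strand_rules)
next
  case (reverse M M' \<rho>)
  then show ?case by simp
qed

text \<open>
  Closing the curl with a maximum forces the orientation of its minimum, hence the sign.
\<close>

lemma curl_signs:
  assumes "oriented_fits st (curl i b k)"
  shows "fold slice_step (curl i b k) st = st" "crossing_total v st (curl i b k) = (if k then 1 else v)"
proof -
  have "slice_fits (Cup (i + 1) b) st" using assms unfolding curl_def by (simp only: oriented_fits.simps)
  then have "i < length st" by simp
  then obtain A s C where st: "st = A @ s # C" "i = length A" by (rule split_strands) simp
  show "fold slice_step (curl i b k) st = st" "crossing_total v st (curl i b k) = (if k then 1 else v)"
    using assms unfolding st curl_def by (cases s; cases b; cases k; simp only: strand_rules)+
qed

lemma bigon_signs: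
  assumes "i + 1 < length st"
  shows "fold slice_step [Cross i k, Cross i (\<not> k)] st = st"
    "crossing_total v st [Cross i k, Cross i (\<not> k)] = 1 + v"
proof -
  from assms obtain A s t C where st: "st = A @ s # t # C" "i = length A" by (rule split_two_strands) simp
  show "fold slice_step [Cross i k, Cross i (\<not> k)] st = st"
    "crossing_total v st [Cross i k, Cross i (\<not> k)] = 1 + v"
    unfolding st by (cases s; cases t; cases k; simp only: strand_rules add.commute)+
qed

lemma triple_signs:
  assumes "i + 2 < length st"
  shows "fold slice_step [Cross (i + 1) False, Cross i True, Cross (i + 1) True] st
      = fold slice_step [Cross i True, Cross (i + 1) True, Cross i False] st"
    "crossing_total v st [Cross (i + 1) False, Cross i True, Cross (i + 1) True]
      = crossing_total v st [Cross i True, Cross (i + 1) True, Cross i False]"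
proof -
  from assms obtain A s t u C where st: "st = A @ s # t # u # C" "i = length A" by (rule split_three_strands) simp
  show "fold slice_step [Cross (i + 1) False, Cross i True, Cross (i + 1) True] st
      = fold slice_step [Cross i True, Cross (i + 1) True, Cross i False] st"
    "crossing_total v st [Cross (i + 1) False, Cross i True, Cross (i + 1) True]
      = crossing_total v st [Cross i True, Cross (i + 1) True, Cross i False]"
    unfolding st by (auto simp only: strand_rules)
qed


section \<open>Sequences of moves\<close>

text \<open>The quantum degree is \<open>unsigned_degree D g + crossing_total (-2) [] D\<close>.\<close>

definition quantum_pair ::
  "diagram \<Rightarrow> diagram \<Rightarrow> ('f::field poly chain \<Rightarrow> 'f poly chain) \<Rightarrow> ('f chain \<Rightarrow> 'f chain) \<Rightarrow> bool" where
  "quantum_pair D D' \<Phi> \<phi> \<longleftrightarrow>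
     graded_pair D D' (crossing_total (-2) [] D - crossing_total (-2) [] D') \<Phi> \<phi>"

lemma quantum_pair_id: "quantum_pair D D id id"
  by (simp add: quantum_pair_def graded_pair_id)

lemma quantum_pair_comp:
  assumes "quantum_pair D D' \<Phi> \<phi>" "quantum_pair D' D'' \<Phi>' \<phi>'"
  shows "quantum_pair D D'' (\<Phi>' \<circ> \<Phi>) (\<phi>' \<circ> \<phi>)"
  using graded_pair_comp[OF assms[unfolded quantum_pair_def]] by (simp add: quantum_pair_def)

lemma quantum_R2_maps:
  assumes "link_diagram (add_bigon P i k Q)"
  shows "quantum_pair (add_bigon P i k Q) (P @ Q) (R2_inv_map (bn_U :: 'f::field poly) P i k Q \<tau>) (R2_inv_map 1 P i k Q \<tau>)"
    and "quantum_pair (P @ Q) (add_bigon P i k Q) (R2_map (bn_U :: 'f::field poly) P i k Q \<tau>) (R2_map 1 P i k Q \<tau>)"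
proof -
  have fits: "diagram_fits 0 (add_bigon P i k Q)" using assms by (rule link_diagram_fits)
  have "i + 1 < length (fold slice_step P [])"
    using link_diagram_oriented_fits[OF assms] by (simp add: add_bigon_def)
  then have "crossing_total (-2) [] (add_bigon P i k Q) = crossing_total (-2) [] (P @ Q) - 1"
    using bigon_signs(1)[of i "fold slice_step P []" k] bigon_signs(2)[of i "fold slice_step P []" "-2" k] by (simp add: add_bigon_def)
  then show "quantum_pair (add_bigon P i k Q) (P @ Q) (R2_inv_map (bn_U :: 'f::field poly) P i k Q \<tau>) (R2_inv_map 1 P i k Q \<tau>)"
    "quantum_pair (P @ Q) (add_bigon P i k Q) (R2_map (bn_U :: 'f::field poly) P i k Q \<tau>) (R2_map 1 P i k Q \<tau>)"
    using graded_R2_inv[OF fits] graded_R2[OF fits] by (simp_all add: quantum_pair_def)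
qed

lemma curl_total:
  assumes "link_diagram (add_curl P i b k Q)"
  shows "crossing_total v [] (add_curl P i b k Q) = crossing_total v [] (P @ Q) + (if k then 1 else v)"
proof -
  have "oriented_fits (fold slice_step P []) (curl i b k)"
    using link_diagram_oriented_fits[OF assms] by (simp add: add_curl_def)
  from curl_signs[OF this] show ?thesis by (simp add: add_curl_def)
qed

lemma quantum_R1_pos:
  assumes "link_diagram (add_curl P i b True Q)"
  shows "quantum_pair (P @ Q) (add_curl P i b True Q) (R1_pos_map (bn_U :: 'f::field poly) P i b Q) (R1_pos_map 1 P i b Q)"
  using graded_R1_pos[OF link_diagram_fits[OF assms]] curl_total[OF assms] by (simp add: quantum_pair_def)

lemma triple_total:
  assumes "diagram_fits 0 (add_triple P (triple i) Q)"
  shows "crossing_total v [] (add_triple P (triple i) Q) = crossing_total v [] (add_triple P (triple' i) Q)"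
proof -
  have "length (fold slice_step P []) = diagram_width 0 P"
    using assms length_fold_slice_step[of "[]" P] by (simp add: triple_def)
  then have "i + 2 < length (fold slice_step P [])" using assms by (simp add: triple_def)
  from triple_signs[OF this] show ?thesis by (simp add: triple_def triple'_def)
qed

lemma quantum_single_move:
  fixes \<Phi> :: "'f::field poly chain \<Rightarrow> 'f poly chain" and \<phi> :: "'f chain \<Rightarrow> 'f chain"
  assumes "single_move_maps m A B \<Phi> \<phi>"
  shows "quantum_pair (fst A) (fst B) \<Phi> \<phi>"
  using assms
proof induction
  case (sign_change D s s' \<tau>)
  then show ?case by (simp add: quantum_pair_def graded_sign_map)
next
  case (isotopy M M' \<rho> D P Q D' s s')
  then have links: "link_diagram (P @ M @ Q)" "link_diagram (P @ M' @ Q)" by auto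
  let ?st = "fold slice_step P []"
  have "oriented_fits ?st M" "oriented_fits ?st M'"
    using links[THEN link_diagram_oriented_fits] by simp_all
  note signs = isotopy_signs[OF isotopy(1) this]
  note fits = links[THEN link_diagram_fits]
  have "length ?st = diagram_width 0 P" using fits length_fold_slice_step[of "[]" P] by simp
  then have "diagram_width (diagram_width 0 P) M = diagram_width (diagram_width 0 P) M'"
    using fits length_fold_slice_step[of ?st M] length_fold_slice_step[of ?st M'] signs by simp
  from graded_isotopy_map[OF isotopy(1) fits this] show ?case
    using signs isotopy(2,3) by (simp add: quantum_pair_def)
next
  case (R1_pos D' P i b Q s s')
  then show ?case using quantum_R1_pos by auto
next
  case (R1_pos_inv D' P i b Q s s')
  then have "link_diagram (add_curl P i b True Q)" by simp
  then show ?case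
    using graded_R1_pos_inv[OF link_diagram_fits] curl_total R1_pos_inv(1) by (simp add: quantum_pair_def)
next
  case (R1_neg D' P i b Q s s')
  then have "link_diagram (add_curl P i b False Q)" by simp
  then show ?case
    using graded_R1_neg[OF link_diagram_fits] curl_total R1_neg(1) by (simp add: quantum_pair_def)
next
  case (R2 D' P i k Q s s' \<tau>)
  then show ?case using quantum_R2_maps(2) by auto
next
  case (R2_inv D' P i k Q s s' \<tau>)
  then show ?case using quantum_R2_maps(1) by auto
next
  case (R3 D P i Q D' ty s s' \<Phi> \<phi>)
  then have fits: "diagram_fits 0 (add_triple P (triple i) Q)" "diagram_fits 0 (add_triple P (triple' i) Q)"
    using link_diagram_fits by auto
  have "third_move_triples (triple i) (triple' i)" by (auto simp: third_move_triples_def)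
  from graded_R3_maps[OF R3(6) this fits] show ?case
    using triple_total[OF fits(1)] R3(1,2) by (simp add: quantum_pair_def)
next
  case (R3_inv D P i Q D' ty s s' \<Phi> \<phi>)
  then have fits: "diagram_fits 0 (add_triple P (triple i) Q)" "diagram_fits 0 (add_triple P (triple' i) Q)"
    using link_diagram_fits by auto
  have "third_move_triples (triple' i) (triple i)" by (auto simp: third_move_triples_def)
  from graded_R3_maps[OF R3_inv(6) this fits(2,1)] show ?case
    using triple_total[OF fits(1)] R3_inv(1,2) by (simp add: quantum_pair_def)
qed

lemma single_move_links: "single_move_maps m A B \<Phi> \<phi> \<Longrightarrow> signed_link_diagram A \<and> signed_link_diagram B"
  by (induction rule: single_move_maps.induct) auto

lemma quantum_isotopy_sequence:
  fixes \<Phi> :: "'f::field poly chain \<Rightarrow> 'f poly chain" and \<phi> :: "'f chain \<Rightarrow> 'f chain"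
  assumes "isotopy_sequence_maps A B \<Phi> \<phi>"
  shows "quantum_pair (fst A) (fst B) \<Phi> \<phi> \<and> signed_link_diagram A \<and> signed_link_diagram B"
  using assms
proof induction
  case (1 A)
  then show ?case using quantum_pair_id by blast
next
  case (2 A B \<Phi> \<phi> m C \<Phi>' \<phi>')
  then show ?case
    using quantum_pair_comp[OF _ quantum_single_move[OF "2.hyps"(3)]] single_move_links[OF "2.hyps"(3)] by blast
qed

lemma quantum_reidemeister:
  fixes \<Phi> :: "'f::field poly chain \<Rightarrow> 'f poly chain" and \<phi> :: "'f chain \<Rightarrow> 'f chain"
  assumes "reidemeister_maps \<Sigma> A B \<Phi> \<phi>"
  shows "quantum_pair (fst A) (fst B) \<Phi> \<phi> \<and> signed_link_diagram A \<and> signed_link_diagram B"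
  using assms
proof induction
  case (no_move A)
  then show ?case using quantum_pair_id by blast
next
  case (single_move m A B \<Phi> \<phi> \<Sigma> C \<Phi>' \<phi>')
  then show ?case
    using quantum_pair_comp[OF quantum_single_move[OF single_move.hyps(1)]]
      single_move_links[OF single_move.hyps(1)] by blast
next
  case (R1_neg_inv D P i b Q s s1 D1 \<Phi>1 \<phi>1 D2 s2 \<Phi>2 \<phi>2 \<tau> \<Phi>3 \<phi>3 D3 s4 \<Phi>4 \<phi>4 \<Sigma> C \<Phi>' \<phi>')
  let ?P = "P @ [Cup (i + 1) b]" and ?Q = "[Cross i False, Cap (i + 1)] @ Q"
  let ?P' = "P @ [Cup i b]" and ?Q' = "[Cup (i + 3) (\<not> b), Cap (i + 2), Cap (i + 1)] @ Q"
  have D: "D = ?P @ ?Q" and D3: "D3 = ?P' @ ?Q'"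
    unfolding R1_neg_inv.hyps(1,13) by (simp_all add: add_curl_def curl_def)
  have iso: "quantum_pair D1 D2 \<Phi>2 \<phi>2" "link_diagram D2" "quantum_pair D3 (P @ Q) \<Phi>4 \<phi>4"
    using quantum_isotopy_sequence[OF R1_neg_inv.hyps(9)] quantum_isotopy_sequence[OF R1_neg_inv.hyps(14)] by auto
  have "link_diagram D1" using R1_neg_inv.hyps(5) by simp
  then have "quantum_pair D D1 \<Phi>1 \<phi>1"
    using quantum_R1_pos[of ?P "i + 2" "\<not> b" ?Q] unfolding D R1_neg_inv.hyps(3,6,7) by simp
  moreover have "quantum_pair D2 D3 \<Phi>3 \<phi>3"
    using quantum_R2_maps(1)[of ?P' "i + 1" True ?Q' \<tau>] iso(2) unfolding D3 R1_neg_inv.hyps(8,11,12) by simp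
  ultimately have "quantum_pair D (fst C) (\<Phi>' \<circ> (\<Phi>4 \<circ> \<Phi>3 \<circ> \<Phi>2 \<circ> \<Phi>1)) (\<phi>' \<circ> (\<phi>4 \<circ> \<phi>3 \<circ> \<phi>2 \<circ> \<phi>1))"
    using quantum_pair_comp[OF quantum_pair_comp[OF quantum_pair_comp[OF quantum_pair_comp[OF _ iso(1)]] iso(3)]]
      R1_neg_inv.IH unfolding comp_assoc by simp
  then show ?case using R1_neg_inv.hyps(4) R1_neg_inv.IH unfolding fst_conv by blast
qed

lemma quantum_markov:
  fixes \<Phi> :: "'f::field poly chain \<Rightarrow> 'f poly chain" and \<phi> :: "'f chain \<Rightarrow> 'f chain"
  assumes "markov_maps \<Lambda> A A' \<Phi> \<phi>"
  shows "quantum_pair (braid_closure (fst A)) (braid_closure (fst A')) \<Phi> \<phi> \<and>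
    link_diagram (braid_closure (fst A)) \<and> link_diagram (braid_closure (fst A'))"
  using assms
proof induction
  case (1 B s)
  then show ?case
    using quantum_pair_id unfolding fst_conv signed_link_diagram.simps by blast
next
  case (2 B B1 K \<Sigma> s s1 \<Phi> \<phi> \<Lambda> B' s' \<Phi>' \<phi>')
  from 2 show ?case
    using quantum_reidemeister[OF "2.hyps"(5)] quantum_pair_comp
    unfolding fst_conv signed_link_diagram.simps by blast
qed


section \<open>Closures of braids\<close>

text \<open>
  The closure of a braid with \<open>n\<close> strands and \<open>m\<close> letters has \<open>2 n + m\<close> slices.  At level \<open>l\<close> it
  has \<open>half_width n m l\<close> upward strands, followed by as many downward strands.
\<close>

definition half_width :: "nat \<Rightarrow> nat \<Rightarrow> nat \<Rightarrow> nat" where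
  "half_width n m l = (if l \<le> n then l else if l \<le> n + m then n else 2 * n + m - l)"

lemma length_braid_closure [simp]: "length (braid_closure B) = 2 * fst B + length (snd B)"
  by (simp add: braid_closure_def)

text \<open>
  In the last part, the maximum at level \<open>l\<close> joins the two innermost of the remaining strands.
\<close>

lemma nth_braid_closure:
  assumes "l < 2 * fst B + length (snd B)"
  shows "braid_closure B ! l = (if l < fst B then Cup l True
    else if l < fst B + length (snd B)
      then Cross (fst (snd B ! (l - fst B)) - 1) (snd (snd B ! (l - fst B)))
    else Cap (half_width (fst B) (length (snd B)) l - 1))"
  using assms
  by (auto simp: braid_closure_def nth_append half_width_def rev_nth case_prod_beta split: if_splits)

lemma braid_letter:
  assumes "is_braid B" "k < length (snd B)"
  shows "1 \<le> fst (snd B ! k)" "fst (snd B ! k) < fst B"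
  using assms nth_mem[of k "snd B"] by (auto simp: is_braid_def case_prod_beta)

lemma braid_strands:
  assumes B: "is_braid B" and l: "l \<le> length (braid_closure B)"
  defines "h \<equiv> half_width (fst B) (length (snd B))"
  shows "strands (braid_closure B) l = replicate (h l) True @ replicate (h l) False"
  using l
proof (induction l)
  case 0
  then show ?case by (simp add: strands_def h_def half_width_def)
next
  case (Suc l)
  let ?n = "fst B" and ?m = "length (snd B)"
  have IH: "strands (braid_closure B) l = replicate (h l) True @ replicate (h l) False"
    using Suc by simp
  have l: "l < 2 * ?n + ?m" using Suc.prems by simp
  have step: "strands (braid_closure B) (Suc l) = slice_step (braid_closure B ! l) (strands (braid_closure B) l)"
    using l by (simp add: strands_def take_Suc_conv_app_nth)
  consider "l < ?n" | "?n \<le> l" "l < ?n + ?m" | "?n + ?m \<le> l" by linarith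
  then show ?case
  proof cases
    case 1
    then have "h l = l" "h (Suc l) = Suc l" by (auto simp: h_def half_width_def)
    then show ?thesis
      using 1 l by (simp add: step IH nth_braid_closure replicate_app_Cons_same)
  next
    case 2
    then have h: "h l = ?n" "h (Suc l) = ?n" by (auto simp: h_def half_width_def)
    let ?i = "fst (snd B ! (l - ?n)) - 1" and ?st = "replicate ?n True @ replicate ?n False"
    have i: "?i + 1 < ?n" using braid_letter[OF B, of "l - ?n"] 2 by linarith
    then have "?st ! ?i = True" "?st ! (?i + 1) = True" by (simp_all add: nth_append)
    then have "?st[?i := ?st ! (?i + 1), ?i + 1 := ?st ! ?i] = ?st"
      by (metis list_update_id)
    then show ?thesis using 2 l by (simp add: step IH h nth_braid_closure)
  next
    case 3
    then have h: "h l = Suc (h (Suc l))" using l by (auto simp: h_def half_width_def)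
    have "slice_step (Cap k) (replicate (Suc k) True @ replicate (Suc k) False)
        = replicate k True @ replicate k False" for k
      by (simp del: replicate_Suc)
    moreover have "braid_closure B ! l = Cap (h (Suc l))"
      using 3 l h nth_braid_closure[OF l] by (simp flip: h_def)
    ultimately show ?thesis unfolding step IH h by simp
  qed
qed

lemma positive_crossing_closure:
  assumes B: "is_braid B" and l: "fst B \<le> l" "l < fst B + length (snd B)"
  shows "positive_crossing (braid_closure B) l \<longleftrightarrow> snd (snd B ! (l - fst B))"
    and "l \<in> crossings (braid_closure B)"
proof -
  let ?i = "fst (snd B ! (l - fst B)) - 1"
  have "?i + 1 < fst B" using braid_letter[OF B, of "l - fst B"] l by linarith
  moreover have "strands (braid_closure B) l = replicate (fst B) True @ replicate (fst B) False"
    using braid_strands[OF B, of l] l by (auto simp: half_width_def)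
  ultimately show "positive_crossing (braid_closure B) l \<longleftrightarrow> snd (snd B ! (l - fst B))"
    using l by (simp add: positive_crossing_def nth_braid_closure nth_append)
  show "l \<in> crossings (braid_closure B)" using l by (simp add: crossings_def nth_braid_closure)
qed

lemma crossings_closure: "l \<in> crossings (braid_closure B) \<Longrightarrow> fst B \<le> l \<and> l < fst B + length (snd B)"
  by (auto simp: crossings_def nth_braid_closure split: if_splits)

lemma writhe_total:
  assumes B: "is_braid B"
  shows "crossing_total (-1) [] (braid_closure B) = writhe B"
proof -
  let ?D = "braid_closure B" and ?n = "fst B"
  have "crossing_total (-1) [] ?D = int (card (pos_crossings ?D)) - int (card (neg_crossings ?D))"
    by (simp add: crossing_total_card)
  also have "pos_crossings ?D = (\<lambda>k. ?n + k) ` {k. k < length (snd B) \<and> snd (snd B ! k)}"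
    using positive_crossing_closure[OF B] crossings_closure[of _ B]
    by (auto simp: pos_crossings_def image_iff) (metis le_add_diff_inverse less_diff_conv2 add.commute)
  also have "neg_crossings ?D = (\<lambda>k. ?n + k) ` {k. k < length (snd B) \<and> \<not> snd (snd B ! k)}"
    using positive_crossing_closure[OF B] crossings_closure[of _ B]
    by (auto simp: neg_crossings_def image_iff) (metis le_add_diff_inverse less_diff_conv2 add.commute)
  also have "int (card ((\<lambda>k. ?n + k) ` {k. k < length (snd B) \<and> snd (snd B ! k)}))
      - int (card ((\<lambda>k. ?n + k) ` {k. k < length (snd B) \<and> \<not> snd (snd B ! k)}))
    = int (length (filter snd (snd B))) - int (length (filter (\<lambda>x. \<not> snd x) (snd B)))"
    by (simp add: card_image length_filter_conv_card)
  also have "\<dots> = writhe B"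
  proof -
    have "int (length (filter snd w)) - int (length (filter (\<lambda>x. \<not> snd x) w))
        = (\<Sum>(i, b)\<leftarrow>w. if b then 1 else -1)" for w :: "(nat \<times> bool) list"
      by (induction w) auto
    then show ?thesis by (simp add: writhe_def)
  qed
  finally show ?thesis .
qed


section \<open>The circles of the oriented resolution of a closed braid\<close>

text \<open>
  In the oriented resolution of a closed braid every crossing is vertical, whence the circles are nested
  and correspond to the strands.
\<close>

lemma braid_circles:
  assumes B: "is_braid B"
  defines "D \<equiv> braid_closure B"
  shows "card (circles D (oriented_resolution D)) = fst B"
proof -
  let ?n = "fst B" and ?m = "length (snd B)" and ?r = "oriented_resolution D"
  let ?c = "circle D ?r"
  define h where "h = half_width ?n ?m"
  have width: "length (strands D l) = 2 * h l" if "l \<le> 2 * ?n + ?m" for l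
    using braid_strands[OF B, of l] that by (simp add: D_def h_def)
  have points: "points D = {(l, p). l \<le> 2 * ?n + ?m \<and> p < 2 * h l}"
    using width by (auto simp: points_def D_def)
  have nth: "D ! l = (if l < ?n then Cup l True
    else if l < ?n + ?m then Cross (fst (snd B ! (l - ?n)) - 1) (snd (snd B ! (l - ?n)))
    else Cap (h l - 1))" if "l < 2 * ?n + ?m" for l
    using nth_braid_closure[OF that] by (simp add: D_def h_def)
  have vertical: "snd (snd B ! (l - ?n)) \<longleftrightarrow> l \<notin> ?r" if "?n \<le> l" "l < ?n + ?m" for l
    using positive_crossing_closure[OF B that] by (simp add: oriented_resolution_def neg_crossings_def D_def)
  \<comment> \<open>The points of the \<open>j\<close>-th circle are the \<open>j\<close>-th ones from the left or from the right of a level.\<close>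
  define col where "col = (\<lambda>(l, p). if p < h l then p else 2 * h l - 1 - p)"
  have slice: "slice_bonds (D ! l) (l \<in> ?r) l (length (strands D l)) =
      (if l < ?n then slice_bonds (Cup l True) False l (2 * l)
       else if l < ?n + ?m then {((l, p), (l + 1, p)) | p. p < 2 * ?n}
       else slice_bonds (Cap (h l - 1)) False l (2 * h l))" if l: "l < 2 * ?n + ?m" for l
  proof -
    consider "l < ?n" | "?n \<le> l" "l < ?n + ?m" | "?n + ?m \<le> l" by linarith
    then show ?thesis
    proof cases
      case 1
      then have "h l = l" by (simp add: h_def half_width_def)
      then show ?thesis using 1 l by (simp add: nth width)
    next
      case 2
      then have "h l = ?n" by (auto simp: h_def half_width_def)
      then show ?thesis using 2 l vertical[OF 2] by (simp add: nth width)
    next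
      case 3
      then show ?thesis using l by (simp add: nth width)
    qed
  qed
  have col_bond: "col u = col v" if uv_bond: "(u, v) \<in> bonds D ?r" for u v
  proof -
    obtain l where l: "l < 2 * ?n + ?m" and uv: "(u, v) \<in> slice_bonds (D ! l) (l \<in> ?r) l (length (strands D l))"
      using uv_bond by (auto simp: bonds_def D_def)
    consider "l < ?n" | "?n \<le> l" "l < ?n + ?m" | "?n + ?m \<le> l" by linarith
    then show ?thesis
    proof cases
      case 1
      then have "h l = l" "h (Suc l) = Suc l" by (auto simp: h_def half_width_def)
      then show ?thesis using 1 uv l unfolding slice[OF l] by (auto simp: col_def)
    next
      case 2
      then have "h l = ?n" "h (Suc l) = ?n" by (auto simp: h_def half_width_def)
      then show ?thesis using 2 uv l unfolding slice[OF l] by (auto simp: col_def)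
    next
      case 3
      then have "h l = Suc (h (Suc l))" using l by (auto simp: h_def half_width_def)
      then show ?thesis using 3 uv l unfolding slice[OF l] by (auto simp: col_def)
    qed
  qed
  have up: "?c (l, j) = ?c (Suc l, j)" "?c (l, 2 * h l - 1 - j) = ?c (Suc l, 2 * h (Suc l) - 1 - j)"
    if l: "l < 2 * ?n + ?m" and j: "j < h l" "j < h (Suc l)" for l j
  proof -
    have bond: "?c u = ?c v" if "(u, v) \<in> slice_bonds (D ! l) (l \<in> ?r) l (length (strands D l))" for u v
      using circle_bond[of l D] that l by (simp add: D_def)
    consider "l < ?n" | "?n \<le> l" "l < ?n + ?m" | "?n + ?m \<le> l" by linarith
    then have "((l, j), (Suc l, j)) \<in> slice_bonds (D ! l) (l \<in> ?r) l (length (strands D l)) \<and>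
      ((l, 2 * h l - 1 - j), (Suc l, 2 * h (Suc l) - 1 - j)) \<in> slice_bonds (D ! l) (l \<in> ?r) l (length (strands D l))"
    proof cases
      case 1
      then have "h l = l" "h (Suc l) = Suc l" by (auto simp: h_def half_width_def)
      then show ?thesis using 1 j unfolding slice[OF l] by auto
    next
      case 2
      then have "h l = ?n" "h (Suc l) = ?n" by (auto simp: h_def half_width_def)
      then show ?thesis using 2 j unfolding slice[OF l] by auto
    next
      case 3
      then have "h l = Suc (h (Suc l))" using l by (auto simp: h_def half_width_def)
      then show ?thesis using 3 j unfolding slice[OF l] by auto
    qed
    then show "?c (l, j) = ?c (Suc l, j)" "?c (l, 2 * h l - 1 - j) = ?c (Suc l, 2 * h (Suc l) - 1 - j)"
      using bond by blast+
  qed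
  have range: "j < h l \<longleftrightarrow> Suc j \<le> l \<and> l + Suc j \<le> 2 * ?n + ?m" if "j < ?n" for j l
    using that by (auto simp: h_def half_width_def)
  have base: "?c (l, j) = ?c (Suc j, j) \<and> ?c (l, 2 * h l - 1 - j) = ?c (Suc j, Suc j)"
    if j: "j < ?n" and l: "Suc j \<le> l" "l + Suc j \<le> 2 * ?n + ?m" for l j
    using l
  proof (induction l rule: nat_induct_at_least)
    case base
    have "h (Suc j) = Suc j" using j by (simp add: h_def half_width_def)
    then show ?case by simp
  next
    case (Suc l)
    then show ?case using up[of l j] range[OF j, of l] range[OF j, of "Suc l"] by simp
  qed
  have join: "?c (Suc j, j) = ?c (Suc j, Suc j)" if "j < ?n" for j
    using that slice[of j] by (intro circle_bond[of j D]) (auto simp: D_def)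
  have h_le: "h l \<le> ?n" for l by (auto simp: h_def half_width_def)
  have rep: "?c z = ?c (Suc (col z), col z) \<and> col z < ?n" if z: "z \<in> points D" for z
  proof -
    obtain l p where lp: "z = (l, p)" "l \<le> 2 * ?n + ?m" "p < 2 * h l" using z by (auto simp: points)
    define j where "j = col z"
    have j: "j < h l" "p = j \<or> p = 2 * h l - 1 - j" using lp by (auto simp: j_def col_def)
    then have n: "j < ?n" using h_le[of l] by simp
    then have "?c z = ?c (Suc j, j)"
      using base[OF n, of l] range[OF n, of l] join[OF n] j lp(1) by auto
    then show ?thesis using n by (simp add: j_def)
  qed
  have "circles D ?r = (\<lambda>j. ?c (Suc j, j)) ` {..<?n}"
  proof
    show "circles D ?r \<subseteq> (\<lambda>j. ?c (Suc j, j)) ` {..<?n}"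
      using rep by (auto simp: circles_def)
    have "(Suc j, j) \<in> points D" if "j < ?n" for j
      using that by (auto simp: points h_def half_width_def)
    then show "(\<lambda>j. ?c (Suc j, j)) ` {..<?n} \<subseteq> circles D ?r" by (auto simp: circles_def)
  qed
  moreover have "inj_on (\<lambda>j. ?c (Suc j, j)) {..<?n}"
  proof (rule inj_onI)
    fix j j' assume j: "j \<in> {..<?n}" "j' \<in> {..<?n}" "?c (Suc j, j) = ?c (Suc j', j')"
    have "col (Suc j, j) = col (Suc j', j')"
      by (rule component_invariant[OF j(3)[unfolded circle_component] col_bond])
    moreover have "col (Suc j, j) = j" if "j < ?n" for j
      using that by (simp add: col_def h_def half_width_def)
    ultimately show "j = j'" using j by simp
  qed
  ultimately show ?thesis by (simp add: card_image)
qed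


section \<open>The invariants are homogeneous\<close>

text \<open>
  Degrees are additive in products, for factors \<open>f \<gamma>\<close> that complement the degree \<open>w \<gamma>\<close> of a label to -1.
\<close>

lemma coeff_prod_degree:
  assumes "finite C" "\<And>\<gamma> n. \<lbrakk>\<gamma> \<in> C; coeff (f \<gamma> :: 'f::field poly) n \<noteq> 0\<rbrakk> \<Longrightarrow> w \<gamma> - 2 * int n = -1"
    and "coeff (prod f C) n \<noteq> 0"
  shows "sum w C - 2 * int n = - int (card C)"
  using assms
proof (induction C arbitrary: n rule: finite_induct)
  case empty
  then show ?case by (simp add: coeff_1 split: if_splits)
next
  case (insert \<gamma> C)
  have "(\<Sum>i\<le>n. coeff (f \<gamma>) i * coeff (prod f C) (n - i)) \<noteq> 0"
    using insert by (simp add: coeff_mult)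
  then obtain i where "i \<in> {..n}" "coeff (f \<gamma>) i * coeff (prod f C) (n - i) \<noteq> 0"
    by (rule sum.not_neutral_contains_not_neutral)
  then have i: "i \<le> n" "coeff (f \<gamma>) i \<noteq> 0" "coeff (prod f C) (n - i) \<noteq> 0" by simp_all
  have "w \<gamma> - 2 * int i = -1" using insert.prems(1)[OF insertI1 i(2)] .
  moreover have "sum w C - 2 * int (n - i) = - int (card C)"
    using insert.IH[OF _ i(3)] insert.prems(1) by blast
  ultimately show ?case using insert.hyps i(1) by simp
qed

text \<open>Each circle contributes -1, as both \<open>X\<close> and \<open>X - U\<close> are homogeneous of that degree.\<close>

lemma enhanced_state_homogeneous:
  assumes D: "diagram_fits 0 D" and \<alpha>: "\<And>\<gamma>. \<alpha> \<gamma> \<in> {x_circ, x_bullet (bn_U :: 'f::field poly)}"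
  shows "homogeneous D (int (card r) - int (card (circles D r))) (enhanced_state D r \<alpha>)"
  unfolding homogeneous_def
proof (intro allI impI)
  fix g n assume coeff: "coeff (enhanced_state D r \<alpha> g) n \<noteq> 0"
  then have g: "fst g = r" "g \<in> generators D"
    and prod: "coeff (\<Prod>\<gamma>\<in>circles D r. alg_coeff (\<alpha> \<gamma>) (\<gamma> \<in> snd g)) n \<noteq> 0"
    by (auto simp: enhanced_state_def split: if_splits)
  have "(\<Sum>\<gamma>\<in>circles D r. if \<gamma> \<in> snd g then -1 else 1) - 2 * int n = - int (card (circles D r))"
  proof (rule coeff_prod_degree[OF finite_circles[OF D] _ prod])
    fix \<gamma> n assume "coeff (alg_coeff (\<alpha> \<gamma>) (\<gamma> \<in> snd g)) n \<noteq> 0"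
    then show "(if \<gamma> \<in> snd g then -1 else 1) - 2 * int n = -1"
      using \<alpha>[of \<gamma>] coeff_bn_U[of n, where 'f = 'f]
      by (auto simp: alg_coeff_def x_circ_def x_bullet_def alg_X_def alg_X_minus_def coeff_1 split: if_splits)
  qed
  then show "unsigned_degree D g - 2 * int n = int (card r) - int (card (circles D r))"
    by (simp add: unsigned_degree_def label_degree_def g(1))
qed

lemma set_one_enhanced_state:
  assumes "\<And>\<gamma> b. poly (alg_coeff (\<alpha> \<gamma>) b) 1 = alg_coeff (\<alpha>1 \<gamma>) b"
  shows "set_one (enhanced_state D r \<alpha>) = enhanced_state D r \<alpha>1"
proof
  fix g show "set_one (enhanced_state D r \<alpha>) g = enhanced_state D r \<alpha>1 g"
    by (cases "fst g = r \<and> g \<in> generators D")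
      (auto simp: set_one_def enhanced_state_def poly_prod assms)
qed

lemma homogeneous_states:
  assumes B: "is_braid B" and D: "diagram_fits 0 (braid_closure B)"
  defines "q \<equiv> sl B - crossing_total (-2) [] (braid_closure B)"
  shows "homogeneous (braid_closure B) q (\<beta> B :: 'f::field poly chain)"
    and "homogeneous (braid_closure B) q (\<beta>_bar B :: 'f poly chain)"
proof -
  let ?D = "braid_closure B"
  have "q = int (card (oriented_resolution ?D)) - int (card (circles ?D (oriented_resolution ?D)))"
    using writhe_total[OF B] braid_circles[OF B]
    by (simp add: q_def sl_def crossing_total_card oriented_resolution_def)
  then have state: "homogeneous ?D q (enhanced_state ?D (oriented_resolution ?D) \<alpha>)"
    if "\<And>\<gamma>. \<alpha> \<gamma> \<in> {x_circ, x_bullet (bn_U :: 'f poly)}" for \<alpha>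
    using enhanced_state_homogeneous[OF D that, of "oriented_resolution ?D"] by simp
  show "homogeneous ?D q (\<beta> B :: 'f poly chain)"
    unfolding \<beta>_def plus_state_def Let_def by (rule state) simp
  show "homogeneous ?D q (\<beta>_bar B :: 'f poly chain)"
    unfolding \<beta>_bar_def minus_state_def Let_def by (rule state) simp
qed

lemma set_one_states: "set_one (\<beta> B) = \<psi>_plus B" "set_one (\<beta>_bar B) = \<psi>_minus B"
  unfolding \<beta>_def \<beta>_bar_def \<psi>_plus_def \<psi>_minus_def plus_state_def minus_state_def Let_def
  by (rule set_one_enhanced_state;
      simp add: alg_coeff_def x_circ_def x_bullet_def alg_X_def alg_X_minus_def)+

text \<open>
  The coefficients of a homogeneous chain are monomials with known exponents, so that nothing is
  lost by setting \<open>U = 1\<close>.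
\<close>

lemma set_one_inj:
  assumes "homogeneous D q x" "homogeneous D q y" "set_one x = set_one (y :: 'f::field poly chain)"
  shows "x = y"
proof
  fix g
  let ?p = "x g - y g"
  have exponent: "unsigned_degree D g - 2 * int n = q" if "coeff ?p n \<noteq> 0" for n
    using that assms(1,2) unfolding homogeneous_def by (metis coeff_diff diff_self)
  \<comment> \<open>all exponents that occur in \<open>?p\<close> agree, so that \<open>?p\<close> consists of its leading term\<close>
  have "?p = 0"
  proof (rule ccontr)
    assume "?p \<noteq> 0"
    then have lead: "coeff ?p (degree ?p) \<noteq> 0" by (rule leading_coeff_neq_0)
    have "coeff ?p i = 0" if "i \<noteq> degree ?p" for i
      using exponent[OF lead] exponent[of i] that by auto
    then have "?p = monom (coeff ?p (degree ?p)) (degree ?p)"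
      by (intro poly_eqI) simp
    then have "poly ?p 1 = coeff ?p (degree ?p)" by (metis mult.right_neutral poly_monom power_one)
    moreover have "poly ?p 1 = 0" using fun_cong[OF assms(3), of g] by (simp add: set_one_def)
    ultimately show False using lead by simp
  qed
  then show "x g = y g" by simp
qed

theorem proposition1p5:
  fixes B B' :: braid and s s' :: signs
    and \<Phi>\<^sub>\<Sigma> :: "'f::field poly chain \<Rightarrow> 'f poly chain" and \<phi>\<^sub>\<Sigma> :: "'f chain \<Rightarrow> 'f chain"
    and \<Lambda> :: "braid list" and \<Sigma> :: "move list"
  assumes "is_braid B" and "is_braid B'"
    and "sl B = sl B'"
    and "markov_maps \<Lambda> (B, s) (B', s') \<Phi>\<^sub>\<Sigma> \<phi>\<^sub>\<Sigma> \<or>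
         reidemeister_maps \<Sigma> (braid_closure B, s) (braid_closure B', s') \<Phi>\<^sub>\<Sigma> \<phi>\<^sub>\<Sigma>"
  shows "(\<Phi>\<^sub>\<Sigma> (\<beta> B) = \<beta> B' \<longleftrightarrow> \<phi>\<^sub>\<Sigma> (\<psi>_plus B) = \<psi>_plus B') \<and>
         (\<Phi>\<^sub>\<Sigma> (\<beta>_bar B) = \<beta>_bar B' \<longleftrightarrow> \<phi>\<^sub>\<Sigma> (\<psi>_minus B) = \<psi>_minus B')"
proof -
  let ?D = "braid_closure B" and ?D' = "braid_closure B'"
  have pair: "quantum_pair ?D ?D' \<Phi>\<^sub>\<Sigma> \<phi>\<^sub>\<Sigma>" and links: "link_diagram ?D" "link_diagram ?D'"
    using assms(4) quantum_markov[of \<Lambda> "(B, s)" "(B', s')" \<Phi>\<^sub>\<Sigma> \<phi>\<^sub>\<Sigma>]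
      quantum_reidemeister[of \<Sigma> "(?D, s)" "(?D', s')" \<Phi>\<^sub>\<Sigma> \<phi>\<^sub>\<Sigma>] by auto
  let ?q = "sl B - crossing_total (-2) [] ?D" and ?q' = "sl B' - crossing_total (-2) [] ?D'"
  have equivalence: "\<Phi>\<^sub>\<Sigma> x = y \<longleftrightarrow> \<phi>\<^sub>\<Sigma> (set_one x) = set_one y"
    if "homogeneous ?D ?q x" "homogeneous ?D' ?q' y" for x y
  proof -
    have "homogeneous ?D' ?q' (\<Phi>\<^sub>\<Sigma> x)"
      using pair that(1) assms(3) unfolding quantum_pair_def graded_pair_def by fastforce
    moreover have "set_one (\<Phi>\<^sub>\<Sigma> x) = \<phi>\<^sub>\<Sigma> (set_one x)"
      using pair by (simp add: quantum_pair_def graded_pair_def)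
    ultimately show ?thesis using set_one_inj[OF _ that(2)] by metis
  qed
  note D = links[THEN link_diagram_fits]
  show ?thesis
    using equivalence[OF homogeneous_states(1)[OF assms(1) D(1)] homogeneous_states(1)[OF assms(2) D(2)]]
      equivalence[OF homogeneous_states(2)[OF assms(1) D(1)] homogeneous_states(2)[OF assms(2) D(2)]]
    by (simp only: set_one_states)
qed

end
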